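(* Let $r\ge 1$ be an integer, let $\lambda/\mu$ be a skew partition with $\lambda=(\lambda_1\ge\dots\ge\lambda_r\ge 0)$, $\mu=(\mu_1\ge\dots\ge\mu_r\ge 0)$ and $\mu_i\le\lambda_i$ for all $i$, and let $f=(f_1,\dots,f_r)$, $g=(g_1,\dots,g_r)$ be sequences of positive integers. Let $G_{\lambda/\mu,[[f/g]]}(x)$ be the flagged skew Grothendieck polynomial defined by $$G_{\lambda/\mu,[[f/g]]}(x)=\det\left(\sum_{s=0}^\infty\binom{i-j}{s}\beta^s\,G^{[[f_i/g_j]]}_{\lambda_i-\mu_j-i+j+s}(x)\right)_{1\le i,j\le r}.$$ Then $G_{\lambda/\mu,[[f/g]]}(x)$ is equal to $$\langle -r|\left(\prod_{j:r\to 1}\psi^\ast_{\mu_j-j}\,e^{H^\ast(-\beta)}\,e^{-H(x^{[(g_j-1)/g_{j-1}]})}\right)\left(\prod_{i:1\to r}e^{H(x^{[f_i/(f_{i-1}+1)]})}\,\psi_{\lambda_i-i}\,e^{-H^\ast(-\beta)}\right)|-r\rangle,$$ where for the first indices we use the convention $x^{[f_1/(f_0+1)]}=x^{[f_1]}$ and $x^{[(g_1-1)/g_0]}=x^{[g_1-1]}$. Here, for noncommuting $P_1,\dots,P_r$, $\prod_{i:1\to r}P_i=P_1P_2\cdots P_r$ and $\prod_{j:r\to 1}P_j=P_r\cdots P_2P_1$.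
   Context: **Fermions and Fock space.** $\mathcal A$ is the $\mathbb C$-algebra generated by $\psi_n,\psi_n^\ast$ ($n\in\mathbb Z$) with relations $[\psi_m,\psi_n]_+=[\psi_m^\ast,\psi_n^\ast]_+=0$ and $[\psi_m,\psi_n^\ast]_+=\delta_{m,n}$, where $[A,B]_+=AB+BA$. The Fock space $\mathcal F=\mathcal A\cdot|0\rangle$ is the left $\mathcal A$-module generated by the vacuum vector $|0\rangle$ with $\psi_m|0\rangle=\psi_n^\ast|0\rangle=0$ for $m<0$, $n\ge 0$. The dual Fock space $\mathcal F^\ast=\langle 0|\cdot\mathcal A$ is the right $\mathcal A$-module generated by $\langle 0|$ with $\langle 0|\psi_n=\langle 0|\psi_m^\ast=0$ for $m<0$, $n\ge 0$. The vacuum expectation value is the unique $\mathbb C$-bilinear pairing $\mathcal F^\ast\otimes\mathcal F\to\mathbb C$, $\langle w|\otimes|v\rangle\mapsto\langle w|v\rangle$, with $\langle 0|0\rangle=1$, $(\langle w|\psi_n)|v\rangle=\langle w|(\psi_n|v\rangle)$ and $(\langle w|\psi_n^\ast)|v\rangle=\langle w|(\psi_n^\ast|v\rangle)$; write $\langle w|X|v\rangle$ for the common value $(\langle w|X)|v\rangle=\langle w|(X|v\rangle)$. For $r\ge 1$ the shifted vacua are $|-r\rangle=\psi^\ast_{-r}\cdots\psi^\ast_{-2}\psi^\ast_{-1}|0\rangle$ and $\langle -r|=\langle 0|\psi_{-1}\psi_{-2}\cdots\psi_{-r}$. **Vertex operators.** For $m\in\mathbb Z$ the current operator is $a_m=\sum_{k\in\mathbb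 Z}:\!\psi_k\psi^\ast_{k+m}\!:$, acting on $\mathcal F$, where normal ordering $:\;:$ moves the annihilation operators ($\psi_m$ with $m<0$, $\psi_n^\ast$ with $n\ge 0$) to the right, with a factor $-1$ for each move (for $m\ne 0$ this is just $a_m=\sum_k\psi_k\psi^\ast_{k+m}$). For a set of commuting variables $X=(X_1,X_2,\dots)$ with power sums $p_n(X)=X_1^n+X_2^n+\cdots$, set $$H(X)=\sum_{n>0}\frac{p_n(X)}{n}a_n,\qquad H^\ast(X)=\sum_{n>0}\frac{p_n(X)}{n}a_{-n},$$ and let $e^{\pm H(X)},e^{\pm H^\ast(X)}$ be their exponential series. In particular $H^\ast(-\beta)=\sum_{n>0}\frac{(-\beta)^n}{n}a_{-n}$ (one variable, equal to $-\beta$). Here $\beta$ is a formal parameter and $x_1,x_2,\dots$ are commuting variables; all operators act on Fock space with scalars extended to formal power series in $\beta$ with coefficients in $\mathbb C[x_1,x_2,\dots]$, and the pairing is extended accordingly. For integers $p\ge 0$, $q\ge 1$, put $x^{[p]}=(x_1,\dots,x_p)$ (so $H(x^{[0]})=0$) and $$H(x^{[p/q]})=H(x^{[p]})-H(x^{[q-1]}).$$ Thus $H(x^{[f_i/(f_{i-1}+1)]})=H(x^{[f_i]})-H(x^{[f_{i-1}]})$ and $H(x^{[(g_j-1)/g_{j-1}]})=H(x^{[g_j-1]})-H(x^{[g_{j-1}-1]})$ for $i,j\ge 2$. **The functions $G_n^{[[p/q]]}$.** For integers $p\ge 0$, $q\ge 1$, the $G_n^{[[p/q]]}(x)$ ($n\in\mathbb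 Z$) are defined by $$\sum_{n\in\mathbb Z}G_n^{[[p/q]]}(x)z^n=\begin{cases}\dfrac{1}{1+\beta z^{-1}}\displaystyle\prod_{k=q}^p\frac{1+\beta x_k}{1-x_kz}&(p\ge q),\\[2mm]\dfrac{1}{1+\beta z^{-1}}&(p=q-1),\\[2mm]\dfrac{1}{1+\beta z^{-1}}\displaystyle\prod_{k=p+1}^{q-1}\frac{1-x_kz}{1+\beta x_k}&(p<q-1),\end{cases}$$ where the right-hand side is expanded in $\mathbb C[x_1,x_2,\dots]((z))[[\beta]]$ (power series in $\beta$ whose coefficients are Laurent series in $z$). **Binomials.** $\binom{a}{s}=a(a-1)\cdots(a-s+1)/s!$ for any integer $a$ (possibly negative) and $s\ge 0$; the sum over $s$ in the determinant is taken as a formal power series in $\beta$. *)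

theory Defs
  imports
    "HOL-Library.Poly_Mapping"
    "HOL-Library.Groups_Big_Fun"
    "HOL-Computational_Algebra.Formal_Laurent_Series"
    "HOL-Computational_Algebra.Formal_Power_Series"
    "Jordan_Normal_Form.Determinant"
    Complex_Main
begin

section \<open>The algebra of fermions\<close>

text \<open>The free \<open>\<complex>\<close>-algebra on the symbols \<open>\<psi>\<^sub>n\<close>, \<open>\<psi>\<^sup>*\<^sub>n\<close> is the monoid algebra of the free monoid of
  words; \<open>Poly_Mapping\<close> supplies the convolution product. The wrapper type avoids a global
  \<open>monoid_add\<close> instance on lists.\<close>

datatype fermion = Psi int | PsiStar int

datatype fword = FWord "fermion list"

instantiation fword :: monoid_add
begin

definition zero_fword :: fword where
  "zero_fword = FWord []"

fun plus_fword :: "fword \<Rightarrow> fword \<Rightarrow> fword" where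
  "plus_fword (FWord u) (FWord v) = FWord (u @ v)"

instance
proof
  fix a b c :: fword
  show "a + b + c = a + (b + c)" by (cases a; cases b; cases c) simp
  show "0 + a = a" by (cases a) (simp add: zero_fword_def)
  show "a + 0 = a" by (cases a) (simp add: zero_fword_def)
qed

end

type_synonym free_alg = "fword \<Rightarrow>\<^sub>0 complex"

definition free_gen :: "fermion \<Rightarrow> free_alg" where
  "free_gen x = Poly_Mapping.single (FWord [x]) 1"

definition free_anticomm :: "fermion \<Rightarrow> fermion \<Rightarrow> free_alg" where
  "free_anticomm x y = free_gen x * free_gen y + free_gen y * free_gen x"

inductive_set cliff_relations :: "free_alg set" where
  "free_anticomm (Psi m) (Psi n) \<in> cliff_relations"
| "free_anticomm (PsiStar m) (PsiStar n) \<in> cliff_relations"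
| "free_anticomm (Psi m) (PsiStar n) - (if m = n then 1 else 0) \<in> cliff_relations"

inductive_set cliff_ideal :: "free_alg set" where
  zero: "0 \<in> cliff_ideal"
| add: "u \<in> cliff_ideal \<Longrightarrow> v \<in> cliff_ideal \<Longrightarrow> u + v \<in> cliff_ideal"
| rel: "s \<in> cliff_relations \<Longrightarrow> a * s * b \<in> cliff_ideal"

lemma cliff_ideal_mult: "u \<in> cliff_ideal \<Longrightarrow> a * u * b \<in> cliff_ideal"
proof (induction rule: cliff_ideal.induct)
  case zero
  then show ?case by (simp add: cliff_ideal.zero)
next
  case (add u v)
  then show ?case by (simp add: distrib_left distrib_right cliff_ideal.add)
next
  case (rel s c d)
  have "a * (c * s * d) * b = (a * c) * s * (d * b)" by (simp add: mult.assoc)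
  then show ?case using cliff_ideal.rel[OF rel] by simp
qed

lemma cliff_ideal_left: "u \<in> cliff_ideal \<Longrightarrow> a * u \<in> cliff_ideal"
  using cliff_ideal_mult[of u a 1] by simp

lemma cliff_ideal_right: "u \<in> cliff_ideal \<Longrightarrow> u * b \<in> cliff_ideal"
  using cliff_ideal_mult[of u 1 b] by simp

lemma cliff_ideal_uminus: "u \<in> cliff_ideal \<Longrightarrow> - u \<in> cliff_ideal"
  using cliff_ideal_left[of u "- 1"] by simp

definition cliff_eq :: "free_alg \<Rightarrow> free_alg \<Rightarrow> bool" where
  "cliff_eq u v \<longleftrightarrow> u - v \<in> cliff_ideal"

quotient_type cliff = free_alg / cliff_eq
proof (rule equivpI)
  show "reflp cliff_eq"
    by (simp add: reflp_def cliff_eq_def cliff_ideal.zero)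
  show "symp cliff_eq"
    unfolding symp_def cliff_eq_def using cliff_ideal_uminus by fastforce
  show "transp cliff_eq"
    unfolding transp_def cliff_eq_def using cliff_ideal.add by fastforce
qed

text \<open>Not an instance of \<open>ring_1\<close>, since that class would require a proof of \<open>0 \<noteq> 1\<close>.\<close>

instantiation cliff :: "{ring, monoid_mult}"
begin

lift_definition zero_cliff :: cliff is 0 .

lift_definition one_cliff :: cliff is 1 .

lift_definition plus_cliff :: "cliff \<Rightarrow> cliff \<Rightarrow> cliff" is "(+)"
  unfolding cliff_eq_def using cliff_ideal.add by (fastforce simp: algebra_simps)

lift_definition uminus_cliff :: "cliff \<Rightarrow> cliff" is uminus
  unfolding cliff_eq_def using cliff_ideal_uminus by fastforce

definition minus_cliff :: "cliff \<Rightarrow> cliff \<Rightarrow> cliff" where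
  "minus_cliff a b = a + - b"

lift_definition times_cliff :: "cliff \<Rightarrow> cliff \<Rightarrow> cliff" is "(*)"
proof -
  fix u u' v v' :: free_alg
  assume "cliff_eq u u'" "cliff_eq v v'"
  then have "(u - u') * v + u' * (v - v') \<in> cliff_ideal"
    unfolding cliff_eq_def
    by (intro cliff_ideal.add cliff_ideal_left cliff_ideal_right)
  then show "cliff_eq (u * v) (u' * v')"
    unfolding cliff_eq_def by (simp add: algebra_simps)
qed

instance
proof
  fix a b c :: cliff
  have eq: "u = v \<Longrightarrow> cliff_eq u v" for u v
    by (simp add: cliff_eq_def cliff_ideal.zero)
  show "a + b + c = a + (b + c)" by transfer (rule eq, simp add: algebra_simps)
  show "a + b = b + a" by transfer (rule eq, simp add: algebra_simps)
  show "0 + a = a" by transfer (rule eq, simp)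
  show "- a + a = 0" by transfer (rule eq, simp)
  show "a - b = a + - b" by (rule minus_cliff_def)
  show "a * b * c = a * (b * c)" by transfer (rule eq, simp add: mult.assoc)
  show "(a + b) * c = a * c + b * c" by transfer (rule eq, simp add: distrib_right)
  show "a * (b + c) = a * b + a * c" by transfer (rule eq, simp add: distrib_left)
  show "1 * a = a" by transfer (rule eq, simp)
  show "a * 1 = a" by transfer (rule eq, simp)
qed

end

lift_definition psi :: "int \<Rightarrow> cliff" is "\<lambda>n. free_gen (Psi n)" .

lift_definition psi_star :: "int \<Rightarrow> cliff" is "\<lambda>n. free_gen (PsiStar n)" .

lift_definition cliff_const :: "complex \<Rightarrow> cliff" is "\<lambda>c. Poly_Mapping.single 0 c" .

lemma cliff_const_0: "cliff_const 0 = 0"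
  by transfer (simp add: cliff_eq_def cliff_ideal.zero)

lemma cliff_const_1: "cliff_const 1 = 1"
  by transfer (simp add: cliff_eq_def cliff_ideal.zero)

lemma cliff_const_add: "cliff_const (c + d) = cliff_const c + cliff_const d"
  by transfer (simp add: cliff_eq_def cliff_ideal.zero single_add)

lemma cliff_const_mult: "cliff_const (c * d) = cliff_const c * cliff_const d"
  by transfer (simp add: cliff_eq_def cliff_ideal.zero mult_single)

lemma psi_anticomm: "psi m * psi n + psi n * psi m = 0"
  using cliff_ideal.rel[OF cliff_relations.intros(1), of 1 m n 1]
  by transfer (simp add: cliff_eq_def free_anticomm_def)

lemma psi_star_anticomm: "psi_star m * psi_star n + psi_star n * psi_star m = 0"
  using cliff_ideal.rel[OF cliff_relations.intros(2), of 1 m n 1]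
  by transfer (simp add: cliff_eq_def free_anticomm_def)

lemma psi_psi_star_anticomm:
  "psi m * psi_star n + psi_star n * psi m = (if m = n then 1 else 0)"
  using cliff_ideal.rel[OF cliff_relations.intros(3), of 1 m n 1]
  by transfer (auto simp: cliff_eq_def free_anticomm_def)

text \<open>The quotients of \<open>cliff\<close> below lift operations from \<open>cliff\<close>, not from \<open>free_alg\<close>.\<close>

lifting_forget cliff.lifting

section \<open>Fock space, its dual and the vacuum expectation value\<close>

inductive_set annihilators :: "cliff set" where
  "m < 0 \<Longrightarrow> psi m \<in> annihilators"
| "n \<ge> 0 \<Longrightarrow> psi_star n \<in> annihilators"

inductive_set co_annihilators :: "cliff set" where
  "n \<ge> 0 \<Longrightarrow> psi n \<in> co_annihilators"
| "m < 0 \<Longrightarrow> psi_star m \<in> co_annihilators"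

inductive_set vac_ideal :: "cliff set" where
  zero: "0 \<in> vac_ideal"
| add: "u \<in> vac_ideal \<Longrightarrow> v \<in> vac_ideal \<Longrightarrow> u + v \<in> vac_ideal"
| gen: "s \<in> annihilators \<Longrightarrow> a * s \<in> vac_ideal"

inductive_set covac_ideal :: "cliff set" where
  zero: "0 \<in> covac_ideal"
| add: "u \<in> covac_ideal \<Longrightarrow> v \<in> covac_ideal \<Longrightarrow> u + v \<in> covac_ideal"
| gen: "s \<in> co_annihilators \<Longrightarrow> s * a \<in> covac_ideal"

lemma vac_ideal_left: "u \<in> vac_ideal \<Longrightarrow> a * u \<in> vac_ideal"
proof (induction rule: vac_ideal.induct)
  case zero
  then show ?case by (simp add: vac_ideal.zero)
next
  case (add u v)
  then show ?case by (simp add: distrib_left vac_ideal.add)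
next
  case (gen s b)
  then show ?case using vac_ideal.gen[of s "a * b"] by (simp add: mult.assoc)
qed

lemma covac_ideal_right: "u \<in> covac_ideal \<Longrightarrow> u * a \<in> covac_ideal"
proof (induction rule: covac_ideal.induct)
  case zero
  then show ?case by (simp add: covac_ideal.zero)
next
  case (add u v)
  then show ?case by (simp add: distrib_right covac_ideal.add)
next
  case (gen s b)
  then show ?case using covac_ideal.gen[of s "b * a"] by (simp add: mult.assoc)
qed

lemma vac_ideal_uminus: "u \<in> vac_ideal \<Longrightarrow> - u \<in> vac_ideal"
  using vac_ideal_left[of u "- 1"] by simp

lemma covac_ideal_uminus: "u \<in> covac_ideal \<Longrightarrow> - u \<in> covac_ideal"
  using covac_ideal_right[of u "- 1"] by simp

definition fock_eq :: "cliff \<Rightarrow> cliff \<Rightarrow> bool" where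
  "fock_eq a b \<longleftrightarrow> a - b \<in> vac_ideal"

definition dfock_eq :: "cliff \<Rightarrow> cliff \<Rightarrow> bool" where
  "dfock_eq a b \<longleftrightarrow> a - b \<in> covac_ideal"

lemma fock_eqI: "a = b \<Longrightarrow> fock_eq a b"
  by (simp add: fock_eq_def vac_ideal.zero)

lemma dfock_eqI: "a = b \<Longrightarrow> dfock_eq a b"
  by (simp add: dfock_eq_def covac_ideal.zero)

quotient_type fock = cliff / fock_eq
proof (rule equivpI)
  show "reflp fock_eq" by (simp add: reflp_def fock_eqI)
  show "symp fock_eq"
    unfolding symp_def fock_eq_def using vac_ideal_uminus by fastforce
  show "transp fock_eq"
    unfolding transp_def fock_eq_def using vac_ideal.add by fastforce
qed

quotient_type dfock = cliff / dfock_eq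
proof (rule equivpI)
  show "reflp dfock_eq" by (simp add: reflp_def dfock_eqI)
  show "symp dfock_eq"
    unfolding symp_def dfock_eq_def using covac_ideal_uminus by fastforce
  show "transp dfock_eq"
    unfolding transp_def dfock_eq_def using covac_ideal.add by fastforce
qed

instantiation fock :: ab_group_add
begin

lift_definition zero_fock :: fock is 0 .

lift_definition plus_fock :: "fock \<Rightarrow> fock \<Rightarrow> fock" is "(+)"
  unfolding fock_eq_def using vac_ideal.add by (fastforce simp: algebra_simps)

lift_definition uminus_fock :: "fock \<Rightarrow> fock" is uminus
  unfolding fock_eq_def using vac_ideal_uminus by fastforce

definition minus_fock :: "fock \<Rightarrow> fock \<Rightarrow> fock" where
  "minus_fock a b = a + - b"

instance
proof
  fix a b c :: fock
  show "a + b + c = a + (b + c)" by transfer (rule fock_eqI, simp add: algebra_simps)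
  show "a + b = b + a" by transfer (rule fock_eqI, simp add: algebra_simps)
  show "0 + a = a" by transfer (rule fock_eqI, simp)
  show "- a + a = 0" by transfer (rule fock_eqI, simp)
  show "a - b = a + - b" by (rule minus_fock_def)
qed

end

instantiation dfock :: ab_group_add
begin

lift_definition zero_dfock :: dfock is 0 .

lift_definition plus_dfock :: "dfock \<Rightarrow> dfock \<Rightarrow> dfock" is "(+)"
  unfolding dfock_eq_def using covac_ideal.add by (fastforce simp: algebra_simps)

lift_definition uminus_dfock :: "dfock \<Rightarrow> dfock" is uminus
  unfolding dfock_eq_def using covac_ideal_uminus by fastforce

definition minus_dfock :: "dfock \<Rightarrow> dfock \<Rightarrow> dfock" where
  "minus_dfock a b = a + - b"

instance
proof
  fix a b c :: dfock
  show "a + b + c = a + (b + c)" by transfer (rule dfock_eqI, simp add: algebra_simps)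
  show "a + b = b + a" by transfer (rule dfock_eqI, simp add: algebra_simps)
  show "0 + a = a" by transfer (rule dfock_eqI, simp)
  show "- a + a = 0" by transfer (rule dfock_eqI, simp)
  show "a - b = a + - b" by (rule minus_dfock_def)
qed

end

lift_definition vac :: fock is 1 .

lift_definition covac :: dfock is 1 .

lift_definition act :: "cliff \<Rightarrow> fock \<Rightarrow> fock" is "(*)"
  unfolding fock_eq_def by (metis right_diff_distrib vac_ideal_left)

lift_definition coact :: "dfock \<Rightarrow> cliff \<Rightarrow> dfock" is "(*)"
  unfolding dfock_eq_def by (metis left_diff_distrib covac_ideal_right)

definition fock_scale :: "complex \<Rightarrow> fock \<Rightarrow> fock" where
  "fock_scale c v = act (cliff_const c) v"

definition dfock_scale :: "complex \<Rightarrow> dfock \<Rightarrow> dfock" where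
  "dfock_scale c w = coact w (cliff_const c)"

lemma act_1: "act 1 v = v"
  by transfer (rule fock_eqI, simp)

lemma act_mult: "act (a * b) v = act a (act b v)"
  by transfer (rule fock_eqI, simp add: mult.assoc)

lemma act_add_left: "act (a + b) v = act a v + act b v"
  by transfer (rule fock_eqI, simp add: distrib_right)

lemma act_add_right: "act a (u + v) = act a u + act a v"
  by transfer (rule fock_eqI, simp add: distrib_left)

lemma coact_1: "coact w 1 = w"
  by transfer (rule dfock_eqI, simp)

lemma coact_mult: "coact w (a * b) = coact (coact w a) b"
  by transfer (rule dfock_eqI, simp add: mult.assoc)

lemma coact_add_left: "coact (u + v) a = coact u a + coact v a"
  by transfer (rule dfock_eqI, simp add: distrib_right)

lemma coact_add_right: "coact w (a + b) = coact w a + coact w b"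
  by transfer (rule dfock_eqI, simp add: distrib_left)

lemma act_psi_vac: "m < 0 \<Longrightarrow> act (psi m) vac = 0"
  using vac_ideal.gen[OF annihilators.intros(1), of m 1]
  by (simp add: act.abs_eq vac_def zero_fock_def fock.abs_eq_iff fock_eq_def)

lemma act_psi_star_vac: "n \<ge> 0 \<Longrightarrow> act (psi_star n) vac = 0"
  using vac_ideal.gen[OF annihilators.intros(2), of n 1]
  by (simp add: act.abs_eq vac_def zero_fock_def fock.abs_eq_iff fock_eq_def)

lemma coact_psi_covac: "n \<ge> 0 \<Longrightarrow> coact covac (psi n) = 0"
  using covac_ideal.gen[OF co_annihilators.intros(1), of n 1]
  by (simp add: coact.abs_eq covac_def zero_dfock_def dfock.abs_eq_iff dfock_eq_def)

lemma coact_psi_star_covac: "m < 0 \<Longrightarrow> coact covac (psi_star m) = 0"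
  using covac_ideal.gen[OF co_annihilators.intros(2), of m 1]
  by (simp add: coact.abs_eq covac_def zero_dfock_def dfock.abs_eq_iff dfock_eq_def)

interpretation fock: vector_space fock_scale
  by standard
    (simp_all add: fock_scale_def act_add_right cliff_const_add act_add_left cliff_const_mult
      act_mult cliff_const_1 act_1)

interpretation dfock: vector_space dfock_scale
proof
  fix c d :: complex and u v :: dfock
  show "dfock_scale c (u + v) = dfock_scale c u + dfock_scale c v"
    by (simp add: dfock_scale_def coact_add_left)
  show "dfock_scale (c + d) u = dfock_scale c u + dfock_scale d u"
    by (simp add: dfock_scale_def cliff_const_add coact_add_right)
  have "cliff_const (c * d) = cliff_const d * cliff_const c"
    by (subst mult.commute) (rule cliff_const_mult)
  then show "dfock_scale c (dfock_scale d u) = dfock_scale (c * d) u"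
    by (simp add: dfock_scale_def coact_mult)
  show "dfock_scale 1 u = u"
    by (simp add: dfock_scale_def cliff_const_1 coact_1)
qed

definition is_vacuum_pairing :: "(dfock \<Rightarrow> fock \<Rightarrow> complex) \<Rightarrow> bool" where
  "is_vacuum_pairing B \<longleftrightarrow>
     (\<forall>w. Vector_Spaces.linear fock_scale (*) (\<lambda>v. B w v)) \<and>
     (\<forall>v. Vector_Spaces.linear dfock_scale (*) (\<lambda>w. B w v)) \<and>
     B covac vac = 1 \<and>
     (\<forall>w n v. B (coact w (psi n)) v = B w (act (psi n) v)) \<and>
     (\<forall>w n v. B (coact w (psi_star n)) v = B w (act (psi_star n) v))"

definition vev :: "dfock \<Rightarrow> fock \<Rightarrow> complex" where
  "vev = (THE B. is_vacuum_pairing B)"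

definition shifted_vac :: "nat \<Rightarrow> fock" where
  "shifted_vac r = act (\<Prod>k\<leftarrow>rev [1..<Suc r]. psi_star (- int k)) vac"

definition shifted_covac :: "nat \<Rightarrow> dfock" where
  "shifted_covac r = coact covac (\<Prod>k\<leftarrow>[1..<Suc r]. psi (- int k))"

section \<open>Current operators\<close>

text \<open>\<open>:\<psi>\<^sub>k \<psi>\<^sup>*\<^sub>l:\<close>. A reordering is needed only if the left factor is an annihilation operator
  (\<open>k < 0\<close>) and the right one is not (\<open>l < 0\<close>).\<close>

definition normal_ordered :: "int \<Rightarrow> int \<Rightarrow> cliff" where
  "normal_ordered k l = (if k < 0 \<and> l < 0 then - (psi_star l * psi k) else psi k * psi_star l)"

text \<open>Only finitely many summands are nonzero on any given vector; \<open>Sum_any\<close> adds these up.\<close>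

definition current :: "int \<Rightarrow> fock \<Rightarrow> fock" where
  "current m v = Sum_any (\<lambda>k. act (normal_ordered k (k + m)) v)"

section \<open>Extension of scalars and vertex operators\<close>

text \<open>\<open>mpoly\<close> is \<open>\<complex>[x\<^sub>1, x\<^sub>2, \<dots>]\<close> (the spare variable \<open>x\<^sub>0\<close> of the encoding is never used),
  \<open>scalar\<close> is \<open>\<complex>[x\<^sub>1, x\<^sub>2, \<dots>][[\<beta>]]\<close>, and \<open>xfock\<close> is \<open>(\<F> \<otimes> \<complex>[x\<^sub>1, x\<^sub>2, \<dots>])[[\<beta>]]\<close>.\<close>

type_synonym monom = "nat \<Rightarrow>\<^sub>0 nat"
type_synonym mpoly = "monom \<Rightarrow>\<^sub>0 complex"
type_synonym scalar = "mpoly fps"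
type_synonym xfock = "(monom \<Rightarrow>\<^sub>0 fock) fps"

definition xvar :: "nat \<Rightarrow> mpoly" where
  "xvar k = Poly_Mapping.single (Poly_Mapping.single k 1) 1"

definition beta :: scalar where
  "beta = fps_X"

definition scalar_const :: "complex \<Rightarrow> scalar" where
  "scalar_const c = fps_const (Poly_Mapping.single 0 c)"

definition poly_scale :: "mpoly \<Rightarrow> (monom \<Rightarrow>\<^sub>0 fock) \<Rightarrow> (monom \<Rightarrow>\<^sub>0 fock)" where
  "poly_scale p v = (\<Sum>m\<in>Poly_Mapping.keys p. \<Sum>n\<in>Poly_Mapping.keys v.
     Poly_Mapping.single (m + n) (fock_scale (Poly_Mapping.lookup p m) (Poly_Mapping.lookup v n)))"

definition xscale :: "scalar \<Rightarrow> xfock \<Rightarrow> xfock" where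
  "xscale c V = Abs_fps (\<lambda>k. \<Sum>i\<le>k. poly_scale (fps_nth c i) (fps_nth V (k - i)))"

text \<open>The scalar extension of an additive map, acting on each coefficient. It is applied to operators
  on \<open>\<F>\<close> and to the functionals \<open>\<langle>w|\<cdot>\<rangle>\<close> with \<open>w \<in> \<F>\<^sup>*\<close>; the latter give the extended
  pairing of \<open>w\<close> with a vector over the extended scalars.\<close>

definition scalar_extend ::
    "('a::zero \<Rightarrow> 'b::zero) \<Rightarrow> (monom \<Rightarrow>\<^sub>0 'a) fps \<Rightarrow> (monom \<Rightarrow>\<^sub>0 'b) fps" where
  "scalar_extend T V = Abs_fps (\<lambda>k. Poly_Mapping.map T (fps_nth V k))"

definition xvac :: "nat \<Rightarrow> xfock" where
  "xvac r = fps_const (Poly_Mapping.single 0 (shifted_vac r))"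

definition xvev :: "dfock \<Rightarrow> xfock \<Rightarrow> scalar" where
  "xvev w V = scalar_extend (vev w) V"

text \<open>Infinite sums of vectors in which each power of \<open>\<beta>\<close> receives only finitely many nonzero
  contributions. For \<open>H(X)\<close> with \<open>X\<close> a set of variables \<open>x\<^sub>k\<close> this holds because positive currents
  are locally nilpotent, for \<open>H\<^sup>*(-\<beta>)\<close> by the growing powers of \<open>\<beta>\<close>.\<close>

definition xsum :: "(nat \<Rightarrow> xfock) \<Rightarrow> xfock" where
  "xsum F = Abs_fps (\<lambda>k. Sum_any (\<lambda>n. fps_nth (F n) k))"

definition xexp :: "(xfock \<Rightarrow> xfock) \<Rightarrow> xfock \<Rightarrow> xfock" where
  "xexp T V = xsum (\<lambda>N. xscale (scalar_const (1 / fact N)) ((T ^^ N) V))"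

text \<open>A set of variables is given as the list of its members.\<close>

definition power_sum :: "scalar list \<Rightarrow> nat \<Rightarrow> scalar" where
  "power_sum X n = (\<Sum>y\<leftarrow>X. y ^ n)"

definition Hop :: "scalar list \<Rightarrow> xfock \<Rightarrow> xfock" where
  "Hop X V = xsum (\<lambda>n. if n = 0 then 0 else
     xscale (scalar_const (1 / of_nat n) * power_sum X n) (scalar_extend (current (int n)) V))"

definition Hstar :: "scalar list \<Rightarrow> xfock \<Rightarrow> xfock" where
  "Hstar X V = xsum (\<lambda>n. if n = 0 then 0 else
     xscale (scalar_const (1 / of_nat n) * power_sum X n) (scalar_extend (current (- int n)) V))"

definition x_upto :: "nat \<Rightarrow> scalar list" where
  "x_upto p = map (\<lambda>k. fps_const (xvar k)) [1..<Suc p]"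

definition Hquot :: "nat \<Rightarrow> nat \<Rightarrow> xfock \<Rightarrow> xfock" where
  "Hquot p q V = Hop (x_upto p) V - Hop (x_upto (q - 1)) V"

definition op_neg :: "(xfock \<Rightarrow> xfock) \<Rightarrow> xfock \<Rightarrow> xfock" where
  "op_neg T V = - T V"

definition compose_list :: "('a \<Rightarrow> 'a) list \<Rightarrow> 'a \<Rightarrow> 'a" where
  "compose_list Ts = foldr (\<circ>) Ts id"

section \<open>The functions \<open>G\<close> and the flagged skew Grothendieck polynomials\<close>

definition unit_inv :: "'a::comm_ring_1 \<Rightarrow> 'a" where
  "unit_inv u = (THE v. u * v = 1)"

lemma unit_inv_eqI:
  assumes "u * v = 1"
  shows "unit_inv u = v"
  unfolding unit_inv_def using assms
  by (intro the_equality) (auto, metis mult.assoc mult.commute mult.right_neutral)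

text \<open>\<open>gring\<close> is \<open>\<complex>[x\<^sub>1, x\<^sub>2, \<dots>]((z))[[\<beta>]]\<close>; every denominator below is a unit in it.\<close>

type_synonym gring = "mpoly fls fps"

definition g_z :: gring where
  "g_z = fps_const fls_X"

definition g_z_inv :: gring where
  "g_z_inv = fps_const fls_X_inv"

definition g_x :: "nat \<Rightarrow> gring" where
  "g_x k = fps_const (fls_const (xvar k))"

definition g_beta :: gring where
  "g_beta = fps_X"

definition G_series :: "nat \<Rightarrow> nat \<Rightarrow> gring" where
  "G_series p q = unit_inv (1 + g_beta * g_z_inv) *
     (if q \<le> p then (\<Prod>k=q..p. (1 + g_beta * g_x k) * unit_inv (1 - g_x k * g_z))
      else if p = q - 1 then 1
      else (\<Prod>k=p+1..q-1. (1 - g_x k * g_z) * unit_inv (1 + g_beta * g_x k)))"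

definition G_fun :: "nat \<Rightarrow> nat \<Rightarrow> int \<Rightarrow> scalar" where
  "G_fun p q n = Abs_fps (\<lambda>k. fls_nth (fps_nth (G_series p q) k) n)"

text \<open>Sequences indexed by \<open>1, \<dots>, r\<close> are functions on \<open>nat\<close>, whereas the rows and columns of \<open>mat\<close>
  are indexed by \<open>0, \<dots>, r - 1\<close>. The sum over \<open>s\<close> converges in the metric space of formal power
  series in \<open>\<beta>\<close>.\<close>

definition flagged_skew_G_entry ::
    "(nat \<Rightarrow> nat) \<Rightarrow> (nat \<Rightarrow> nat) \<Rightarrow> (nat \<Rightarrow> nat) \<Rightarrow> (nat \<Rightarrow> nat) \<Rightarrow> nat \<Rightarrow> nat \<Rightarrow> scalar" where
  "flagged_skew_G_entry lam mu f g i j =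
     suminf (\<lambda>s. scalar_const ((of_int (int i - int j) :: complex) gchoose s) * beta ^ s *
       G_fun (f i) (g j) (int (lam i) - int (mu j) - int i + int j + int s))"

definition flagged_skew_G ::
    "nat \<Rightarrow> (nat \<Rightarrow> nat) \<Rightarrow> (nat \<Rightarrow> nat) \<Rightarrow> (nat \<Rightarrow> nat) \<Rightarrow> (nat \<Rightarrow> nat) \<Rightarrow> scalar" where
  "flagged_skew_G r lam mu f g =
     Determinant.det (mat r r (\<lambda>(i, j). flagged_skew_G_entry lam mu f g (Suc i) (Suc j)))"

end

theory Submission
  imports Defs "HOL-Library.Nat_Bijection"
begin

text \<open>Packing the fermions into fields \<open>\<psi>(P)\<close> and \<open>\<psi>\<^sup>*(P)\<close> with \<open>P\<close> a Laurent series in \<open>z\<close> turns the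
  commutator with the current \<open>a\<^sub>m\<close> into multiplication of \<open>P\<close> by \<open>z\<^sup>m\<close>. Conjugation by \<open>e\<^sup>H\<close> and
  \<open>e\<^sup>H\<^sup>*\<close> therefore multiplies \<open>P\<close> by the exponentials of logarithmic series, that is by products of
  \<open>(1 - x\<^sub>k z)\<^sup>\<plusminus>\<^sup>1\<close> and by \<open>(1 + \<beta> / z)\<^sup>\<plusminus>\<^sup>1\<close>. Since \<open>e\<^sup>H\<close> and \<open>e\<^sup>H\<^sup>*\<close> commute up to a scalar (Heisenberg
  relation), all exponentials can be moved to the right, where those of \<open>H\<close> fix \<open>|-r\<rangle>\<close> and those of
  \<open>H\<^sup>*\<close> cancel. What remains is a product of \<open>r\<close> fields \<open>\<psi>\<^sup>*(Q\<^sub>j)\<close> and \<open>r\<close> fields \<open>\<psi>(P\<^sub>i)\<close>. The \<open>j\<close>-th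
  field \<open>\<psi>\<^sup>*\<close> has passed only \<open>r - j\<close> factors \<open>1 + \<beta> / z\<close>, so the order of \<open>Q\<^sub>j\<close> in \<open>z\<close> is at least \<open>- r\<close> and
  \<open>\<psi>\<^sup>*(Q\<^sub>j)\<close> annihilates \<open>|-r\<rangle>\<close>. Wick's theorem then gives the determinant of the anticommutators
  \<open>[z\<^sup>0] P\<^sub>i Q\<^sub>j\<close>, and these are the entries in the definition of the Grothendieck polynomial.\<close>

section \<open>Fock space as a module over the fermion algebra\<close>

text \<open>The exponents determine the shape of the entries. To the left of \<psi> number i stand
  all r exponentials of Hstar and i - 1 of those of - Hstar, so this field collects (1 +
  \<beta>/z)^(i - 1 - r), while \<psi>* number j collects (1 + \<beta>/z)^(r - j). The product has
  exponent (i - j) - 1: the power i - j expands into the binomial sum, and the power -1 is the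
  prefactor in the series of the G_n. The numerators 1 + \<beta> x_k in that series are the scalars
  by which exponentials of H and of Hstar fail to commute, and the differences of flags telescope
  along the product. The obstacle is convergence, because currents, fields, H and Hstar are all
  infinite sums. Two mechanisms make them finite: the energy of a vector, and divisibility by powers
  of \<beta>. The bounds are not uniform: the energy depends on the vector, and the order in z of
  1/(1 + \<beta>/z) is unbounded below as the power of \<beta> grows. Hence limits are taken on one
  fixed vector and up to one fixed power of \<beta>.\<close>

lemma poly_mapping_induct_single [case_names zero add single]:
  assumes "P 0" and "\<And>p q. P p \<Longrightarrow> P q \<Longrightarrow> P (p + q)" and "\<And>k c. P (Poly_Mapping.single k c)"
  shows "P (p :: 'a \<Rightarrow>\<^sub>0 'b::comm_monoid_add)"
proof -
  have "P (\<Sum>k\<in>A. Poly_Mapping.single k (Poly_Mapping.lookup p k))" if "finite A" for A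
    using that by induction (auto intro: assms)
  moreover have "p = (\<Sum>k\<in>Poly_Mapping.keys p. Poly_Mapping.single k (Poly_Mapping.lookup p k))"
  proof (rule poly_mapping_eqI)
    fix k
    show "Poly_Mapping.lookup p k =
      Poly_Mapping.lookup (\<Sum>k\<in>Poly_Mapping.keys p. Poly_Mapping.single k (Poly_Mapping.lookup p k)) k"
      by (simp add: lookup_sum lookup_single when_def sum.delta in_keys_iff)
  qed
  ultimately show ?thesis by (metis finite_keys)
qed

lemma abs_cliff_surj: "\<exists>u. a = abs_cliff u"
  by (induct a rule: cliff.abs_induct) blast

lemma abs_fock_surj: "\<exists>a. v = abs_fock a"
  by (induct v rule: fock.abs_induct) blast

lemma abs_dfock_surj: "\<exists>a. w = abs_dfock a"
  by (induct w rule: dfock.abs_induct) blast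

lemma act_zero [simp]: "act a 0 = 0"
  using act_add_right[of a 0 0] by simp

lemma act_zero_left [simp]: "act 0 v = 0"
  using act_add_left[of 0 0 v] by simp

lemma act_uminus: "act a (- v) = - act a v"
  by (metis act_add_right act_zero add.right_inverse add_eq_0_iff)

lemma act_uminus_left: "act (- a) v = - act a v"
  by (metis act_add_left act_zero_left add.right_inverse add_eq_0_iff)

lemma act_diff: "act a (u - v) = act a u - act a v"
  by (metis act_add_right act_uminus diff_conv_add_uminus)

lemma act_diff_left: "act (a - b) v = act a v - act b v"
  by (metis act_add_left act_uminus_left diff_conv_add_uminus)

lemma act_sum: "act a (\<Sum>i\<in>A. f i) = (\<Sum>i\<in>A. act a (f i))"
  by (induction A rule: infinite_finite_induct) (simp_all add: act_add_right)

lemma single_zero_commute: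
  "Poly_Mapping.single 0 c * u = u * Poly_Mapping.single 0 (c::complex)" for u :: free_alg
  by (induction u rule: poly_mapping_induct_single)
    (simp_all add: distrib_left distrib_right mult_single mult.commute)

lemma cliff_const_commute: "cliff_const c * a = a * cliff_const c"
proof -
  obtain u where "a = abs_cliff u" using abs_cliff_surj by blast
  then show ?thesis
    by (simp add: cliff_const.abs_eq times_cliff.abs_eq single_zero_commute)
qed

lemma act_scale: "act a (fock_scale c v) = fock_scale c (act a v)"
  by (simp add: fock_scale_def cliff_const_commute flip: act_mult)

fun fgen :: "fermion \<Rightarrow> cliff" where
  "fgen (Psi n) = psi n"
| "fgen (PsiStar n) = psi_star n"

lemma fgen_abs: "fgen x = abs_cliff (free_gen x)"
  by (cases x) (simp_all add: psi.abs_eq psi_star.abs_eq)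

text \<open>Words span the free algebra, so their classes span the quotient. A word is built by
  prepending letters, which matches the left action on Fock space.\<close>

lemma cliff_induct [case_names add const_mult gen_mult one]:
  assumes add: "\<And>a b. Q a \<Longrightarrow> Q b \<Longrightarrow> Q (a + b)"
    and const: "\<And>c a. Q a \<Longrightarrow> Q (cliff_const c * a)"
    and gen: "\<And>x a. Q a \<Longrightarrow> Q (fgen x * a)"
    and one: "Q 1"
  shows "Q (a :: cliff)"
proof -
  have word: "Q (abs_cliff (Poly_Mapping.single (FWord xs) 1))" for xs
  proof (induction xs)
    case Nil
    then show ?case using one by (simp add: one_cliff.abs_eq flip: zero_fword_def)
  next
    case (Cons x xs)
    have "abs_cliff (Poly_Mapping.single (FWord (x # xs)) 1) =
        fgen x * abs_cliff (Poly_Mapping.single (FWord xs) 1)"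
      by (simp add: fgen_abs times_cliff.abs_eq free_gen_def mult_single)
    then show ?case using gen[OF Cons] by simp
  qed
  have "Q (abs_cliff u)" for u
  proof (induction u rule: poly_mapping_induct_single)
    case zero
    have "cliff_const 0 * 1 = 0" by (simp add: cliff_const_0)
    then show ?case using const[OF one, of 0] by (simp add: zero_cliff.abs_eq)
  next
    case (add p q)
    then show ?case using assms(1) by (metis plus_cliff.abs_eq)
  next
    case (single w c)
    obtain xs where w: "w = FWord xs" by (cases w)
    have "abs_cliff (Poly_Mapping.single w c) =
        cliff_const c * abs_cliff (Poly_Mapping.single w 1)"
      by (simp add: cliff_const.abs_eq times_cliff.abs_eq mult_single)
    then show ?case using const[OF word] w by simp
  qed
  then show ?thesis using abs_cliff_surj[of a] by blast
qed

lemma fock_induct [case_names vac add scale gen]: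
  assumes "Q vac" "\<And>u v. Q u \<Longrightarrow> Q v \<Longrightarrow> Q (u + v)" "\<And>c v. Q v \<Longrightarrow> Q (fock_scale c v)"
    "\<And>x v. Q v \<Longrightarrow> Q (act (fgen x) v)"
  shows "Q (v :: fock)"
proof -
  have "Q (act a vac)" for a
    by (induction a rule: cliff_induct)
      (simp_all add: act_add_left act_mult act_1 assms flip: fock_scale_def)
  moreover obtain a where "v = abs_fock a" using abs_fock_surj by blast
  then have "v = act a vac" by (simp add: vac_def act.abs_eq)
  ultimately show ?thesis by simp
qed

lemma dfock_cases: obtains a where "w = coact covac a"
proof -
  obtain a where "w = abs_dfock a" using abs_dfock_surj by blast
  then have "w = coact covac a" by (simp add: covac_def coact.abs_eq)
  then show ?thesis by (rule that)
qed

text \<open>The grading is chosen so that \<psi>_k \<psi>*_(k+m), hence the current a_m, has energy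
  -m. Creation operators have energy at least 0, and \<psi>_0 is one of energy exactly 0.\<close>

fun gen_energy :: "fermion \<Rightarrow> int" where
  "gen_energy (Psi n) = n"
| "gen_energy (PsiStar n) = - n"

fun is_creator :: "fermion \<Rightarrow> bool" where
  "is_creator (Psi n) = (n \<ge> 0)"
| "is_creator (PsiStar n) = (n < 0)"

fun dual_gen :: "fermion \<Rightarrow> fermion" where
  "dual_gen (Psi n) = PsiStar n"
| "dual_gen (PsiStar n) = Psi n"

lemma fgen_anticomm: "fgen x * fgen y = - (fgen y * fgen x) + (if y = dual_gen x then 1 else 0)"
proof -
  have "fgen x * fgen y + fgen y * fgen x = (if y = dual_gen x then 1 else 0)"
    by (cases x; cases y)
      (auto simp: psi_anticomm psi_star_anticomm psi_psi_star_anticomm add.commute[of "psi_star _ * psi _"])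
  then show ?thesis by (simp only: uminus_add_conv_diff eq_diff_eq)
qed

lemma act_fgen_anticomm:
  "act (fgen x) (act (fgen y) v) = - act (fgen y) (act (fgen x) v) + (if y = dual_gen x then v else 0)"
  unfolding act_mult[symmetric] fgen_anticomm[of x y]
  by (simp add: act_add_left act_diff_left act_uminus_left act_1)

lemma annihilator_vac: "\<not> is_creator x \<Longrightarrow> act (fgen x) vac = 0"
  by (cases x) (simp_all add: act_psi_vac act_psi_star_vac)

lemma creator_covac: "is_creator x \<Longrightarrow> coact covac (fgen x) = 0"
  by (cases x) (simp_all add: coact_psi_covac coact_psi_star_covac)

lemma gen_energy_creator: "is_creator x \<Longrightarrow> gen_energy x \<ge> 0"
  by (cases x) auto

text \<open>The energy filtration controls all infinite sums, since the energy of a nonzero vector is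
  bounded below.\<close>

inductive energy_le :: "int \<Rightarrow> fock \<Rightarrow> bool" where
  zero: "energy_le E 0"
| vac: "E \<ge> 0 \<Longrightarrow> energy_le E (fock_scale c vac)"
| add: "energy_le E u \<Longrightarrow> energy_le E v \<Longrightarrow> energy_le E (u + v)"
| create: "is_creator x \<Longrightarrow> energy_le E v \<Longrightarrow> E' = E + gen_energy x \<Longrightarrow> energy_le E' (act (fgen x) v)"

lemma energy_le_mono: "energy_le E v \<Longrightarrow> E \<le> E' \<Longrightarrow> energy_le E' v"
proof (induction arbitrary: E' rule: energy_le.induct)
  case (create x E v E1)
  then have "energy_le (E' - gen_energy x) v" by simp
  then show ?case by (intro energy_le.create[OF create.hyps(1)]) auto
qed (auto intro: energy_le.intros)

text \<open>The vacuum requires a bound E \<ge> 0 and \<open>create\<close> never decreases the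
  bound, so a derivation with a negative bound starts from zero vectors only.\<close>

lemma energy_le_neg: "energy_le E v \<Longrightarrow> E < 0 \<Longrightarrow> v = 0"
proof (induction rule: energy_le.induct)
  case (create x E v E')
  then show ?case using gen_energy_creator[of x] by simp
qed auto

lemma energy_le_scale: "energy_le E v \<Longrightarrow> energy_le E (fock_scale c v)"
proof (induction rule: energy_le.induct)
  case (add E u v)
  then show ?case by (simp add: fock.scale_right_distrib energy_le.add)
next
  case (create x E v E')
  then show ?case by (metis act_scale energy_le.create)
qed (auto intro: energy_le.intros)

lemma energy_le_uminus: "energy_le E v \<Longrightarrow> energy_le E (- v)"
  using energy_le_scale[of E v "-1"] by simp

lemma energy_le_sum: "(\<And>i. i \<in> A \<Longrightarrow> energy_le E (f i)) \<Longrightarrow> energy_le E (sum f A)"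
  by (induction A rule: infinite_finite_induct) (auto intro: energy_le.intros)

lemma gen_energy_dual: "gen_energy (dual_gen x) = - gen_energy x"
  by (cases x) auto

text \<open>A creator is covered by \<open>create\<close>. An annihilator is anticommuted inwards
  until it kills the vacuum; the contraction with its dual removes a generator of opposite energy,
  so the bound still fits.\<close>

lemma energy_le_gen: "energy_le E v \<Longrightarrow> energy_le (E + gen_energy x) (act (fgen x) v)"
proof (cases "is_creator x")
  case True
  then show "energy_le E v \<Longrightarrow> energy_le (E + gen_energy x) (act (fgen x) v)"
    by (auto intro: energy_le.create)
next
  case False
  show "energy_le E v \<Longrightarrow> energy_le (E + gen_energy x) (act (fgen x) v)"
  proof (induction rule: energy_le.induct)
    case (vac E c)
    then show ?case by (simp add: act_scale annihilator_vac[OF False] energy_le.zero)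
  next
    case (add E u v)
    then show ?case by (simp add: act_add_right energy_le.add)
  next
    case (create y E v E')
    have "energy_le (E' + gen_energy x) (act (fgen y) (act (fgen x) v))"
      using create by (intro energy_le.create[OF create.hyps(1) create.IH]) auto
    moreover have "y = dual_gen x \<Longrightarrow> energy_le (E' + gen_energy x) v"
      using create by (simp add: gen_energy_dual)
    ultimately show ?case
      unfolding act_fgen_anticomm[of x y]
      by (intro energy_le.add energy_le_uminus) (auto intro: energy_le.zero)
  qed (simp add: energy_le.zero)
qed

lemma energy_le_exists: "\<exists>E. energy_le E v"
proof (induction v rule: fock_induct)
  case vac
  have "energy_le 0 (fock_scale 1 vac)" by (rule energy_le.vac) simp
  then show ?case by auto
next
  case (add u v)
  then obtain E E' where "energy_le E u" "energy_le E' v" by blast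
  then have "energy_le (max E E') u" "energy_le (max E E') v"
    by (auto intro: energy_le_mono)
  then show ?case using energy_le.add by blast
qed (auto intro: energy_le_scale energy_le_gen)

section \<open>The vacuum expectation value\<close>

text \<open>Existence comes from the concrete model in which a state is a function of the set of excited
  modes. Measuring the sign by \<open>int_encode\<close> keeps the counted sets finite even though the occupied
  sets need not be.\<close>

definition mode_sign :: "int \<Rightarrow> int set \<Rightarrow> complex" where
  "mode_sign k D = (- 1) ^ card {j \<in> D. int_encode j < int_encode k}"

definition excite :: "int \<Rightarrow> (int set \<Rightarrow> complex) \<Rightarrow> int set \<Rightarrow> complex" where
  "excite k F D = (if k \<in> D then mode_sign k D * F (D - {k}) else 0)"

definition relax :: "int \<Rightarrow> (int set \<Rightarrow> complex) \<Rightarrow> int set \<Rightarrow> complex" where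
  "relax k F D = (if k \<in> D then 0 else mode_sign k D * F (insert k D))"

lemma finite_below_mode: "finite {j. int_encode j < int_encode k}"
  by (rule finite_inverse_image[of "{..<int_encode k}" int_encode, simplified])
    (simp_all add: inj_int_encode)

lemma mode_sign_square [simp]: "mode_sign k D * mode_sign k D = 1"
  by (simp add: mode_sign_def flip: power_add mult_2)

lemma mode_sign_square' [simp]: "mode_sign k D * (mode_sign k D * c) = c"
  by (simp flip: mult.assoc)

lemma mode_sign_same [simp]:
  "mode_sign k (insert k D) = mode_sign k D" "mode_sign k (D - {k}) = mode_sign k D"
  unfolding mode_sign_def by (auto intro!: arg_cong[where f="\<lambda>S. (- 1) ^ card S"])

lemma mode_sign_insert:
  assumes "l \<noteq> k" "l \<notin> D"
  shows "mode_sign k (insert l D) = (if int_encode l < int_encode k then - mode_sign k D else mode_sign k D)"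
proof (cases "int_encode l < int_encode k")
  case True
  then have "{j \<in> insert l D. int_encode j < int_encode k} = insert l {j \<in> D. int_encode j < int_encode k}"
    by auto
  moreover have "finite {j \<in> D. int_encode j < int_encode k}"
    by (rule finite_subset[OF _ finite_below_mode[of k]]) auto
  ultimately show ?thesis using True assms by (simp add: mode_sign_def)
next
  case False
  then have "{j \<in> insert l D. int_encode j < int_encode k} = {j \<in> D. int_encode j < int_encode k}"
    by auto
  then show ?thesis using False by (simp add: mode_sign_def)
qed

lemma mode_sign_remove:
  assumes "l \<noteq> k" "l \<in> D"
  shows "mode_sign k (D - {l}) = (if int_encode l < int_encode k then - mode_sign k D else mode_sign k D)"
  using mode_sign_insert[of l k "D - {l}"] assms by (auto simp: insert_absorb)

lemma int_encode_less_linear: "k \<noteq> l \<Longrightarrow> int_encode k < int_encode l \<or> int_encode l < int_encode k"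
  by (metis injD inj_int_encode linorder_neqE_nat)

text \<open>Of two distinct modes exactly one precedes the other in the order given by
  \<open>int_encode\<close>, so exchanging them flips exactly one of the two signs. The same
  argument serves \<open>relax_relax\<close> and the mixed case.\<close>

lemma excite_excite: "excite k (excite l F) D = - excite l (excite k F) D"
proof (cases "k = l")
  case False
  have "D - {k} - {l} = D - {l} - {k}" by auto
  then show ?thesis
  proof (cases "k \<in> D \<and> l \<in> D")
    case True
    define F0 where "F0 = F (D - {k} - {l})"
    have "excite k (excite l F) D = mode_sign k D * (mode_sign l (D - {k}) * F0)"
      "excite l (excite k F) D = mode_sign l D * (mode_sign k (D - {l}) * F0)"
      using True False \<open>D - {k} - {l} = _\<close> by (auto simp: excite_def F0_def)
    then show ?thesis
      using int_encode_less_linear[OF False] False True by (auto simp: mode_sign_remove)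
  qed (auto simp: excite_def)
qed (simp add: excite_def)

lemma relax_relax: "relax k (relax l F) D = - relax l (relax k F) D"
proof (cases "k = l")
  case False
  show ?thesis
  proof (cases "k \<in> D \<or> l \<in> D")
    case out: False
    define F0 where "F0 = F (insert k (insert l D))"
    have "relax k (relax l F) D = mode_sign k D * (mode_sign l (insert k D) * F0)"
      "relax l (relax k F) D = mode_sign l D * (mode_sign k (insert l D) * F0)"
      using out False by (auto simp: relax_def F0_def insert_commute)
    then show ?thesis
      using int_encode_less_linear[OF False] False out by (auto simp: mode_sign_insert)
  qed (auto simp: relax_def)
qed (simp add: relax_def)

text \<open>For k = l exactly one of the two compositions survives on D, according to whether k lies
  in D, and its two equal signs cancel. This produces the central term.\<close>

lemma excite_relax: "excite k (relax l F) D = - relax l (excite k F) D + (if k = l then F D else 0)"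
proof (cases "k = l")
  case True
  then show ?thesis by (auto simp: excite_def relax_def insert_absorb)
next
  case False
  show ?thesis
  proof (cases "k \<in> D \<and> l \<notin> D")
    case True
    define F0 where "F0 = F (insert l (D - {k}))"
    have "excite k (relax l F) D = mode_sign k D * (mode_sign l (D - {k}) * F0)"
      "relax l (excite k F) D = mode_sign l D * (mode_sign k (insert l D) * F0)"
      using True False by (auto simp: excite_def relax_def F0_def insert_Diff_if)
    then show ?thesis
      using int_encode_less_linear[OF False] False True
      by (auto simp: mode_sign_insert mode_sign_remove)
  qed (use False in \<open>auto simp: excite_def relax_def\<close>)
qed

text \<open>Particle-hole convention: a mode n < 0, filled in the vacuum, counts as excited once it
  has been emptied, so \<psi>*_n excites it. The vacuum becomes the empty set, and creation and
  annihilation need no further case distinction.\<close>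

fun rep_gen :: "fermion \<Rightarrow> (int set \<Rightarrow> complex) \<Rightarrow> int set \<Rightarrow> complex" where
  "rep_gen (Psi n) = (if n \<ge> 0 then excite n else relax n)"
| "rep_gen (PsiStar n) = (if n \<ge> 0 then relax n else excite n)"

section \<open>The model as a module over the free algebra and over its quotient\<close>

fun rep_word :: "fword \<Rightarrow> (int set \<Rightarrow> complex) \<Rightarrow> int set \<Rightarrow> complex" where
  "rep_word (FWord xs) F = foldr rep_gen xs F"

definition rep_free :: "free_alg \<Rightarrow> (int set \<Rightarrow> complex) \<Rightarrow> int set \<Rightarrow> complex" where
  "rep_free u F D = (\<Sum>w\<in>Poly_Mapping.keys u. Poly_Mapping.lookup u w * rep_word w F D)"

lemma rep_free_zero [simp]: "rep_free 0 F D = 0"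
  by (simp add: rep_free_def)

lemma rep_free_add: "rep_free (u + v) F D = rep_free u F D + rep_free v F D"
  unfolding rep_free_def
  by (rule setsum_keys_plus_distrib[where f="\<lambda>w c. c * rep_word w F D"]) (simp_all add: distrib_right)

lemma rep_free_uminus: "rep_free (- u) F D = - rep_free u F D"
  using rep_free_add[of "- u" u F D] by (simp add: eq_neg_iff_add_eq_0)

lemma rep_free_diff: "rep_free (u - v) F D = rep_free u F D - rep_free v F D"
  using rep_free_add[of u "- v"] by (simp add: rep_free_uminus)

lemma rep_free_single: "rep_free (Poly_Mapping.single w c) F D = c * rep_word w F D"
  by (simp add: rep_free_def)

lemma rep_gen_linear: "rep_gen x (\<lambda>D. c * F D + G D) D = c * rep_gen x F D + rep_gen x G D"
  by (cases x) (simp_all add: excite_def relax_def algebra_simps)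

lemma rep_word_linear: "rep_word w (\<lambda>D. c * F D + G D) D = c * rep_word w F D + rep_word w G D"
proof -
  have "foldr rep_gen xs (\<lambda>D. c * F D + G D) = (\<lambda>D. c * foldr rep_gen xs F D + foldr rep_gen xs G D)" for xs
  proof (induction xs)
    case (Cons x xs)
    show ?case
      unfolding foldr_Cons comp_apply Cons by (simp add: rep_gen_linear fun_eq_iff)
  qed simp
  then show ?thesis by (cases w) simp
qed

lemma rep_word_zero: "rep_word w (\<lambda>D. 0) D = 0"
  using rep_word_linear[of w 1 "\<lambda>_. 0" "\<lambda>_. 0" D] by simp

lemma rep_word_mult: "rep_word (v + w) F = rep_word v (rep_word w F)"
  by (cases v; cases w) simp

lemma rep_free_mult: "rep_free (u * v) F = rep_free u (rep_free v F)"
proof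
  fix D
  show "rep_free (u * v) F D = rep_free u (rep_free v F) D"
  proof (induction u rule: poly_mapping_induct_single)
    case (single w c)
    show ?case
    proof (induction v rule: poly_mapping_induct_single)
      case zero
      then show ?case by (simp add: rep_free_single rep_word_zero rep_free_def)
    next
      case (add p q)
      have "rep_free (p + q) F = (\<lambda>D. 1 * rep_free p F D + rep_free q F D)"
        by (simp add: rep_free_add fun_eq_iff)
      then show ?case
        using add by (simp add: distrib_left rep_free_add rep_free_single rep_word_linear del: mult_1)
    next
      case (single w' c')
      have "rep_free (Poly_Mapping.single w' c') F = (\<lambda>D. c' * rep_word w' F D + 0)"
        by (simp add: rep_free_single fun_eq_iff)
      then show ?case
        by (simp only: mult_single rep_free_single rep_word_mult rep_word_linear) (simp add: rep_word_zero)
    qed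
  qed (simp_all add: distrib_right rep_free_add)
qed

lemma rep_free_zero_fun [simp]: "rep_free u (\<lambda>D. 0) = (\<lambda>D. 0)"
  by (simp add: fun_eq_iff rep_free_def rep_word_zero)

lemma rep_free_gen: "rep_free (free_gen x) F = rep_gen x F"
  by (simp add: fun_eq_iff free_gen_def rep_free_single)

lemma rep_gen_anticomm:
  "rep_gen x (rep_gen y F) D + rep_gen y (rep_gen x F) D = (if y = dual_gen x then F D else 0)"
proof -
  have ee: "excite k (excite l F) D + excite l (excite k F) D = 0" for k l
    using excite_excite[of k l F D] by simp
  have rr: "relax k (relax l F) D + relax l (relax k F) D = 0" for k l
    using relax_relax[of k l F D] by simp
  have er: "excite k (relax l F) D + relax l (excite k F) D = (if k = l then F D else 0)"
    and re: "relax k (excite l F) D + excite l (relax k F) D = (if k = l then F D else 0)" for k l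
    using excite_relax[of k l F D] excite_relax[of l k F D] by auto
  show ?thesis
    by (cases x; cases y) (auto simp: ee rr er re)
qed

lemma rep_free_relation: "s \<in> cliff_relations \<Longrightarrow> rep_free s F = (\<lambda>D. 0)"
proof (erule cliff_relations.cases)
  have anti: "rep_free (free_anticomm x y) F D = (if y = dual_gen x then F D else 0)" for x y D
    by (simp add: free_anticomm_def rep_free_add rep_free_mult rep_free_gen rep_gen_anticomm)
  have one: "rep_free 1 F D = F D" for D
    by (simp add: rep_free_single zero_fword_def flip: single_one)
  show "s = free_anticomm (Psi m) (Psi n) \<Longrightarrow> rep_free s F = (\<lambda>D. 0)" for m n
    by (simp add: fun_eq_iff anti)
  show "s = free_anticomm (PsiStar m) (PsiStar n) \<Longrightarrow> rep_free s F = (\<lambda>D. 0)" for m n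
    by (simp add: fun_eq_iff anti)
  show "s = free_anticomm (Psi m) (PsiStar n) - (if m = n then 1 else 0) \<Longrightarrow>
      rep_free s F = (\<lambda>D. 0)" for m n
    by (simp add: fun_eq_iff rep_free_diff anti one)
qed

lemma rep_free_ideal: "u \<in> cliff_ideal \<Longrightarrow> rep_free u F = (\<lambda>D. 0)"
  by (induction rule: cliff_ideal.induct)
    (simp_all add: fun_eq_iff rep_free_add rep_free_mult rep_free_relation)

definition rep_cliff_act :: "cliff \<Rightarrow> (int set \<Rightarrow> complex) \<Rightarrow> int set \<Rightarrow> complex" where
  "rep_cliff_act a = rep_free (rep_cliff a)"

text \<open>The representative chosen by \<open>rep_cliff\<close> differs from u by an element of
  the ideal, and the ideal acts as zero.\<close>

lemma rep_cliff_act_abs: "rep_cliff_act (abs_cliff u) F = rep_free u F"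
proof -
  have "cliff_eq (rep_cliff (abs_cliff u)) u"
    by (simp add: Quotient3_abs_rep[OF Quotient3_cliff] flip: cliff.abs_eq_iff)
  then have "rep_free (rep_cliff (abs_cliff u) - u) F = (\<lambda>D. 0)"
    by (simp add: cliff_eq_def rep_free_ideal)
  then show ?thesis by (simp add: rep_cliff_act_def fun_eq_iff rep_free_diff)
qed

lemma rep_cliff_act_add: "rep_cliff_act (a + b) F D = rep_cliff_act a F D + rep_cliff_act b F D"
proof -
  obtain u v where "a = abs_cliff u" "b = abs_cliff v" using abs_cliff_surj by metis
  then show ?thesis by (simp add: plus_cliff.abs_eq rep_cliff_act_abs rep_free_add)
qed

lemma rep_cliff_act_mult: "rep_cliff_act (a * b) F = rep_cliff_act a (rep_cliff_act b F)"
proof -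
  obtain u v where "a = abs_cliff u" "b = abs_cliff v" using abs_cliff_surj by metis
  then show ?thesis by (simp add: times_cliff.abs_eq rep_cliff_act_abs rep_free_mult)
qed

lemma rep_cliff_act_0: "rep_cliff_act 0 F = (\<lambda>D. 0)"
  by (simp add: fun_eq_iff zero_cliff.abs_eq rep_cliff_act_abs)

lemma rep_cliff_act_const: "rep_cliff_act (cliff_const c) F D = c * F D"
  by (simp add: cliff_const.abs_eq rep_cliff_act_abs rep_free_single zero_fword_def)

lemma rep_cliff_act_fgen: "rep_cliff_act (fgen x) F = rep_gen x F"
  by (simp add: fgen_abs rep_cliff_act_abs rep_free_gen)

lemma rep_cliff_act_zero_fun: "rep_cliff_act a (\<lambda>D. 0) = (\<lambda>D. 0)"
  by (simp add: rep_cliff_act_def)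

definition vac_state :: "int set \<Rightarrow> complex" where
  "vac_state D = (if D = {} then 1 else 0)"

text \<open>A matrix coefficient of the model: \<open>vac_state\<close> plays the vacuum, and
  evaluation at the empty set plays the covacuum, since \<open>excite\<close> always vanishes
  there.\<close>

definition cliff_vev :: "cliff \<Rightarrow> complex" where
  "cliff_vev a = rep_cliff_act a vac_state {}"

lemma cliff_vev_add: "cliff_vev (a + b) = cliff_vev a + cliff_vev b"
  by (simp add: cliff_vev_def rep_cliff_act_add)

lemma cliff_vev_0: "cliff_vev 0 = 0"
  by (simp add: cliff_vev_def rep_cliff_act_0)

lemma cliff_vev_const: "cliff_vev (cliff_const c * a) = c * cliff_vev a"
  by (simp add: cliff_vev_def rep_cliff_act_mult rep_cliff_act_const)

lemma cliff_vev_one: "cliff_vev 1 = 1"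
  unfolding cliff_const_1[symmetric] by (simp add: cliff_vev_def rep_cliff_act_const vac_state_def)

lemma cliff_vev_diff: "cliff_vev (a - b) = cliff_vev a - cliff_vev b"
  using cliff_vev_add[of "a - b" b] by simp

lemma cliff_vev_annihilator: "s \<in> annihilators \<Longrightarrow> cliff_vev (a * s) = 0"
proof (erule annihilators.cases)
  have "rep_gen x vac_state = (\<lambda>D. 0)" if "\<not> is_creator x" for x
    using that by (cases x) (auto simp: fun_eq_iff relax_def vac_state_def)
  from this[of "Psi m" for m] this[of "PsiStar m" for m]
  show "s = psi m \<Longrightarrow> m < 0 \<Longrightarrow> cliff_vev (a * s) = 0"
    "s = psi_star m \<Longrightarrow> m \<ge> 0 \<Longrightarrow> cliff_vev (a * s) = 0" for m
    using rep_cliff_act_fgen[of "Psi m"] rep_cliff_act_fgen[of "PsiStar m"]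
    by (simp_all add: cliff_vev_def rep_cliff_act_mult rep_cliff_act_zero_fun)
qed

lemma cliff_vev_co_annihilator: "s \<in> co_annihilators \<Longrightarrow> cliff_vev (s * a) = 0"
proof (erule co_annihilators.cases)
  have "rep_gen x F {} = 0" if "is_creator x" for x F
    using that by (cases x) (auto simp: excite_def)
  from this[of "Psi m" for m] this[of "PsiStar m" for m]
  show "s = psi m \<Longrightarrow> m \<ge> 0 \<Longrightarrow> cliff_vev (s * a) = 0"
    "s = psi_star m \<Longrightarrow> m < 0 \<Longrightarrow> cliff_vev (s * a) = 0" for m
    using rep_cliff_act_fgen[of "Psi m"] rep_cliff_act_fgen[of "PsiStar m"]
    by (simp_all add: cliff_vev_def rep_cliff_act_mult)
qed

lemma cliff_vev_vac_ideal: "u \<in> vac_ideal \<Longrightarrow> cliff_vev (a * u) = 0"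
proof (induction rule: vac_ideal.induct)
  case (gen s b)
  then show ?case using cliff_vev_annihilator[of s "a * b"] by (simp add: mult.assoc)
qed (simp_all add: cliff_vev_0 cliff_vev_add distrib_left)

lemma cliff_vev_covac_ideal: "u \<in> covac_ideal \<Longrightarrow> cliff_vev (u * a) = 0"
proof (induction rule: covac_ideal.induct)
  case (gen s b)
  then show ?case using cliff_vev_co_annihilator[of s "b * a"] by (simp add: mult.assoc)
qed (simp_all add: cliff_vev_0 cliff_vev_add distrib_right)

section \<open>The pairing of the two Fock spaces and its uniqueness\<close>

definition fock_pairing :: "dfock \<Rightarrow> fock \<Rightarrow> complex" where
  "fock_pairing w v = cliff_vev (rep_dfock w * rep_fock v)"

text \<open>Changing the representatives adds an element of \<open>covac_ideal\<close> on the left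
  or of \<open>vac_ideal\<close> on the right, and \<open>cliff_vev\<close> vanishes on both kinds
  of products.\<close>

lemma fock_pairing_abs: "fock_pairing (coact covac a) (act b vac) = cliff_vev (a * b)"
proof -
  define a' b' where "a' = rep_dfock (abs_dfock a)" and "b' = rep_fock (abs_fock b)"
  have "abs_dfock a' = abs_dfock a" "abs_fock b' = abs_fock b"
    unfolding a'_def b'_def
    by (rule Quotient3_abs_rep[OF Quotient3_dfock], rule Quotient3_abs_rep[OF Quotient3_fock])
  then have "a' - a \<in> covac_ideal" "b' - b \<in> vac_ideal"
    by (simp_all add: dfock.abs_eq_iff dfock_eq_def fock.abs_eq_iff fock_eq_def)
  then have "cliff_vev ((a' - a) * b') = 0" "cliff_vev (a * (b' - b)) = 0"
    by (simp_all add: cliff_vev_covac_ideal cliff_vev_vac_ideal)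
  then have "cliff_vev (a' * b') = cliff_vev (a * b)"
    by (simp add: left_diff_distrib right_diff_distrib cliff_vev_diff)
  then show ?thesis
    by (simp add: fock_pairing_def a'_def b'_def covac_def vac_def act.abs_eq coact.abs_eq)
qed

lemma act_vac_cases: obtains a where "v = act a vac"
proof -
  obtain a where "v = abs_fock a" using abs_fock_surj by blast
  then have "v = act a vac" by (simp add: vac_def act.abs_eq)
  then show ?thesis by (rule that)
qed

lemma is_vacuum_pairing_fock_pairing: "is_vacuum_pairing fock_pairing"
proof -
  have add_r: "fock_pairing w (u + v) = fock_pairing w u + fock_pairing w v" for w u v
    by (rule dfock_cases[of w], rule act_vac_cases[of u], rule act_vac_cases[of v])
      (simp add: fock_pairing_abs cliff_vev_add distrib_left flip: act_add_left)
  have add_l: "fock_pairing (w + x) v = fock_pairing w v + fock_pairing x v" for w x v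
    by (rule dfock_cases[of w], rule dfock_cases[of x], rule act_vac_cases[of v])
      (simp add: fock_pairing_abs cliff_vev_add distrib_right flip: coact_add_right)
  have scale_r: "fock_pairing w (fock_scale c v) = c * fock_pairing w v" for w c v
  proof -
    obtain a b where "w = coact covac a" "v = act b vac" by (meson dfock_cases act_vac_cases)
    then have "fock_pairing w (fock_scale c v) = cliff_vev (a * (cliff_const c * b))"
      by (simp add: fock_scale_def fock_pairing_abs flip: act_mult)
    also have "a * (cliff_const c * b) = cliff_const c * (a * b)"
      by (metis cliff_const_commute mult.assoc)
    finally show ?thesis
      by (simp add: cliff_vev_const fock_pairing_abs \<open>w = _\<close> \<open>v = _\<close>)
  qed
  have scale_l: "fock_pairing (dfock_scale c w) v = c * fock_pairing w v" for w c v
  proof -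
    obtain a b where "w = coact covac a" "v = act b vac" by (meson dfock_cases act_vac_cases)
    then have "fock_pairing (dfock_scale c w) v = cliff_vev ((a * cliff_const c) * b)"
      by (simp add: dfock_scale_def fock_pairing_abs flip: coact_mult)
    also have "(a * cliff_const c) * b = cliff_const c * (a * b)"
      by (metis cliff_const_commute mult.assoc)
    finally show ?thesis
      by (simp add: cliff_vev_const fock_pairing_abs \<open>w = _\<close> \<open>v = _\<close>)
  qed
  have bal: "fock_pairing (coact w a) v = fock_pairing w (act a v)" for w v a
    by (rule dfock_cases[of w], rule act_vac_cases[of v])
      (simp add: fock_pairing_abs mult.assoc flip: act_mult coact_mult)
  have one: "fock_pairing covac vac = 1"
    using fock_pairing_abs[of 1 1] cliff_vev_one by (simp add: act_1 coact_1)
  have vs: "vector_space ((*) :: complex \<Rightarrow> complex \<Rightarrow> complex)"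
    by unfold_locales (simp_all add: algebra_simps)
  show ?thesis
    unfolding is_vacuum_pairing_def Vector_Spaces.linear_def module_hom_def module_hom_axioms_def
    using fock.vector_space_axioms dfock.vector_space_axioms vs
      fock.module_axioms dfock.module_axioms
    by (auto simp: add_r add_l scale_r scale_l bal one vector_space_def module_iff_vector_space
        vector_space_pair_def)
qed

lemma is_vacuum_pairingD:
  assumes "is_vacuum_pairing B"
  shows "B w (u + v) = B w u + B w v" "B w (fock_scale c v) = c * B w v" "B w 0 = 0"
    and "B (w + x) v = B w v + B x v" "B (dfock_scale c w) v = c * B w v" "B 0 v = 0"
    and "B (coact w (fgen y)) v = B w (act (fgen y) v)" "B covac vac = 1"
proof -
  interpret r: Vector_Spaces.linear fock_scale "(*)" "\<lambda>v. B w v" for w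
    using assms by (simp add: is_vacuum_pairing_def)
  interpret l: Vector_Spaces.linear dfock_scale "(*)" "\<lambda>w. B w v" for v
    using assms by (simp add: is_vacuum_pairing_def)
  show "B w (u + v) = B w u + B w v" "B w (fock_scale c v) = c * B w v" "B w 0 = 0"
    "B (w + x) v = B w v + B x v" "B (dfock_scale c w) v = c * B w v" "B 0 v = 0"
    by (rule r.add r.scale r.zero l.add l.scale l.zero)+
  show "B (coact w (fgen y)) v = B w (act (fgen y) v)"
    using assms by (cases y) (simp_all add: is_vacuum_pairing_def)
  show "B covac vac = 1" using assms by (simp add: is_vacuum_pairing_def)
qed

text \<open>Balance is postulated for the generators only. It passes to products by iteration and to
  constants by bilinearity.\<close>

lemma pairing_balance:
  assumes "is_vacuum_pairing B"
  shows "B (coact w a) v = B w (act a v)"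
proof (induction a arbitrary: w v rule: cliff_induct)
  case (const_mult c a)
  then show ?case
    by (simp add: coact_mult act_mult is_vacuum_pairingD[OF assms]
        flip: fock_scale_def dfock_scale_def)
qed (simp_all add: coact_add_right act_add_left coact_mult act_mult coact_1 act_1
    is_vacuum_pairingD[OF assms])

text \<open>The covacuum generates the dual space, so by balance only the functional of the covacuum
  has to be compared. There \<open>energy_le\<close> serves as an induction principle that builds
  vectors with creators alone: anything that begins with a creator pairs to zero.\<close>

lemma pairing_unique:
  assumes B: "is_vacuum_pairing B" and B': "is_vacuum_pairing B'"
  shows "B = B'"
proof -
  have cov: "B covac v = B' covac v" for v
  proof -
    obtain E where "energy_le E v" using energy_le_exists by blast
    then show ?thesis
    proof (induction rule: energy_le.induct)
      case (vac E c)
      show ?case by (simp add: is_vacuum_pairingD[OF B] is_vacuum_pairingD[OF B'])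
    next
      case (create x E v E')
      have "C covac (act (fgen x) v) = 0" if "is_vacuum_pairing C" for C
        using is_vacuum_pairingD(7)[OF that, of covac x v] is_vacuum_pairingD(6)[OF that]
        by (simp add: creator_covac[OF create.hyps(1)])
      from this[OF B] this[OF B'] show ?case by simp
    qed (simp_all add: is_vacuum_pairingD[OF B] is_vacuum_pairingD[OF B'])
  qed
  show ?thesis
  proof (intro ext)
    fix w v
    obtain a where "w = coact covac a" by (rule dfock_cases)
    then show "B w v = B' w v"
      by (simp add: pairing_balance[OF B] pairing_balance[OF B'] cov)
  qed
qed

lemma is_vacuum_pairing_vev: "is_vacuum_pairing vev"
  unfolding vev_def
  by (rule theI[of is_vacuum_pairing, OF is_vacuum_pairing_fock_pairing]) (rule pairing_unique[OF _ is_vacuum_pairing_fock_pairing])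

lemma vev_linear:
  "vev w (u + v) = vev w u + vev w v" "vev w (fock_scale c v) = c * vev w v"
  by (simp_all add: is_vacuum_pairingD[OF is_vacuum_pairing_vev])

lemma vev_zero: "vev w 0 = 0"
  using vev_linear(1)[of w 0 0] by simp

section \<open>Shifted vacua\<close>

lemma shifted_vac_Suc: "shifted_vac (Suc r) = act (psi_star (- int (Suc r))) (shifted_vac r)"
  by (simp add: shifted_vac_def act_mult)

lemma shifted_covac_Suc: "shifted_covac (Suc r) = coact (shifted_covac r) (psi (- int (Suc r)))"
  by (simp add: shifted_covac_def coact_mult)

text \<open>In |-r> the modes -1, ..., -r have been emptied and those below -r are still filled. For
  n < -r the operator \<psi>_n passes every \<psi>*_(-k) with k \<le> r without contraction.\<close>

lemma act_psi_shifted_vac: "n < - int r \<Longrightarrow> act (psi n) (shifted_vac r) = 0"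
proof (induction r)
  case 0
  then show ?case by (simp add: shifted_vac_def act_1 act_psi_vac)
next
  case (Suc r)
  then have "act (fgen (Psi n)) (act (fgen (PsiStar (- int (Suc r)))) (shifted_vac r)) = 0"
    by (subst act_fgen_anticomm) simp
  then show ?case by (simp add: shifted_vac_Suc)
qed

lemma act_psi_star_shifted_vac: "n \<ge> - int r \<Longrightarrow> act (psi_star n) (shifted_vac r) = 0"
proof (induction r)
  case 0
  then show ?case by (simp add: shifted_vac_def act_1 act_psi_star_vac)
next
  case (Suc r)
  have *: "act (psi_star n) (act (psi_star m) v) = - act (psi_star m) (act (psi_star n) v)" for m v
    using act_fgen_anticomm[of "PsiStar n" "PsiStar m" v] by simp
  show ?case
  proof (cases "n = - int (Suc r)")
    case True
    have "act (psi_star n) (act (psi_star n) v) = 0" for v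
    proof -
      let ?w = "act (psi_star n) (act (psi_star n) v)"
      \<comment> \<open>Anticommuting \<psi>*_n with itself only gives twice the vector equal to 0;
        the scalar 2 is invertible.\<close>
      have "?w + ?w = 0" using *[of n v] by (metis add.right_inverse)
      then have "fock_scale 2 ?w = 0"
        using fock.scale_left_distrib[of 1 1 ?w] by simp
      then show ?thesis by simp
    qed
    then show ?thesis by (simp only: shifted_vac_Suc True)
  next
    case False
    then show ?thesis using Suc by (simp add: shifted_vac_Suc *)
  qed
qed

lemma vev_shifted_vac: "vev (shifted_covac r) (shifted_vac r) = 1"
proof (induction r)
  case 0
  then show ?case
    by (simp add: shifted_vac_def shifted_covac_def act_1 coact_1
        is_vacuum_pairingD[OF is_vacuum_pairing_vev])
next
  case (Suc r)
  let ?n = "- int (Suc r)"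
  have "act (psi ?n) (act (psi_star ?n) (shifted_vac r)) = shifted_vac r"
    using act_fgen_anticomm[of "Psi ?n" "PsiStar ?n" "shifted_vac r"]
    by (simp add: act_psi_shifted_vac)
  then show ?case
    using Suc is_vacuum_pairingD(7)[OF is_vacuum_pairing_vev, of _ "Psi ?n"]
    by (simp add: shifted_vac_Suc shifted_covac_Suc)
qed

section \<open>Current operators\<close>

definition fock_linear :: "(fock \<Rightarrow> fock) \<Rightarrow> bool" where
  "fock_linear T \<longleftrightarrow> (\<forall>u v. T (u + v) = T u + T v) \<and> (\<forall>c v. T (fock_scale c v) = fock_scale c (T v))"

lemma fock_linearD:
  assumes "fock_linear T"
  shows "T (u + v) = T u + T v" "T (fock_scale c v) = fock_scale c (T v)" "T 0 = 0"
    "T (- v) = - T v" "T (u - v) = T u - T v"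
proof -
  show add: "T (u + v) = T u + T v" for u v using assms by (simp add: fock_linear_def)
  show scale: "T (fock_scale c v) = fock_scale c (T v)" for c v using assms by (simp add: fock_linear_def)
  show "T 0 = 0" using scale[of 0 0] by simp
  show uminus: "T (- v) = - T v" for v using scale[of "-1" v] by simp
  show "T (u - v) = T u - T v" using add[of u "- v"] uminus[of v] by simp
qed

lemma fock_linear_act: "fock_linear (act a)"
  by (simp add: fock_linear_def act_add_right act_scale)

text \<open>Fock space is cyclic, so an operator commuting with all generators is determined by its
  value on the vacuum.\<close>

lemma commuting_fock_linear_scalar:
  assumes "fock_linear T" and "\<And>x v. T (act (fgen x) v) = act (fgen x) (T v)"
    and "T vac = fock_scale c vac"
  shows "T v = fock_scale c v"
  by (induction v rule: fock_induct)
    (simp_all add: assms fock_linearD[OF assms(1)] fock.scale_right_distrib act_scale mult.commute)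

text \<open>For m \<noteq> 0 the two factors anticommute to zero, so normal ordering changes
  nothing.\<close>

lemma current_term:
  assumes "m \<noteq> 0"
  shows "act (normal_ordered k (k + m)) v = act (psi k) (act (psi_star (k + m)) v)"
  using assms act_fgen_anticomm[of "Psi k" "PsiStar (k + m)" v]
  by (simp add: normal_ordered_def act_mult act_uminus_left)

text \<open>For k < -E already \<psi>_k would push the energy below 0, and for k > E - m already
  \<psi>*_(k+m) would. The energy thus cuts the current down to a finite window.\<close>

lemma current_term_zero:
  assumes "energy_le E v" "m \<noteq> 0" "k \<notin> {- E..E - m}"
  shows "act (psi k) (act (psi_star (k + m)) v) = 0"
proof (cases "k < - E")
  case True
  then have "act (psi k) v = 0"
    using energy_le_neg[OF energy_le_gen[OF assms(1), of "Psi k"]] by simp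
  then show ?thesis
    using assms(2) act_fgen_anticomm[of "Psi k" "PsiStar (k + m)" v] by simp
next
  case False
  then have "act (psi_star (k + m)) v = 0"
    using assms energy_le_neg[OF energy_le_gen[OF assms(1), of "PsiStar (k + m)"]] by simp
  then show ?thesis by simp
qed

lemma current_eq_sum:
  assumes "m \<noteq> 0" "finite S" "\<And>k. k \<notin> S \<Longrightarrow> act (psi k) (act (psi_star (k + m)) v) = 0"
  shows "current m v = (\<Sum>k\<in>S. act (psi k) (act (psi_star (k + m)) v))"
  unfolding current_def current_term[OF assms(1)]
  using assms by (intro Sum_any.expand_superset) auto

lemma current_eq_sum_energy:
  assumes "m \<noteq> 0" "energy_le E v"
  shows "current m v = (\<Sum>k\<in>{- E..E - m}. act (psi k) (act (psi_star (k + m)) v))"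
  using assms by (intro current_eq_sum current_term_zero[OF assms(2)]) auto

lemma energy_le_exists2: "\<exists>E. energy_le E u \<and> energy_le E v"
proof -
  obtain E E' where "energy_le E u" "energy_le E' v" using energy_le_exists by metis
  then have "energy_le (max E E') u" "energy_le (max E E') v" by (auto intro: energy_le_mono)
  then show ?thesis by blast
qed

lemma fock_linear_current:
  assumes "m \<noteq> 0"
  shows "fock_linear (current m)"
  unfolding fock_linear_def
proof (intro conjI allI)
  fix u v :: fock and c
  obtain E where E: "energy_le E u" "energy_le E v" using energy_le_exists2 by blast
  show "current m (u + v) = current m u + current m v"
    using assms energy_le.add[OF E] E
    by (simp add: current_eq_sum_energy[of m E] act_add_right sum.distrib)
  show "current m (fock_scale c v) = fock_scale c (current m v)"
    using assms energy_le_scale[OF E(2), of c] E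
    by (simp add: current_eq_sum_energy[of m E] act_scale fock.scale_sum_right)
qed

lemma energy_le_current:
  assumes "m \<noteq> 0" "energy_le E v"
  shows "energy_le (E - m) (current m v)"
  unfolding current_eq_sum_energy[OF assms]
proof (rule energy_le_sum)
  fix k
  show "energy_le (E - m) (act (psi k) (act (psi_star (k + m)) v))"
    using energy_le_gen[OF energy_le_gen[OF assms(2), of "PsiStar (k + m)"], of "Psi k"] by simp
qed

lemma current_psi:
  assumes "m \<noteq> 0"
  shows "current m (act (psi k) v) = act (psi k) (current m v) + act (psi (k - m)) v"
proof -
  obtain E where E: "energy_le E v" "energy_le E (act (psi k) v)" using energy_le_exists2 by blast
  \<comment> \<open>Besides the energy window, S holds the single index at which the contraction
    with \<psi>_k contributes.\<close>
  define S where "S = insert (k - m) {- E..E - m}"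
  have fin: "finite S" by (simp add: S_def)
  have "act (psi j) (act (psi_star (j + m)) (act (psi k) v)) =
      act (psi k) (act (psi j) (act (psi_star (j + m)) v)) + (if j = k - m then act (psi j) v else 0)" for j
  proof -
    have 1: "act (psi_star (j + m)) (act (psi k) v) =
        - act (psi k) (act (psi_star (j + m)) v) + (if k = j + m then v else 0)"
      using act_fgen_anticomm[of "PsiStar (j + m)" "Psi k" v] by auto
    have 2: "act (psi j) (act (psi k) w) = - act (psi k) (act (psi j) w)" for w
      using act_fgen_anticomm[of "Psi j" "Psi k" w] by simp
    show ?thesis unfolding 1 by (auto simp: act_add_right act_uminus act_diff 2)
  qed
  moreover have "current m v = (\<Sum>j\<in>S. act (psi j) (act (psi_star (j + m)) v))"
    using assms fin E(1) by (intro current_eq_sum) (auto simp: S_def intro: current_term_zero)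
  moreover have "current m (act (psi k) v) = (\<Sum>j\<in>S. act (psi j) (act (psi_star (j + m)) (act (psi k) v)))"
    using assms fin E(2) by (intro current_eq_sum) (auto simp: S_def intro: current_term_zero)
  ultimately show ?thesis
    using fin by (simp add: sum.distrib act_sum) (simp add: S_def)
qed

lemma current_psi_star:
  assumes "m \<noteq> 0"
  shows "current m (act (psi_star k) v) = act (psi_star k) (current m v) - act (psi_star (k + m)) v"
proof -
  obtain E where E: "energy_le E v" "energy_le E (act (psi_star k) v)" using energy_le_exists2 by blast
  define S where "S = insert k {- E..E - m}"
  have fin: "finite S" by (simp add: S_def)
  have "act (psi j) (act (psi_star (j + m)) (act (psi_star k) v)) =
      act (psi_star k) (act (psi j) (act (psi_star (j + m)) v)) +
      (if j = k then - act (psi_star (j + m)) v else 0)" for j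
  proof -
    have 1: "act (psi_star (j + m)) (act (psi_star k) v) = - act (psi_star k) (act (psi_star (j + m)) v)"
      using act_fgen_anticomm[of "PsiStar (j + m)" "PsiStar k" v] by auto
    have 2: "act (psi j) (act (psi_star k) w) = - act (psi_star k) (act (psi j) w) + (if j = k then w else 0)" for w
      using act_fgen_anticomm[of "Psi j" "PsiStar k" w] by auto
    show ?thesis unfolding 1 by (auto simp: act_uminus 2)
  qed
  moreover have "current m v = (\<Sum>j\<in>S. act (psi j) (act (psi_star (j + m)) v))"
    using assms fin E(1) by (intro current_eq_sum) (auto simp: S_def intro: current_term_zero)
  moreover have "current m (act (psi_star k) v) =
      (\<Sum>j\<in>S. act (psi j) (act (psi_star (j + m)) (act (psi_star k) v)))"
    using assms fin E(2) by (intro current_eq_sum) (auto simp: S_def intro: current_term_zero)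
  ultimately show ?thesis
    using fin by (simp add: sum.distrib act_sum) (simp add: S_def)
qed

text \<open>A summand dies because of \<psi>_k when k < -r, and because of \<psi>*_(k+m) when k
  \<ge> -r.\<close>

lemma current_shifted_vac:
  assumes "m > 0"
  shows "current m (shifted_vac r) = 0"
proof -
  have "act (psi k) (act (psi_star (k + m)) (shifted_vac r)) = 0" for k
  proof (cases "k < - int r")
    case True
    then show ?thesis
      using assms act_fgen_anticomm[of "Psi k" "PsiStar (k + m)" "shifted_vac r"]
      by (simp add: act_psi_shifted_vac)
  qed (use assms in \<open>simp add: act_psi_star_shifted_vac\<close>)
  then show ?thesis using assms by (subst current_eq_sum[where S="{}"]) auto
qed

lemma current_vac: "m > 0 \<Longrightarrow> current m vac = 0"
  using current_shifted_vac[of m 0] by (simp add: shifted_vac_def act_1)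

lemma current_commutator_linear:
  assumes "m \<noteq> 0" "n \<noteq> 0"
  shows "fock_linear (\<lambda>v. current m (current n v) - current n (current m v))"
  using fock_linearD[OF fock_linear_current[OF assms(1)]] fock_linearD[OF fock_linear_current[OF assms(2)]]
  by (simp add: fock_linear_def fock.scale_right_diff_distrib)

lemma current_commutator_gen:
  assumes "m \<noteq> 0" "n \<noteq> 0"
  shows "current m (current n (act (fgen x) v)) - current n (current m (act (fgen x) v)) =
    act (fgen x) (current m (current n v) - current n (current m v))"
  by (cases x)
    (simp_all add: current_psi current_psi_star assms act_diff algebra_simps
      fock_linearD[OF fock_linear_current[OF assms(1)]] fock_linearD[OF fock_linear_current[OF assms(2)]])

lemma current_commute:
  assumes "m > 0" "n > 0"
  shows "current m (current n v) = current n (current m v)"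
proof -
  have "current m (current n v) - current n (current m v) = fock_scale 0 v"
  proof (rule commuting_fock_linear_scalar[where T="\<lambda>v. current m (current n v) - current n (current m v)"])
    show "current m (current n vac) - current n (current m vac) = fock_scale 0 vac"
      using assms by (simp add: current_vac fock_linearD(3)[OF fock_linear_current])
  qed (use assms current_commutator_linear current_commutator_gen in auto)
  then show ?thesis by simp
qed

text \<open>A commutator of currents commutes with all fermions, hence is a scalar, and that scalar is
  read off from its action on the vacuum.\<close>

lemma current_heisenberg:
  assumes "m > 0" "n > 0"
  shows "current m (current (- n) v) =
    current (- n) (current m v) + (if m = n then fock_scale (of_int m) v else 0)"
proof -
  define f where "f k = act (psi k) (act (psi_star (k + m - n)) vac)" for k
  have f_high: "f k = 0" if "k \<ge> n - m" for k
    using that by (simp add: f_def act_psi_star_vac)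
  have f_low: "f k = (if m = n then vac else 0)" if "k < 0" for k
    using that act_fgen_anticomm[of "Psi k" "PsiStar (k + m - n)" vac]
    by (auto simp: f_def act_psi_vac)
  have lin: "fock_linear (current m)" using assms by (intro fock_linear_current) simp
  have sum_lin: "current m (\<Sum>i\<in>A. g i) = (\<Sum>i\<in>A. current m (g i))" for g and A :: "int set"
    by (induction A rule: infinite_finite_induct) (simp_all add: fock_linearD[OF lin])
  have zero: "act (psi k) (act (psi_star (k - n)) vac) = 0" if "k \<notin> {0..<n}" for k
  proof (cases "k < 0")
    case True
    then show ?thesis
      using assms act_fgen_anticomm[of "Psi k" "PsiStar (k - n)" vac] by (simp add: act_psi_vac)
  qed (use that in \<open>simp add: act_psi_star_vac\<close>)
  have "current (- n) vac = (\<Sum>k\<in>{0..<n}. act (psi k) (act (psi_star (k - n)) vac))"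
    using assms zero current_eq_sum[of "- n" "{0..<n}" vac] by simp
  then have "current m (current (- n) vac) =
      (\<Sum>k\<in>{0..<n}. current m (act (psi k) (act (psi_star (k - n)) vac)))"
    by (simp add: sum_lin)
  \<comment> \<open>The current a_m shifts \<psi>_k down by m and \<psi>*_(k-n) up by m with
    opposite signs, so the sum telescopes. The m indices in {-m..<0} remain, each contributing the
    vacuum when m = n; this is the origin of the factor m.\<close>
  also have "\<dots> = (\<Sum>k\<in>{0..<n}. f (k - m) - f k)"
    using assms by (intro sum.cong refl)
      (simp add: current_psi current_psi_star current_vac f_def act_uminus algebra_simps)
  also have "\<dots> = (\<Sum>k\<in>{0..<n}. f (k - m)) - (\<Sum>k\<in>{0..<n}. f k)"
    by (rule sum_subtractf)
  also have "(\<Sum>k\<in>{0..<n}. f (k - m)) = (\<Sum>k\<in>{- m..<n - m}. f k)"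
    by (rule sum.reindex_bij_witness[of _ "\<lambda>k. k + m" "\<lambda>k. k - m"]) auto
  also have "\<dots> = (\<Sum>k\<in>{- m..<n}. f k)"
    using assms f_high by (intro sum.mono_neutral_left) auto
  also have "\<dots> = (\<Sum>k\<in>{- m..<0}. f k) + (\<Sum>k\<in>{0..<n}. f k)"
    using assms by (subst sum.union_disjoint[symmetric]) (auto intro!: sum.cong)
  also have "(\<Sum>k\<in>{- m..<0}. f k) = (\<Sum>k\<in>{- m..<0}. if m = n then vac else 0)"
    by (intro sum.cong) (auto simp: f_low)
  also have "\<dots> = fock_scale (if m = n then of_int m else 0) vac"
    using assms fock.sum_constant_scale[of vac "{- m..<0}"] by (cases "m = n") simp_all
  finally have vac: "current m (current (- n) vac) = fock_scale (if m = n then of_int m else 0) vac"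
    by simp
  have "current m (current (- n) v) - current (- n) (current m v) =
      fock_scale (if m = n then of_int m else 0) v"
  proof (rule commuting_fock_linear_scalar
      [where T="\<lambda>v. current m (current (- n) v) - current (- n) (current m v)"])
    show "current m (current (- n) vac) - current (- n) (current m vac) =
        fock_scale (if m = n then of_int m else 0) vac"
      using assms vac by (simp add: current_vac fock_linearD(3)[OF fock_linear_current])
  qed (use assms current_commutator_linear[of m "- n"] current_commutator_gen[of m "- n"] in auto)
  then show ?thesis by (auto simp: algebra_simps)
qed

section \<open>Extension of scalars\<close>

text \<open>Summing over common index sets for several arguments makes additivity a termwise
  statement.\<close>

lemma poly_scale_superset:
  assumes "finite A" "finite B" "Poly_Mapping.keys p \<subseteq> A" "Poly_Mapping.keys v \<subseteq> B"
  shows "poly_scale p v = (\<Sum>m\<in>A. \<Sum>n\<in>B.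
    Poly_Mapping.single (m + n) (fock_scale (Poly_Mapping.lookup p m) (Poly_Mapping.lookup v n)))"
proof -
  have "poly_scale p v = (\<Sum>m\<in>Poly_Mapping.keys p. \<Sum>n\<in>B.
    Poly_Mapping.single (m + n) (fock_scale (Poly_Mapping.lookup p m) (Poly_Mapping.lookup v n)))"
    unfolding poly_scale_def
    using assms by (intro sum.cong refl sum.mono_neutral_left) (auto simp: in_keys_iff)
  also have "\<dots> = (\<Sum>m\<in>A. \<Sum>n\<in>B.
    Poly_Mapping.single (m + n) (fock_scale (Poly_Mapping.lookup p m) (Poly_Mapping.lookup v n)))"
    using assms by (intro sum.mono_neutral_left) (auto simp: in_keys_iff)
  finally show ?thesis .
qed

lemma poly_scale_zero [simp]: "poly_scale p 0 = 0" "poly_scale 0 v = 0"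
  by (simp_all add: poly_scale_def)

lemma poly_scale_add_left: "poly_scale (p + q) v = poly_scale p v + poly_scale q v"
proof -
  let ?A = "Poly_Mapping.keys p \<union> Poly_Mapping.keys q"
  have "poly_scale x v = (\<Sum>m\<in>?A. \<Sum>n\<in>Poly_Mapping.keys v.
      Poly_Mapping.single (m + n) (fock_scale (Poly_Mapping.lookup x m) (Poly_Mapping.lookup v n)))"
    if "x \<in> {p, q, p + q}" for x
    using that keys_add[of p q] by (intro poly_scale_superset) auto
  then show ?thesis
    by (simp add: lookup_add fock.scale_left_distrib single_add sum.distrib)
qed

lemma poly_scale_add_right: "poly_scale p (u + v) = poly_scale p u + poly_scale p v"
proof -
  let ?A = "Poly_Mapping.keys u \<union> Poly_Mapping.keys v"
  have "poly_scale p x = (\<Sum>m\<in>Poly_Mapping.keys p. \<Sum>n\<in>?A.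
      Poly_Mapping.single (m + n) (fock_scale (Poly_Mapping.lookup p m) (Poly_Mapping.lookup x n)))"
    if "x \<in> {u, v, u + v}" for x
    using that keys_add[of u v] by (intro poly_scale_superset) auto
  then show ?thesis
    by (simp add: lookup_add fock.scale_right_distrib single_add sum.distrib)
qed

lemma poly_scale_single [simp]:
  "poly_scale (Poly_Mapping.single m c) (Poly_Mapping.single n v) =
    Poly_Mapping.single (m + n) (fock_scale c v)"
  by (simp add: poly_scale_def)

lemma poly_scale_mult: "poly_scale (p * q) v = poly_scale p (poly_scale q v)"
proof (induction p rule: poly_mapping_induct_single)
  case (single m c)
  show ?case
  proof (induction q rule: poly_mapping_induct_single)
    case (single n d)
    show ?case
      by (induction v rule: poly_mapping_induct_single)
        (simp_all add: poly_scale_add_right mult_single add.assoc)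
  qed (simp_all add: distrib_left poly_scale_add_left poly_scale_add_right)
qed (simp_all add: distrib_right poly_scale_add_left)

lemma poly_scale_one [simp]: "poly_scale 1 v = v"
proof (induction v rule: poly_mapping_induct_single)
  case (single k c)
  then show ?case using poly_scale_single[of 0 1 k c] by simp
qed (simp_all add: poly_scale_add_right)

lemma poly_scale_sum_left: "poly_scale (\<Sum>i\<in>A. f i) v = (\<Sum>i\<in>A. poly_scale (f i) v)"
  by (induction A rule: infinite_finite_induct) (simp_all add: poly_scale_add_left)

lemma poly_scale_sum_right: "poly_scale p (\<Sum>i\<in>A. f i) = (\<Sum>i\<in>A. poly_scale p (f i))"
  by (induction A rule: infinite_finite_induct) (simp_all add: poly_scale_add_right)

lemma xscale_nth: "fps_nth (xscale c V) k = (\<Sum>i=0..k. poly_scale (fps_nth c i) (fps_nth V (k - i)))"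
  by (simp add: xscale_def atMost_atLeast0)

lemma xscale_add_right: "xscale c (U + V) = xscale c U + xscale c V"
  by (rule fps_ext) (simp add: xscale_nth poly_scale_add_right sum.distrib)

lemma xscale_add_left: "xscale (c + d) V = xscale c V + xscale d V"
  by (rule fps_ext) (simp add: xscale_nth poly_scale_add_left sum.distrib)

lemma xscale_zero [simp]: "xscale c 0 = 0" "xscale 0 V = 0"
  by (rule fps_ext; simp add: xscale_nth)+

lemma xscale_mult: "xscale (c * d) V = xscale c (xscale d V)"
proof (rule fps_ext)
  fix k
  have "fps_nth (xscale (c * d) V) k =
      (\<Sum>j=0..k. \<Sum>i=0..j. poly_scale (fps_nth c i) (poly_scale (fps_nth d (j - i)) (fps_nth V (k - j))))"
    by (simp add: xscale_nth fps_mult_nth poly_scale_sum_left poly_scale_mult)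
  also have "\<dots> = (\<Sum>j=0..k. \<Sum>i=0..k - j.
      poly_scale (fps_nth c j) (poly_scale (fps_nth d i) (fps_nth V (k - j - i))))"
    by (rule fps_mult_assoc_lemma)
  also have "\<dots> = fps_nth (xscale c (xscale d V)) k"
    by (simp add: xscale_nth poly_scale_sum_right)
  finally show "fps_nth (xscale (c * d) V) k = fps_nth (xscale c (xscale d V)) k" .
qed

lemma xscale_const_nth: "fps_nth (xscale (fps_const p) V) k = poly_scale p (fps_nth V k)"
proof -
  have "fps_nth (xscale (fps_const p) V) k =
      (\<Sum>i=0..k. if i = 0 then poly_scale p (fps_nth V k) else 0)"
    unfolding xscale_nth by (rule sum.cong) auto
  then show ?thesis by simp
qed

lemma xscale_one [simp]: "xscale 1 V = V"
  by (rule fps_ext) (metis fps_const_1_eq_1 poly_scale_one xscale_const_nth)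

lemma xscale_beta_power_nth:
  "fps_nth (xscale (beta ^ n) V) k = (if k < n then 0 else fps_nth V (k - n))"
proof -
  have "fps_nth (xscale (beta ^ n) V) k = (\<Sum>i=0..k. if i = n then fps_nth V (k - n) else 0)"
    unfolding xscale_nth by (rule sum.cong) (auto simp: beta_def)
  then show ?thesis by simp
qed

lemma xscale_uminus: "xscale (- c) V = - xscale c V" "xscale c (- V) = - xscale c V"
proof -
  have "xscale (- c) V + xscale c V = 0" by (simp flip: xscale_add_left)
  then show "xscale (- c) V = - xscale c V" by (simp add: eq_neg_iff_add_eq_0)
  have "xscale c (- V) + xscale c V = 0" by (simp flip: xscale_add_right)
  then show "xscale c (- V) = - xscale c V" by (simp add: eq_neg_iff_add_eq_0)
qed

lemma xscale_sum_left: "xscale (\<Sum>i\<in>A. f i) V = (\<Sum>i\<in>A. xscale (f i) V)"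
  by (induction A rule: infinite_finite_induct) (simp_all add: xscale_add_left)

lemma xscale_commute: "xscale c (xscale d V) = xscale d (xscale c V)"
  by (metis mult.commute xscale_mult)

definition xlinear :: "(xfock \<Rightarrow> xfock) \<Rightarrow> bool" where
  "xlinear T \<longleftrightarrow> (\<forall>U V. T (U + V) = T U + T V) \<and> (\<forall>c V. T (xscale c V) = xscale c (T V))"

lemma xlinearD:
  assumes "xlinear T"
  shows "T (U + V) = T U + T V" "T (xscale c V) = xscale c (T V)" "T 0 = 0"
    "T (- V) = - T V" "T (U - V) = T U - T V" "T (\<Sum>i\<in>A. f i) = (\<Sum>i\<in>A. T (f i))"
proof -
  show add: "T (U + V) = T U + T V" for U V using assms by (simp add: xlinear_def)
  show scale: "T (xscale c V) = xscale c (T V)" for c V using assms by (simp add: xlinear_def)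
  show zero: "T 0 = 0" using scale[of 0 0] by simp
  show uminus: "T (- V) = - T V" for V using scale[of "- 1" V] by (simp add: xscale_uminus)
  show "T (U - V) = T U - T V" using add[of U "- V"] uminus[of V] by simp
  show "T (\<Sum>i\<in>A. f i) = (\<Sum>i\<in>A. T (f i))"
    by (induction A rule: infinite_finite_induct) (simp_all add: zero add)
qed

lemma xlinear_xscale: "xlinear (xscale c)"
  by (simp add: xlinear_def xscale_add_right xscale_commute[of c])

lemma xlinear_compose: "xlinear S \<Longrightarrow> xlinear T \<Longrightarrow> xlinear (\<lambda>V. S (T V))"
  by (simp add: xlinear_def)

lemma xlinear_add: "xlinear S \<Longrightarrow> xlinear T \<Longrightarrow> xlinear (\<lambda>V. S V + T V)"
  by (simp add: xlinear_def xscale_add_right algebra_simps)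

lemma xlinear_uminus: "xlinear T \<Longrightarrow> xlinear (\<lambda>V. - T V)"
  by (simp add: xlinear_def xscale_uminus)

lemma xlinear_zero: "xlinear (\<lambda>V. 0)"
  by (simp add: xlinear_def)

lemma xlinear_power: "xlinear T \<Longrightarrow> xlinear (T ^^ n)"
  by (induction n) (simp_all add: xlinear_def)

definition vanishes_upto :: "nat \<Rightarrow> xfock \<Rightarrow> bool" where
  "vanishes_upto k V \<longleftrightarrow> (\<forall>i\<le>k. fps_nth V i = 0)"

text \<open>Scalar linearity already makes an operator continuous for the \<open>\<beta>\<close>-adic topology, as it commutes
  with multiplication by powers of \<open>\<beta>\<close>.\<close>

lemma xlinear_vanishes:
  assumes "xlinear T" "vanishes_upto k V"
  shows "vanishes_upto k (T V)"
proof -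
  have "V = xscale (beta ^ Suc k) (fps_shift (Suc k) V)"
    using assms(2) by (intro fps_ext)
      (auto simp: xscale_beta_power_nth vanishes_upto_def not_less simp del: power_Suc)
  then have "T V = xscale (beta ^ Suc k) (T (fps_shift (Suc k) V))"
    using xlinearD(2)[OF assms(1)] by metis
  then show ?thesis by (simp add: vanishes_upto_def xscale_beta_power_nth del: power_Suc)
qed

lemma xscale_vanishes_left:
  assumes "\<And>i. i \<le> k \<Longrightarrow> fps_nth c i = 0"
  shows "vanishes_upto k (xscale c V)"
  using assms by (simp add: vanishes_upto_def xscale_nth)

lemma vanishes_upto_zero [simp]: "vanishes_upto k 0"
  by (simp add: vanishes_upto_def)

lemma lookup_map_zero: "T 0 = 0 \<Longrightarrow> Poly_Mapping.lookup (Poly_Mapping.map T p) k = T (Poly_Mapping.lookup p k)"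
  by (simp add: Poly_Mapping.map.rep_eq when_def)

lemma map_zero [simp]: "Poly_Mapping.map T 0 = 0"
  by (rule poly_mapping_eqI) (simp add: Poly_Mapping.map.rep_eq)

lemma map_add_hom:
  fixes T :: "'b::comm_monoid_add \<Rightarrow> 'c::comm_monoid_add"
  assumes "\<And>u v. T (u + v) = T u + T v" "T 0 = 0"
  shows "Poly_Mapping.map T (p + q) = Poly_Mapping.map T p + Poly_Mapping.map T q"
  by (rule poly_mapping_eqI) (simp add: lookup_map_zero[of T] assms lookup_add)

lemma scalar_extend_nth: "fps_nth (scalar_extend T V) k = Poly_Mapping.map T (fps_nth V k)"
  by (simp add: scalar_extend_def)

lemma lookup_scalar_extend:
  "T 0 = 0 \<Longrightarrow> Poly_Mapping.lookup (fps_nth (scalar_extend T V) k) m = T (Poly_Mapping.lookup (fps_nth V k) m)"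
  by (simp add: scalar_extend_nth lookup_map_zero)

lemma xfock_eqI:
  "(\<And>k m. Poly_Mapping.lookup (fps_nth U k) m = Poly_Mapping.lookup (fps_nth V k) m) \<Longrightarrow> U = V"
  by (intro fps_ext poly_mapping_eqI)

lemma map_poly_scale:
  assumes "fock_linear T"
  shows "Poly_Mapping.map T (poly_scale p v) = poly_scale p (Poly_Mapping.map T v)"
proof -
  note add = map_add_hom[of T, OF fock_linearD(1,3)[OF assms]]
  show ?thesis
  proof (induction p rule: poly_mapping_induct_single)
    case (single m c)
    show ?case
    proof (induction v rule: poly_mapping_induct_single)
      case (single n u)
      then show ?case by (simp add: map_single fock_linearD[OF assms])
    qed (simp_all add: poly_scale_add_right add)
  qed (simp_all add: poly_scale_add_left add)
qed

lemma xlinear_scalar_extend: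
  assumes "fock_linear T"
  shows "xlinear (scalar_extend T)"
proof -
  note add = map_add_hom[of T, OF fock_linearD(1,3)[OF assms]]
  have sum: "Poly_Mapping.map T (\<Sum>i\<in>A. f i) = (\<Sum>i\<in>A. Poly_Mapping.map T (f i))" for f and A :: "nat set"
    by (induction A rule: infinite_finite_induct) (simp_all add: add)
  show ?thesis
    unfolding xlinear_def
    by (intro conjI allI fps_ext) (simp_all add: scalar_extend_nth add xscale_nth sum map_poly_scale[OF assms])
qed

section \<open>Energy bounds over the extended scalars\<close>

definition xenergy_le :: "int \<Rightarrow> nat \<Rightarrow> xfock \<Rightarrow> bool" where
  "xenergy_le E k V \<longleftrightarrow> (\<forall>i\<le>k. \<forall>m. energy_le E (Poly_Mapping.lookup (fps_nth V i) m))"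

text \<open>Only finitely many vectors of Fock space occur as coefficients up to \<beta>^k. The
  bound depends on k in general.\<close>

lemma xenergy_le_exists: "\<exists>E. xenergy_le E k V"
proof -
  define S where "S = (\<Union>i\<le>k. Poly_Mapping.lookup (fps_nth V i) ` Poly_Mapping.keys (fps_nth V i))"
  have "\<exists>E. \<forall>v\<in>A. energy_le E v" if "finite A" for A
    using that
  proof induction
    case (insert v A)
    then obtain E E' where "\<forall>v\<in>A. energy_le E v" "energy_le E' v" using energy_le_exists by metis
    then have "\<forall>u\<in>insert v A. energy_le (max E E') u" by (auto intro: energy_le_mono)
    then show ?case by blast
  qed simp
  from this[of S] obtain E where "\<forall>v\<in>S. energy_le E v" by (auto simp: S_def)
  then have "energy_le E (Poly_Mapping.lookup (fps_nth V i) m)" if "i \<le> k" for i m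
    using that energy_le.zero[of E]
    by (cases "m \<in> Poly_Mapping.keys (fps_nth V i)") (auto simp: S_def in_keys_iff)
  then show ?thesis by (auto simp: xenergy_le_def)
qed

lemma xenergy_le_mono: "xenergy_le E k V \<Longrightarrow> E \<le> E' \<Longrightarrow> j \<le> k \<Longrightarrow> xenergy_le E' j V"
  unfolding xenergy_le_def by (meson energy_le_mono order_trans)

lemma xenergy_le_neg: "xenergy_le E k V \<Longrightarrow> E < 0 \<Longrightarrow> vanishes_upto k V"
  unfolding xenergy_le_def vanishes_upto_def
  by (intro allI impI poly_mapping_eqI) (simp, metis energy_le_neg)

lemma energy_le_poly_scale:
  assumes "\<And>m. energy_le E (Poly_Mapping.lookup v m)"
  shows "energy_le E (Poly_Mapping.lookup (poly_scale p v) m)"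
  unfolding poly_scale_def lookup_sum lookup_single when_def
  by (intro energy_le_sum) (auto intro: energy_le.zero energy_le_scale assms)

lemma xenergy_le_xscale: "xenergy_le E k V \<Longrightarrow> xenergy_le E k (xscale c V)"
  by (auto simp: xenergy_le_def xscale_nth lookup_sum intro!: energy_le_sum energy_le_poly_scale)

lemma xenergy_le_scalar_extend:
  assumes "xenergy_le E k V" "T 0 = 0" "\<And>v. energy_le E v \<Longrightarrow> energy_le E' (T v)"
  shows "xenergy_le E' k (scalar_extend T V)"
  using assms by (simp add: xenergy_le_def lookup_scalar_extend)

section \<open>Infinite sums of vectors\<close>

text \<open>This is \<open>xsum\<close> over an arbitrary index type, because the modes of a field
  are indexed by integers.\<close>

definition tsum :: "('i \<Rightarrow> xfock) \<Rightarrow> xfock" where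
  "tsum F = Abs_fps (\<lambda>k. Sum_any (\<lambda>n. fps_nth (F n) k))"

definition xsummable :: "('i \<Rightarrow> xfock) \<Rightarrow> bool" where
  "xsummable F \<longleftrightarrow> (\<forall>k. finite {n. fps_nth (F n) k \<noteq> 0})"

lemma xsum_eq_tsum: "xsum F = tsum F"
  by (simp add: xsum_def tsum_def)

lemma tsum_nth:
  assumes "finite S" "\<And>n. n \<notin> S \<Longrightarrow> fps_nth (F n) k = 0"
  shows "fps_nth (tsum F) k = (\<Sum>n\<in>S. fps_nth (F n) k)"
  using assms by (auto simp: tsum_def intro: Sum_any.expand_superset)

lemma xsummable_finite_upto:
  assumes "xsummable F"
  obtains S where "finite S" "\<And>n. n \<notin> S \<Longrightarrow> vanishes_upto k (F n)"
proof
  show "finite (\<Union>i\<le>k. {n. fps_nth (F n) i \<noteq> 0})" using assms by (simp add: xsummable_def)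
qed (auto simp: vanishes_upto_def)

lemma xsummableI:
  assumes "\<And>k. \<exists>S. finite S \<and> (\<forall>n. n \<notin> S \<longrightarrow> vanishes_upto k (F n))"
  shows "xsummable F"
  unfolding xsummable_def
proof
  fix k
  obtain S where "finite S" "\<forall>n. n \<notin> S \<longrightarrow> vanishes_upto k (F n)" using assms by blast
  then show "finite {n. fps_nth (F n) k \<noteq> 0}"
    by (elim finite_subset[rotated]) (auto simp: vanishes_upto_def)
qed

lemma xsummable_natI:
  assumes "\<And>k. \<exists>N. \<forall>n\<ge>N. vanishes_upto k (F n)"
  shows "xsummable (F :: nat \<Rightarrow> xfock)"
proof (rule xsummableI)
  fix k
  obtain N where "\<forall>n\<ge>N. vanishes_upto k (F n)" using assms by blast
  then show "\<exists>S. finite S \<and> (\<forall>n. n \<notin> S \<longrightarrow> vanishes_upto k (F n))"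
    by (intro exI[of _ "{..<N}"]) auto
qed

lemma tsum_add:
  assumes "xsummable F" "xsummable G"
  shows "tsum (\<lambda>n. F n + G n) = tsum F + tsum G"
  using assms by (intro fps_ext) (simp add: tsum_def xsummable_def Sum_any.distrib)

lemma tsum_zero [simp]: "tsum (\<lambda>n. 0) = 0"
  by (rule fps_ext) (simp add: tsum_def)

lemma tsum_single:
  assumes "\<And>n. n \<noteq> a \<Longrightarrow> F n = 0"
  shows "tsum F = F a"
  by (rule fps_ext) (subst tsum_nth[where S="{a}"], auto simp: assms)

text \<open>Up to \<beta>^k the sum agrees with a finite one, and a linear operator preserves the
  vanishing of the difference.\<close>

lemma tsum_xlinear:
  assumes "xlinear T" "xsummable F"
  shows "T (tsum F) = tsum (\<lambda>n. T (F n))" "xsummable (\<lambda>n. T (F n))"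
proof -
  show "xsummable (\<lambda>n. T (F n))"
    by (rule xsummableI) (metis assms xlinear_vanishes xsummable_finite_upto)
  show "T (tsum F) = tsum (\<lambda>n. T (F n))"
  proof (rule fps_ext)
    fix k
    obtain S where S: "finite S" "\<And>n. n \<notin> S \<Longrightarrow> vanishes_upto k (F n)"
      using assms(2) xsummable_finite_upto by blast
    have "fps_nth (tsum F) i = fps_nth (\<Sum>n\<in>S. F n) i" if "i \<le> k" for i
      using that S by (simp add: tsum_nth[OF S(1)] vanishes_upto_def fps_sum_nth)
    then have "vanishes_upto k (tsum F - (\<Sum>n\<in>S. F n))"
      by (simp add: vanishes_upto_def)
    then have "vanishes_upto k (T (tsum F) - (\<Sum>n\<in>S. T (F n)))"
      using xlinear_vanishes[OF assms(1)] by (metis xlinearD(5,6)[OF assms(1)])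
    then have "fps_nth (T (tsum F)) k = (\<Sum>n\<in>S. fps_nth (T (F n)) k)"
      by (simp add: vanishes_upto_def fps_sum_nth)
    also have "\<dots> = fps_nth (tsum (\<lambda>n. T (F n))) k"
      by (intro tsum_nth[symmetric] S(1))
        (use xlinear_vanishes[OF assms(1) S(2)] in \<open>simp add: vanishes_upto_def\<close>)
    finally show "fps_nth (T (tsum F)) k = fps_nth (tsum (\<lambda>n. T (F n))) k" .
  qed
qed

lemma xlinear_tsum:
  assumes "\<And>n. xlinear (T n)" "\<And>V. xsummable (\<lambda>n. T n V)"
  shows "xlinear (\<lambda>V. tsum (\<lambda>n. T n V))"
  unfolding xlinear_def
  by (simp add: xlinearD(1,2)[OF assms(1)] tsum_add assms(2) tsum_xlinear(1)[OF xlinear_xscale assms(2)])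

text \<open>For each power of \<beta> only indices in a square of side J contribute, and the
  triangle j + m < 2 J contains that square.\<close>

lemma tsum_cauchy:
  fixes b :: "nat \<Rightarrow> nat \<Rightarrow> xfock"
  assumes "\<And>k. \<exists>J. \<forall>j m. J \<le> j \<or> J \<le> m \<longrightarrow> fps_nth (b j m) k = 0"
  shows "tsum (\<lambda>N. \<Sum>j\<le>N. b j (N - j)) = tsum (\<lambda>j. tsum (b j))"
proof (rule fps_ext)
  fix k
  obtain J where J: "\<And>j m. J \<le> j \<or> J \<le> m \<Longrightarrow> fps_nth (b j m) k = 0" using assms by blast
  have "fps_nth (tsum (\<lambda>N. \<Sum>j\<le>N. b j (N - j))) k = (\<Sum>N<2 * J. \<Sum>j\<le>N. fps_nth (b j (N - j)) k)"
  proof (subst tsum_nth[where S="{..<2 * J}"])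
    fix N assume "N \<notin> {..<2 * J}"
    then have "J \<le> j \<or> J \<le> N - j" for j by auto
    then show "fps_nth (\<Sum>j\<le>N. b j (N - j)) k = 0" by (simp add: fps_sum_nth J)
  qed (simp_all add: fps_sum_nth)
  also have "\<dots> = (\<Sum>(j, m)\<in>{(j, m). j + m < 2 * J}. fps_nth (b j m) k)"
    by (rule sum.triangle_reindex[symmetric])
  also have "\<dots> = (\<Sum>(j, m)\<in>{..<J} \<times> {..<J}. fps_nth (b j m) k)"
  proof (rule sum.mono_neutral_right)
    show "finite {(j, m). j + m < 2 * J}"
      by (rule finite_subset[of _ "{..<2 * J} \<times> {..<2 * J}"]) auto
  qed (auto intro: J simp: not_less)
  also have "\<dots> = (\<Sum>j<J. \<Sum>m<J. fps_nth (b j m) k)"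
    by (simp add: sum.cartesian_product)
  also have "\<dots> = (\<Sum>j<J. fps_nth (tsum (b j)) k)"
    by (intro sum.cong refl tsum_nth[symmetric]) (auto intro: J)
  also have "\<dots> = fps_nth (tsum (\<lambda>j. tsum (b j))) k"
  proof (rule tsum_nth[symmetric])
    fix j assume "j \<notin> {..<J}"
    then show "fps_nth (tsum (b j)) k = 0" by (subst tsum_nth[where S="{}"]) (auto intro: J)
  qed simp
  finally show "fps_nth (tsum (\<lambda>N. \<Sum>j\<le>N. b j (N - j))) k = fps_nth (tsum (\<lambda>j. tsum (b j))) k" .
qed

section \<open>Exponentials of operators\<close>

lemma scalar_const_mult: "scalar_const (c * d) = scalar_const c * scalar_const d"
  by (simp add: scalar_const_def mult_single)

lemma scalar_const_add: "scalar_const (c + d) = scalar_const c + scalar_const d"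
  by (simp add: scalar_const_def single_add)

lemma scalar_const_one [simp]: "scalar_const 1 = 1"
  by (simp add: scalar_const_def)

text \<open>With divided powers, Leibniz and binomial formulas lose their coefficients.\<close>

definition div_power :: "(xfock \<Rightarrow> xfock) \<Rightarrow> nat \<Rightarrow> xfock \<Rightarrow> xfock" where
  "div_power T n V = xscale (scalar_const (1 / fact n)) ((T ^^ n) V)"

text \<open>Topological nilpotency, pointwise: N may depend on the vector and on the power of
  \<beta>. This is what makes the exponential series summable on each vector.\<close>

definition nilpotent_op :: "(xfock \<Rightarrow> xfock) \<Rightarrow> bool" where
  "nilpotent_op T \<longleftrightarrow> (\<forall>V k. \<exists>N. \<forall>n\<ge>N. vanishes_upto k ((T ^^ n) V))"

lemma xexp_eq_tsum: "xexp T V = tsum (\<lambda>n. div_power T n V)"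
  by (simp add: xexp_def xsum_eq_tsum div_power_def)

lemma xlinear_div_power: "xlinear T \<Longrightarrow> xlinear (div_power T n)"
  unfolding div_power_def by (intro xlinear_compose[OF xlinear_xscale] xlinear_power)

lemma div_power_0 [simp]: "div_power T 0 V = V"
  by (simp add: div_power_def)

lemma xscale_const_cancel:
  assumes "xscale (scalar_const (of_nat (Suc n))) U = xscale (scalar_const (of_nat (Suc n))) V"
  shows "U = V"
proof -
  have "scalar_const (1 / of_nat (Suc n)) * scalar_const (of_nat (Suc n)) = 1"
    by (simp del: of_nat_Suc flip: scalar_const_mult)
  then show ?thesis using assms by (metis xscale_mult xscale_one)
qed

lemma div_power_Suc:
  assumes "xlinear T"
  shows "T (div_power T n V) = xscale (scalar_const (of_nat (Suc n))) (div_power T (Suc n) V)"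
proof -
  have "(1 / fact n :: complex) = of_nat (Suc n) * (1 / fact (Suc n))"
    by (simp del: of_nat_Suc)
  then show ?thesis
    by (simp only: div_power_def xlinearD(2)[OF assms] funpow.simps comp_apply scalar_const_mult xscale_mult)
qed

lemma div_power_vanishes:
  assumes "xlinear T" "nilpotent_op T"
  shows "\<exists>N. \<forall>n\<ge>N. vanishes_upto k (div_power T n V)"
  using assms(2) xlinear_vanishes[OF xlinear_xscale]
  unfolding nilpotent_op_def div_power_def by meson

lemma xsummable_div_power: "xlinear T \<Longrightarrow> nilpotent_op T \<Longrightarrow> xsummable (\<lambda>n. div_power T n V)"
  by (intro xsummable_natI div_power_vanishes)

lemma xlinear_xexp: "xlinear T \<Longrightarrow> nilpotent_op T \<Longrightarrow> xlinear (xexp T)"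
  unfolding xexp_eq_tsum by (intro xlinear_tsum xlinear_div_power xsummable_div_power)

text \<open>If the operators \<open>D j\<close> behave under \<open>X\<close> like the divided powers of an operator commuting with
  \<open>Y\<close>, where \<open>X\<close> acts as the sum of the two, then \<open>X\<close> exponentiates accordingly.\<close>

lemma xexp_leibniz:
  assumes X: "xlinear X" and Y: "xlinear Y" "nilpotent_op Y" and D: "\<And>j. xlinear (D j)"
    and rec: "\<And>j V. X (D j V) = xscale (scalar_const (of_nat (Suc j))) (D (Suc j) V) + D j (Y V)"
    and small: "\<And>V k. \<exists>J. \<forall>j\<ge>J. vanishes_upto k (D j V)"
  shows "xexp X (D 0 V) = tsum (\<lambda>j. D j (xexp Y V))"
proof -
  define b where "b j m = D j (div_power Y m V)" for j m
  have step: "X (b j m) = xscale (scalar_const (of_nat (Suc j))) (b (Suc j) m) +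
      xscale (scalar_const (of_nat (Suc m))) (b j (Suc m))" for j m
    by (simp only: b_def rec div_power_Suc[OF Y(1)] xlinearD(2)[OF D])
  \<comment> \<open>The induction step is proved after multiplication by N + 1: the two parts of the
    Leibniz rule carry the coefficients j and N + 1 - j, whose sum is the constant that
    cancels.\<close>
  have "div_power X N (D 0 V) = (\<Sum>j\<le>N. b j (N - j))" for N
  proof (induction N)
    case 0
    then show ?case by (simp add: b_def)
  next
    case (Suc N)
    let ?c = "\<lambda>n. scalar_const (of_nat n)"
    have "xscale (?c (Suc N)) (div_power X (Suc N) (D 0 V)) = X (div_power X N (D 0 V))"
      by (simp only: div_power_Suc[OF X])
    also have "\<dots> = (\<Sum>j\<le>N. xscale (?c (Suc j)) (b (Suc j) (N - j))) +
        (\<Sum>j\<le>N. xscale (?c (Suc (N - j))) (b j (Suc (N - j))))"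
      by (simp only: Suc xlinearD(6)[OF X] step sum.distrib)
    also have "(\<Sum>j\<le>N. xscale (?c (Suc j)) (b (Suc j) (N - j))) =
        (\<Sum>j\<le>Suc N. xscale (?c j) (b j (Suc N - j)))"
      by (subst sum.atMost_Suc_shift) (simp add: scalar_const_def del: of_nat_Suc)
    also have "(\<Sum>j\<le>N. xscale (?c (Suc (N - j))) (b j (Suc (N - j)))) =
        (\<Sum>j\<le>Suc N. xscale (?c (Suc N - j)) (b j (Suc N - j)))"
      by (subst sum.atMost_Suc)
        (auto simp: scalar_const_def Suc_diff_le simp del: of_nat_Suc of_nat_diff intro!: sum.cong)
    also have "(\<Sum>j\<le>Suc N. xscale (?c j) (b j (Suc N - j))) +
        (\<Sum>j\<le>Suc N. xscale (?c (Suc N - j)) (b j (Suc N - j))) =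
        (\<Sum>j\<le>Suc N. xscale (?c (Suc N)) (b j (Suc N - j)))"
      unfolding sum.distrib[symmetric]
      by (intro sum.cong refl) (simp del: of_nat_Suc of_nat_diff flip: xscale_add_left scalar_const_add of_nat_add)
    also have "\<dots> = xscale (?c (Suc N)) (\<Sum>j\<le>Suc N. b j (Suc N - j))"
      by (rule xlinearD(6)[OF xlinear_xscale, symmetric])
    finally show ?case by (rule xscale_const_cancel)
  qed
  then have "xexp X (D 0 V) = tsum (\<lambda>N. \<Sum>j\<le>N. b j (N - j))"
    by (simp add: xexp_eq_tsum)
  also have "\<dots> = tsum (\<lambda>j. tsum (b j))"
  proof (rule tsum_cauchy)
    fix k
    obtain M where M: "\<forall>m\<ge>M. vanishes_upto k (div_power Y m V)"
      using div_power_vanishes[OF Y] by blast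
    have "\<forall>m. \<exists>J. \<forall>j\<ge>J. vanishes_upto k (b j m)" using small by (simp add: b_def)
    then obtain J where J: "\<And>m j. J m \<le> j \<Longrightarrow> vanishes_upto k (b j m)" by metis
    \<comment> \<open>Smallness in j is not uniform in m. For m \<ge> M the nilpotency of Y works
      for every j at once, so the maximum of \<open>J\<close> over finitely many m suffices.\<close>
    have "fps_nth (b j m) k = 0" if "max M (Max (J ` {..M})) \<le> j \<or> max M (Max (J ` {..M})) \<le> m" for j m
    proof (cases "M \<le> m")
      case True
      then have "vanishes_upto k (b j m)"
        using M xlinear_vanishes[OF D] by (simp add: b_def)
      then show ?thesis by (simp add: vanishes_upto_def)
    next
      case False
      then have "J m \<le> Max (J ` {..M})" by (intro Max_ge) auto
      then have "J m \<le> j" using that False by auto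
      then show ?thesis using J[of m j] by (simp add: vanishes_upto_def)
    qed
    then show "\<exists>J. \<forall>j m. J \<le> j \<or> J \<le> m \<longrightarrow> fps_nth (b j m) k = 0" by blast
  qed
  also have "\<dots> = tsum (\<lambda>j. D j (xexp Y V))"
    by (simp add: xexp_eq_tsum b_def[abs_def] tsum_xlinear(1)[OF D xsummable_div_power[OF Y]])
  finally show ?thesis .
qed

text \<open>The case of \<open>xexp_leibniz\<close> in which the operators D are the divided powers
  of S.\<close>

lemma xexp_add:
  assumes S: "xlinear S" "nilpotent_op S" and T: "xlinear T" "nilpotent_op T"
    and comm: "\<And>V. S (T V) = T (S V)"
  shows "xexp (\<lambda>V. S V + T V) V = xexp S (xexp T V)"
proof -
  have pow: "T ((S ^^ n) V) = (S ^^ n) (T V)" for n V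
    by (induction n) (simp_all add: comm[symmetric])
  have "xexp (\<lambda>V. S V + T V) (div_power S 0 V) = tsum (\<lambda>j. div_power S j (xexp T V))"
  proof (rule xexp_leibniz[OF xlinear_add[OF S(1) T(1)] T xlinear_div_power[OF S(1)]])
    show "S (div_power S j V) + T (div_power S j V) =
        xscale (scalar_const (of_nat (Suc j))) (div_power S (Suc j) V) + div_power S j (T V)" for j V
      by (simp only: div_power_Suc[OF S(1)]) (simp add: div_power_def xlinearD(2)[OF T(1)] pow)
  qed (rule div_power_vanishes[OF S])
  then show ?thesis by (simp add: xexp_eq_tsum)
qed

lemma nilpotent_op_uminus:
  assumes "xlinear T" "nilpotent_op T"
  shows "nilpotent_op (\<lambda>V. - T V)"
proof -
  have "((\<lambda>V. - T V) ^^ n) V = xscale ((- 1) ^ n) ((T ^^ n) V)" for n V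
    by (induction n) (simp_all add: xlinearD[OF assms(1)] xscale_uminus)
  then show ?thesis
    using assms(2) xlinear_vanishes[OF xlinear_xscale] unfolding nilpotent_op_def by metis
qed

lemma xexp_zero: "xexp (\<lambda>V. 0) V = V"
proof -
  define Z :: "xfock \<Rightarrow> xfock" where "Z = (\<lambda>V. 0)"
  have "(Z ^^ n) V = 0" if "n \<noteq> 0" for n :: nat
    using that by (cases n) (simp_all, simp add: Z_def)
  then have "xexp Z V = div_power Z 0 V"
    unfolding xexp_eq_tsum by (intro tsum_single) (simp add: div_power_def)
  then show ?thesis by (simp add: Z_def)
qed

lemma op_neg_eq: "op_neg T = (\<lambda>V. - T V)"
  by (simp add: fun_eq_iff op_neg_def)

lemma xexp_op_neg:
  assumes "xlinear T" "nilpotent_op T"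
  shows "xexp (op_neg T) (xexp T V) = V" "xexp T (xexp (op_neg T) V) = V"
proof -
  note N = xlinear_uminus[OF assms(1)] nilpotent_op_uminus[OF assms]
  show "xexp (op_neg T) (xexp T V) = V"
    unfolding op_neg_eq using xexp_add[OF N assms, of V]
    by (simp add: xlinearD[OF assms(1)] xexp_zero)
  show "xexp T (xexp (op_neg T) V) = V"
    unfolding op_neg_eq using xexp_add[OF assms N, of V]
    by (simp add: xlinearD[OF assms(1)] xexp_zero)
qed

text \<open>A scalar commutator acts as a derivation, [X, T^n] = n c T^(n-1); after division by n!
  this is c times the preceding divided power.\<close>

lemma xexp_scalar_commutator:
  assumes X: "xlinear X" and T: "xlinear T" "nilpotent_op T"
    and comm: "\<And>V. X (T V) = T (X V) + xscale c V"
  shows "X (xexp T V) = xexp T (X V) + xscale c (xexp T V)"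
proof -
  \<comment> \<open>At n = 0 the truncated exponent n - 1 is harmless, because its coefficient is
    0.\<close>
  have pow: "X ((T ^^ n) V) = (T ^^ n) (X V) + xscale (of_nat n * c) ((T ^^ (n - 1)) V)" for n V
  proof (induction n)
    case (Suc n)
    have "xscale (of_nat n * c) (T ((T ^^ (n - 1)) V)) = xscale (of_nat n * c) ((T ^^ n) V)"
      by (cases n) simp_all
    then show ?case
      by (simp add: comm Suc xlinearD[OF T(1)] distrib_right xscale_add_left algebra_simps)
  qed simp
  have "X (div_power T n V) = div_power T n (X V) + (if n = 0 then 0 else xscale c (div_power T (n - 1) V))" for n
  proof (cases n)
    case (Suc m)
    have "scalar_const (1 / fact (Suc m)) * (of_nat (Suc m) * c) = c * scalar_const (1 / fact m)"
    proof -
      have "(of_nat (Suc m) :: scalar) = scalar_const (of_nat (Suc m))"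
        by (simp add: scalar_const_def del: of_nat_Suc flip: fps_of_nat)
      moreover have "1 / fact (Suc m) * of_nat (Suc m) = (1 / fact m :: complex)"
        by (simp del: of_nat_Suc)
      ultimately show ?thesis
        by (metis mult.assoc mult.commute scalar_const_mult)
    qed
    then have "xscale (scalar_const (1 / fact (Suc m))) (xscale (of_nat (Suc m) * c) W) =
        xscale c (xscale (scalar_const (1 / fact m)) W)" for W
      by (simp only: flip: xscale_mult)
    then show ?thesis
      unfolding div_power_def xlinearD(2)[OF X] pow Suc xscale_add_right
      by (simp only: diff_Suc_1) simp
  qed simp
  then have "X (xexp T V) =
      tsum (\<lambda>n. div_power T n (X V) + (if n = 0 then 0 else xscale c (div_power T (n - 1) V)))"
    by (simp add: xexp_eq_tsum tsum_xlinear(1)[OF X xsummable_div_power[OF T]])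
  also have "\<dots> = xexp T (X V) + tsum (\<lambda>n. if n = 0 then 0 else xscale c (div_power T (n - 1) V))"
  proof (subst tsum_add)
    show "xsummable (\<lambda>n. if n = 0 then 0 else xscale c (div_power T (n - 1) V))"
    proof (rule xsummable_natI)
      fix k
      obtain N where "\<forall>n\<ge>N. vanishes_upto k (div_power T n V)" using div_power_vanishes[OF T] by blast
      then show "\<exists>N. \<forall>n\<ge>N. vanishes_upto k (if n = 0 then 0 else xscale c (div_power T (n - 1) V))"
        by (intro exI[of _ "Suc N"]) (auto intro!: xlinear_vanishes[OF xlinear_xscale])
    qed
  qed (simp_all add: xsummable_div_power[OF T] xexp_eq_tsum)
  also have "tsum (\<lambda>n. if n = 0 then 0 else xscale c (div_power T (n - 1) V)) =
      tsum (\<lambda>n. xscale c (div_power T n V))"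
  proof (rule fps_ext)
    fix k
    obtain N where N: "\<forall>n\<ge>N. vanishes_upto k (div_power T n V)" using div_power_vanishes[OF T] by blast
    then have van: "fps_nth (xscale c (div_power T n V)) k = 0" if "n \<ge> N" for n
      using that xlinear_vanishes[OF xlinear_xscale] by (auto simp: vanishes_upto_def)
    have "fps_nth (tsum (\<lambda>n. if n = 0 then 0 else xscale c (div_power T (n - 1) V))) k =
        (\<Sum>n<Suc N. fps_nth (if n = 0 then 0 else xscale c (div_power T (n - 1) V)) k)"
      by (rule tsum_nth) (auto intro!: van)
    also have "\<dots> = (\<Sum>n<N. fps_nth (xscale c (div_power T n V)) k)"
      by (subst sum.lessThan_Suc_shift) simp
    also have "\<dots> = fps_nth (tsum (\<lambda>n. xscale c (div_power T n V))) k"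
      by (rule tsum_nth[symmetric]) (auto intro!: van)
    finally show "fps_nth (tsum (\<lambda>n. if n = 0 then 0 else xscale c (div_power T (n - 1) V))) k =
      fps_nth (tsum (\<lambda>n. xscale c (div_power T n V))) k" .
  qed
  also have "\<dots> = xscale c (xexp T V)"
    by (simp add: xexp_eq_tsum tsum_xlinear(1)[OF xlinear_xscale xsummable_div_power[OF T]])
  finally show ?thesis .
qed

section \<open>Fermion fields with Laurent series coefficients\<close>

definition gcoef :: "gring \<Rightarrow> int \<Rightarrow> scalar" where
  "gcoef P n = Abs_fps (\<lambda>k. fls_nth (fps_nth P k) n)"

definition gscal :: "scalar \<Rightarrow> gring" where
  "gscal c = Abs_fps (\<lambda>k. fls_const (fps_nth c k))"

definition zpow :: "int \<Rightarrow> gring" where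
  "zpow n = fps_const (fls_X_intpow n)"

lemma gcoef_nth [simp]: "fps_nth (gcoef P n) k = fls_nth (fps_nth P k) n"
  by (simp add: gcoef_def)

lemma gscal_nth [simp]: "fps_nth (gscal c) k = fls_const (fps_nth c k)"
  by (simp add: gscal_def)

lemma fls_const_times_nth: "fls_nth (fls_const c * f) n = c * fls_nth f n"
  for c :: "'a::comm_semiring_1"
proof (cases "c = 0")
  case False
  have "fls_nth (fls_const c * f) n = (\<Sum>i=0..n - fls_subdegree f. fls_nth (fls_const c) i * fls_nth f (n - i))"
    by (subst fls_times_nth(2)) simp
  also have "\<dots> = (\<Sum>i=0..n - fls_subdegree f. if i = 0 then c * fls_nth f n else 0)"
    by (intro sum.cong) auto
  finally show ?thesis by (auto simp: sum.delta)
qed simp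

lemma gcoef_gscal_mult: "gcoef (gscal c * P) n = c * gcoef P n"
  by (rule fps_ext) (simp add: fps_mult_nth fls_nth_sum fls_const_times_nth)

lemma gscal_mult: "gscal (c * d) = gscal c * gscal d"
  by (rule fps_ext, rule fls_eqI) (simp add: fps_mult_nth fls_nth_sum)

lemma gscal_add: "gscal (c + d) = gscal c + gscal d"
  by (rule fps_ext, rule fls_eqI) simp

lemma gscal_one [simp]: "gscal 1 = 1"
  by (rule fps_ext, rule fls_eqI) simp

lemma gscal_uminus: "gscal (- c) = - gscal c"
  by (rule fps_ext, rule fls_eqI) simp

lemma gscal_power: "gscal (c ^ n) = gscal c ^ n"
  by (induction n) (simp_all add: gscal_mult)

lemma gcoef_add: "gcoef (P + Q) n = gcoef P n + gcoef Q n"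
  by (rule fps_ext) simp

lemma gcoef_zpow_mult: "gcoef (zpow m * P) n = gcoef P (n - m)"
  by (rule fps_ext) (simp add: zpow_def fls_X_intpow_times_conv_shift)

lemma gcoef_zpow: "gcoef (zpow m) n = (if n = m then 1 else 0)"
  by (rule fps_ext) (simp add: zpow_def)

lemma zpow_add: "zpow (m + n) = zpow m * zpow n"
  by (simp add: zpow_def fls_X_intpow_times_fls_X_intpow algebra_simps flip: fps_const_mult)

text \<open>A common order in z exists only up to a given power of \<beta>: in 1/(1 + \<beta>/z) the
  order tends to minus infinity.\<close>

lemma gring_lower_bound: "\<exists>L. \<forall>i\<le>k. \<forall>n<L. fls_nth (fps_nth P i) n = 0" for P :: gring
proof -
  define L where "L = Min ((\<lambda>i. fls_subdegree (fps_nth P i)) ` {..k})"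
  have "L \<le> fls_subdegree (fps_nth P i)" if "i \<le> k" for i
    unfolding L_def using that by (intro Min_le) auto
  then show ?thesis by (meson fls_eq0_below_subdegree less_le_trans)
qed

text \<open>Any lower bounds may replace the subdegrees, so that many products can share one range
  of summation. The interval from l to u contains both ranges, and outside either range the terms
  vanish.\<close>

lemma fls_times_nth_bounds:
  fixes f g :: "'a::comm_ring_1 fls"
  assumes "\<And>i. i < a \<Longrightarrow> fls_nth f i = 0" "\<And>i. i < b \<Longrightarrow> fls_nth g i = 0"
  shows "fls_nth (f * g) n = (\<Sum>i=a..n - b. fls_nth f i * fls_nth g (n - i))"
proof -
  let ?t = "\<lambda>i. fls_nth f i * fls_nth g (n - i)"
  define l u where "l = min a (fls_subdegree f)" and "u = max (n - b) (n - fls_subdegree g)"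
  have "fls_nth (f * g) n = (\<Sum>i=fls_subdegree f..n - fls_subdegree g. ?t i)"
    by (rule fls_times_nth(2))
  also have "\<dots> = (\<Sum>i=l..u. ?t i)"
    unfolding l_def u_def by (intro sum.mono_neutral_left) auto
  also have "\<dots> = (\<Sum>i=a..n - b. ?t i)"
    unfolding l_def u_def using assms by (intro sum.mono_neutral_right) auto
  finally show ?thesis .
qed

text \<open>Coefficientwise convergence in \<open>gring\<close>, uniform below each power of \<open>z\<close>, so that multiplication
  is continuous.\<close>

definition gsmall :: "nat \<Rightarrow> int \<Rightarrow> gring \<Rightarrow> bool" where
  "gsmall k m P \<longleftrightarrow> (\<forall>i\<le>k. \<forall>l\<le>m. fls_nth (fps_nth P i) l = 0)"

definition gtends :: "(nat \<Rightarrow> gring) \<Rightarrow> gring \<Rightarrow> bool" where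
  "gtends S h \<longleftrightarrow> (\<forall>k m. \<exists>N. \<forall>j\<ge>N. gsmall k m (S j - h))"

lemma gsmall_mult: "\<exists>m'. \<forall>D. gsmall k m' D \<longrightarrow> gsmall k m (D * P)"
proof -
  obtain L where L: "\<And>i n. i \<le> k \<Longrightarrow> n < L \<Longrightarrow> fls_nth (fps_nth P i) n = 0"
    using gring_lower_bound by blast
  have "gsmall k m (D * P)" if "gsmall k (m - L) D" for D
    unfolding gsmall_def
  proof (intro allI impI)
    fix i l assume i: "i \<le> k" and l: "l \<le> m"
    have "fls_nth (fps_nth D j * fps_nth P (i - j)) l = 0" if "j \<le> i" for j
    proof -
      have "fls_nth (fps_nth D j * fps_nth P (i - j)) l =
          (\<Sum>x=m - L + 1..l - L. fls_nth (fps_nth D j) x * fls_nth (fps_nth P (i - j)) (l - x))"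
        using \<open>gsmall k (m - L) D\<close> that i by (intro fls_times_nth_bounds) (auto simp: gsmall_def L)
      then show ?thesis using l by simp
    qed
    then show "fls_nth (fps_nth (D * P) i) l = 0" by (simp add: fps_mult_nth fls_nth_sum)
  qed
  then show ?thesis by blast
qed

lemma gtends_mult:
  assumes "gtends S h"
  shows "gtends (\<lambda>j. S j * P) (h * P)"
  unfolding gtends_def
proof (intro allI)
  fix k m
  obtain m' where "\<And>D. gsmall k m' D \<Longrightarrow> gsmall k m (D * P)" using gsmall_mult by blast
  moreover obtain N where "\<forall>j\<ge>N. gsmall k m' (S j - h)" using assms unfolding gtends_def by blast
  ultimately show "\<exists>N. \<forall>j\<ge>N. gsmall k m (S j * P - h * P)"
    unfolding left_diff_distrib[symmetric] by blast
qed

text \<open>Mode \<open>n\<close> of either field lowers the energy by \<open>n\<close>; the field \<open>\<psi>\<close> (\<open>True\<close>) therefore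
  has modes \<open>\<psi>\<^sub>-\<^sub>n\<close>.\<close>

definition fmode :: "bool \<Rightarrow> int \<Rightarrow> fock \<Rightarrow> fock" where
  "fmode s n = (if s then act (psi (- n)) else act (psi_star n))"

text \<open>The sign in the commutators [a_m, \<psi>_k] = \<psi>_(k-m) and [a_m, \<psi>*_k] = -
  \<psi>*_(k+m).\<close>

definition fsign :: "bool \<Rightarrow> scalar" where
  "fsign s = (if s then 1 else - 1)"

definition fermi_field :: "bool \<Rightarrow> gring \<Rightarrow> xfock \<Rightarrow> xfock" where
  "fermi_field s P V = tsum (\<lambda>n. xscale (gcoef P n) (scalar_extend (fmode s n) V))"

lemma fock_linear_fmode: "fock_linear (fmode s n)"
  by (simp add: fmode_def fock_linear_act)

lemma xlinear_fmode: "xlinear (scalar_extend (fmode s n))"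
  by (intro xlinear_scalar_extend fock_linear_fmode)

lemma energy_le_fmode: "energy_le E v \<Longrightarrow> energy_le (E - n) (fmode s n v)"
  using energy_le_gen[of E v "Psi (- n)"] energy_le_gen[of E v "PsiStar n"] by (simp add: fmode_def)

lemma fmode_vanishes:
  assumes "xenergy_le E k V" "n > E"
  shows "vanishes_upto k (scalar_extend (fmode s n) V)"
proof (rule xenergy_le_neg)
  show "xenergy_le (E - n) k (scalar_extend (fmode s n) V)"
    by (rule xenergy_le_scalar_extend[OF assms(1)])
      (simp_all add: fock_linearD[OF fock_linear_fmode] energy_le_fmode)
qed (use assms in simp)

text \<open>The order of P cuts the modes off from below, the energy of V from above.\<close>

lemma xsummable_fermi_field: "xsummable (\<lambda>n. xscale (gcoef P n) (scalar_extend (fmode s n) V))"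
proof (rule xsummableI)
  fix k
  obtain L where L: "\<And>i n. i \<le> k \<Longrightarrow> n < L \<Longrightarrow> fls_nth (fps_nth P i) n = 0"
    using gring_lower_bound by blast
  obtain E where E: "xenergy_le E k V" using xenergy_le_exists by blast
  have "vanishes_upto k (xscale (gcoef P n) (scalar_extend (fmode s n) V))" if "n \<notin> {L..E}" for n
  proof (cases "n < L")
    case True
    then show ?thesis by (intro xscale_vanishes_left) (simp add: L)
  next
    case False
    then show ?thesis
      using that E by (intro xlinear_vanishes[OF xlinear_xscale] fmode_vanishes) auto
  qed
  then show "\<exists>S. finite S \<and> (\<forall>n. n \<notin> S \<longrightarrow>
      vanishes_upto k (xscale (gcoef P n) (scalar_extend (fmode s n) V)))"
    by (intro exI[of _ "{L..E}"]) auto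
qed

lemma xlinear_fermi_field: "xlinear (fermi_field s P)"
  unfolding fermi_field_def
  by (intro xlinear_tsum xlinear_compose[OF xlinear_xscale xlinear_fmode] xsummable_fermi_field)

lemma fermi_field_add: "fermi_field s (P + Q) V = fermi_field s P V + fermi_field s Q V"
  by (simp add: fermi_field_def gcoef_add xscale_add_left tsum_add xsummable_fermi_field)

lemma fermi_field_gscal: "fermi_field s (gscal c * P) V = xscale c (fermi_field s P V)"
  by (simp add: fermi_field_def gcoef_gscal_mult xscale_mult
      tsum_xlinear(1)[OF xlinear_xscale xsummable_fermi_field])

lemma fermi_field_uminus: "fermi_field s (- P) V = - fermi_field s P V"
  using fermi_field_gscal[of s "- 1" P V] by (simp add: gscal_uminus xscale_uminus)

lemma fermi_field_zero [simp]: "fermi_field s 0 V = 0"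
  using fermi_field_add[of s 0 0 V] by simp

lemma fermi_field_diff: "fermi_field s (P - Q) V = fermi_field s P V - fermi_field s Q V"
  using fermi_field_add[of s P "- Q" V] by (simp add: fermi_field_uminus)

lemma fermi_field_sum: "fermi_field s (\<Sum>i\<in>A. f i) V = (\<Sum>i\<in>A. fermi_field s (f i) V)"
  by (induction A rule: infinite_finite_induct) (simp_all add: fermi_field_add)

lemma fermi_field_zpow: "fermi_field s (zpow n) V = scalar_extend (fmode s n) V"
proof -
  have "fermi_field s (zpow n) V = xscale (gcoef (zpow n) n) (scalar_extend (fmode s n) V)"
    unfolding fermi_field_def by (rule tsum_single) (simp add: gcoef_zpow)
  then show ?thesis by (simp add: gcoef_zpow)
qed

text \<open>Modes above the energy E of V annihilate it, so only the coefficients of P up to z^E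
  matter.\<close>

lemma fermi_field_continuous: "\<exists>m. \<forall>P. gsmall k m P \<longrightarrow> vanishes_upto k (fermi_field s P V)"
proof -
  obtain E where E: "xenergy_le E k V" using xenergy_le_exists by blast
  have "vanishes_upto k (fermi_field s P V)" if "gsmall k E P" for P
  proof -
    have "vanishes_upto k (xscale (gcoef P n) (scalar_extend (fmode s n) V))" for n
    proof (cases "n \<le> E")
      case True
      then show ?thesis using that by (intro xscale_vanishes_left) (simp add: gsmall_def)
    next
      case False
      then show ?thesis using E by (intro xlinear_vanishes[OF xlinear_xscale] fmode_vanishes) auto
    qed
    then show ?thesis
      unfolding fermi_field_def by (auto simp: vanishes_upto_def tsum_nth[where S="{}"])
  qed
  then show ?thesis by blast
qed

text \<open>Consecutive partial sums differ by one term, so their convergence already yields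
  summability in the discrete sense used here.\<close>

lemma tsum_partial_sums:
  fixes F :: "nat \<Rightarrow> xfock"
  assumes "\<And>k. \<exists>N. \<forall>j\<ge>N. vanishes_upto k ((\<Sum>n<j. F n) - W)"
  shows "xsummable F" "tsum F = W"
proof -
  have small: "vanishes_upto k (F n)" if "\<forall>j\<ge>N. vanishes_upto k ((\<Sum>n<j. F n) - W)" "n \<ge> N" for n N k
    using that(1)[rule_format, of n] that(1)[rule_format, of "Suc n"] that(2)
    by (auto simp: vanishes_upto_def)
  show "xsummable F" using assms small by (intro xsummable_natI) meson
  show "tsum F = W"
  proof (rule fps_ext)
    fix k
    obtain N where N: "\<forall>j\<ge>N. vanishes_upto k ((\<Sum>n<j. F n) - W)" using assms by blast
    then have "fps_nth (tsum F) k = (\<Sum>n<N. fps_nth (F n) k)"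
      using small[OF N] by (intro tsum_nth) (auto simp: vanishes_upto_def)
    then show "fps_nth (tsum F) k = fps_nth W k"
      using N by (auto simp: vanishes_upto_def fps_sum_nth)
  qed
qed

lemma tsum_fermi_field:
  assumes "gtends (\<lambda>j. \<Sum>n<j. f n) h"
  shows "xsummable (\<lambda>n. fermi_field s (f n) V)" "tsum (\<lambda>n. fermi_field s (f n) V) = fermi_field s h V"
proof -
  have "\<exists>N. \<forall>j\<ge>N. vanishes_upto k ((\<Sum>n<j. fermi_field s (f n) V) - fermi_field s h V)" for k
  proof -
    obtain m where "\<And>P. gsmall k m P \<Longrightarrow> vanishes_upto k (fermi_field s P V)"
      using fermi_field_continuous by blast
    moreover obtain N where "\<forall>j\<ge>N. gsmall k m ((\<Sum>n<j. f n) - h)"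
      using assms unfolding gtends_def by blast
    ultimately show ?thesis
      unfolding fermi_field_sum[symmetric] fermi_field_diff[symmetric] by blast
  qed
  then show "xsummable (\<lambda>n. fermi_field s (f n) V)"
    "tsum (\<lambda>n. fermi_field s (f n) V) = fermi_field s h V"
    by (rule tsum_partial_sums)+
qed

lemma tsum_shift: "tsum (\<lambda>n::int. F (n + m)) = tsum F"
proof (rule fps_ext)
  fix k
  have "Sum_any (\<lambda>n. fps_nth (F n) k) = Sum_any (\<lambda>n. fps_nth (F (n + m)) k)"
    by (rule Sum_any.reindex_cong[of "\<lambda>n. n + m"])
      (auto simp: fun_eq_iff intro: bij_betwI[where g="\<lambda>n. n - m"])
  then show "fps_nth (tsum (\<lambda>n. F (n + m))) k = fps_nth (tsum F) k"
    by (simp add: tsum_def)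
qed

section \<open>Commutation relations of currents and fields\<close>

abbreviation (input) xcurrent :: "int \<Rightarrow> xfock \<Rightarrow> xfock" where
  "xcurrent m \<equiv> scalar_extend (current m)"

lemma xlinear_xcurrent: "m \<noteq> 0 \<Longrightarrow> xlinear (xcurrent m)"
  by (intro xlinear_scalar_extend fock_linear_current)

lemma xcurrent_fmode:
  assumes "m \<noteq> 0"
  shows "xcurrent m (scalar_extend (fmode s n) V) =
    scalar_extend (fmode s n) (xcurrent m V) + xscale (fsign s) (scalar_extend (fmode s (n + m)) V)"
proof -
  have "current m (fmode s n v) =
      fmode s n (current m v) + (if s then fmode s (n + m) v else - fmode s (n + m) v)" for v
    using assms by (simp add: fmode_def current_psi current_psi_star)
  then show ?thesis
    by (intro xfock_eqI)
      (simp add: fsign_def lookup_scalar_extend fock_linearD[OF fock_linear_fmode]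
        fock_linearD[OF fock_linear_current[OF assms]] lookup_add xscale_uminus)
qed

lemma xcurrent_fermi_field:
  assumes "m \<noteq> 0"
  shows "xcurrent m (fermi_field s P V) =
    fermi_field s P (xcurrent m V) + xscale (fsign s) (fermi_field s (zpow m * P) V)"
proof -
  have "xcurrent m (fermi_field s P V) =
      tsum (\<lambda>n. xscale (gcoef P n) (scalar_extend (fmode s n) (xcurrent m V)) +
        xscale (fsign s) (xscale (gcoef (zpow m * P) (n + m)) (scalar_extend (fmode s (n + m)) V)))"
    unfolding fermi_field_def
    by (simp add: tsum_xlinear(1)[OF xlinear_xcurrent[OF assms] xsummable_fermi_field]
        xlinearD(2)[OF xlinear_xcurrent[OF assms]] xcurrent_fmode[OF assms] xscale_add_right
        gcoef_zpow_mult xscale_commute[of "fsign s"])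
  also have "\<dots> = fermi_field s P (xcurrent m V) + xscale (fsign s)
      (tsum (\<lambda>n. xscale (gcoef (zpow m * P) (n + m)) (scalar_extend (fmode s (n + m)) V)))"
  proof -
    let ?G = "\<lambda>n. xscale (gcoef (zpow m * P) n) (scalar_extend (fmode s n) V)"
    have G: "xsummable (\<lambda>n. ?G (n + m))"
      unfolding xsummable_def
    proof
      fix k
      have "finite {n. fps_nth (?G n) k \<noteq> 0}"
        using xsummable_fermi_field[of "zpow m * P" s V] by (simp add: xsummable_def)
      then have "finite ((\<lambda>n. n - m) ` {n. fps_nth (?G n) k \<noteq> 0})" by (rule finite_imageI)
      then show "finite {n. fps_nth (?G (n + m)) k \<noteq> 0}"
        by (elim finite_subset[rotated]) (auto intro: image_eqI[of _ _ "_ + m"])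
    qed
    show ?thesis
      by (simp only: tsum_add[OF xsummable_fermi_field tsum_xlinear(2)[OF xlinear_xscale G]]
          tsum_xlinear(1)[OF xlinear_xscale G] fermi_field_def)
  qed
  also have "tsum (\<lambda>n. xscale (gcoef (zpow m * P) (n + m)) (scalar_extend (fmode s (n + m)) V)) =
      fermi_field s (zpow m * P) V"
    unfolding fermi_field_def by (rule tsum_shift)
  finally show ?thesis .
qed

lemma fmode_anticomm:
  "scalar_extend (fmode True m) (scalar_extend (fmode False n) V) +
    scalar_extend (fmode False n) (scalar_extend (fmode True m) V) = (if m = - n then V else 0)"
  using act_fgen_anticomm[of "Psi (- m)" "PsiStar n"]
  by (intro xfock_eqI)
    (auto simp: lookup_add lookup_scalar_extend fock_linearD[OF fock_linear_fmode] fmode_def)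

lemma gcoef_mult_zero:
  assumes "\<And>i n. i \<le> k \<Longrightarrow> n < a \<Longrightarrow> fls_nth (fps_nth P i) n = 0"
    and "\<And>i n. i \<le> k \<Longrightarrow> n < b \<Longrightarrow> fls_nth (fps_nth Q i) n = 0" and "i \<le> k"
  shows "fps_nth (gcoef (P * Q) 0) i = fps_nth (\<Sum>l=b..- a. gcoef Q l * gcoef P (- l)) i"
proof -
  have "fps_nth (gcoef (P * Q) 0) i =
      (\<Sum>j=0..i. \<Sum>x=a..- b. fls_nth (fps_nth P j) x * fls_nth (fps_nth Q (i - j)) (- x))"
    unfolding gcoef_nth fps_mult_nth fls_nth_sum
    using assms by (intro sum.cong refl) (simp add: fls_times_nth_bounds[of a _ b])
  also have "\<dots> = (\<Sum>j=0..i. \<Sum>l=b..- a. fls_nth (fps_nth P j) (- l) * fls_nth (fps_nth Q (i - j)) l)"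
    by (intro sum.cong refl sum.reindex_bij_witness[of _ uminus uminus]) auto
  also have "\<dots> = (\<Sum>l=b..- a. \<Sum>j=0..i. fls_nth (fps_nth P j) (- l) * fls_nth (fps_nth Q (i - j)) l)"
    by (rule sum.swap)
  also have "\<dots> = fps_nth (\<Sum>l=b..- a. gcoef P (- l) * gcoef Q l) i"
    by (simp add: fps_sum_nth fps_mult_nth)
  finally show ?thesis by (simp add: mult.commute)
qed

text \<open>Mode m of \<psi> and mode l of \<psi>* anticommute to 1 exactly when m + l = 0, which
  pairs the coefficient of z^l in Q with that of z^(-l) in P. Expanding one field at a time keeps
  every interchange of sums an instance of \<open>tsum_xlinear\<close>.\<close>

lemma fermi_field_anticomm:
  "fermi_field True P (fermi_field False Q V) + fermi_field False Q (fermi_field True P V) =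
    xscale (gcoef (P * Q) 0) V"
proof -
  have one: "fermi_field True P (scalar_extend (fmode False l) V) +
      scalar_extend (fmode False l) (fermi_field True P V) = xscale (gcoef P (- l)) V" for l
  proof -
    have "fermi_field True P (scalar_extend (fmode False l) V) +
        scalar_extend (fmode False l) (fermi_field True P V) =
        tsum (\<lambda>n. xscale (gcoef P n) (scalar_extend (fmode True n) (scalar_extend (fmode False l) V)) +
          xscale (gcoef P n) (scalar_extend (fmode False l) (scalar_extend (fmode True n) V)))"
      using tsum_xlinear(2)[OF xlinear_fmode[of False l] xsummable_fermi_field[of P True V]]
      by (simp add: fermi_field_def tsum_xlinear(1)[OF xlinear_fmode xsummable_fermi_field]
          xlinearD(2)[OF xlinear_fmode] tsum_add xsummable_fermi_field)
    also have "\<dots> = tsum (\<lambda>n. xscale (gcoef P n) (if n = - l then V else 0))"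
      by (simp only: fmode_anticomm flip: xscale_add_right)
    also have "\<dots> = xscale (gcoef P (- l)) V"
      by (subst tsum_single[where a="- l"]) auto
    finally show ?thesis .
  qed
  have "fermi_field True P (fermi_field False Q V) + fermi_field False Q (fermi_field True P V) =
      tsum (\<lambda>l. xscale (gcoef Q l) (fermi_field True P (scalar_extend (fmode False l) V)) +
        xscale (gcoef Q l) (scalar_extend (fmode False l) (fermi_field True P V)))"
    using tsum_xlinear(2)[OF xlinear_fermi_field[of True P] xsummable_fermi_field[of Q False V]]
    by (simp add: fermi_field_def[of False] tsum_xlinear(1)[OF xlinear_fermi_field xsummable_fermi_field]
        xlinearD(2)[OF xlinear_fermi_field] tsum_add xsummable_fermi_field)
  also have "\<dots> = tsum (\<lambda>l. xscale (gcoef Q l * gcoef P (- l)) V)"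
    by (simp only: one xscale_mult flip: xscale_add_right)
  also have "\<dots> = xscale (gcoef (P * Q) 0) V"
  proof (rule fps_ext)
    fix k
    obtain a where a: "\<And>i n. i \<le> k \<Longrightarrow> n < a \<Longrightarrow> fls_nth (fps_nth P i) n = 0"
      using gring_lower_bound by blast
    obtain b where b: "\<And>i n. i \<le> k \<Longrightarrow> n < b \<Longrightarrow> fls_nth (fps_nth Q i) n = 0"
      using gring_lower_bound by blast
    have "fps_nth (tsum (\<lambda>l. xscale (gcoef Q l * gcoef P (- l)) V)) k =
        (\<Sum>l=b..- a. fps_nth (xscale (gcoef Q l * gcoef P (- l)) V) k)"
    proof (rule tsum_nth)
      fix l assume "l \<notin> {b..- a}"
      then have "vanishes_upto k (xscale (gcoef Q l * gcoef P (- l)) V)"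
        using a b by (intro xscale_vanishes_left) (auto simp: fps_mult_nth not_le intro!: sum.neutral)
      then show "fps_nth (xscale (gcoef Q l * gcoef P (- l)) V) k = 0"
        by (simp add: vanishes_upto_def)
    qed simp
    also have "\<dots> = fps_nth (xscale (\<Sum>l=b..- a. gcoef Q l * gcoef P (- l)) V) k"
      by (simp add: xscale_sum_left fps_sum_nth)
    also have "\<dots> = fps_nth (xscale (gcoef (P * Q) 0) V) k"
    proof -
      have "vanishes_upto k (xscale ((\<Sum>l=b..- a. gcoef Q l * gcoef P (- l)) - gcoef (P * Q) 0) V)"
        using gcoef_mult_zero[OF a b, of k] by (intro xscale_vanishes_left) simp
      then show ?thesis
        using xscale_add_left[of "(\<Sum>l=b..- a. gcoef Q l * gcoef P (- l)) - gcoef (P * Q) 0" "gcoef (P * Q) 0" V]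
        by (simp add: vanishes_upto_def)
    qed
    finally show "fps_nth (tsum (\<lambda>l. xscale (gcoef Q l * gcoef P (- l)) V)) k =
      fps_nth (xscale (gcoef (P * Q) 0) V) k" .
  qed
  finally show ?thesis .
qed

section \<open>Logarithmic series and their exponentials\<close>

text \<open>This is - log (1 - X).\<close>

definition log_series :: "complex fps" where
  "log_series = Abs_fps (\<lambda>n. if n = 0 then 0 else 1 / of_nat n)"

text \<open>The closed forms 1/(1 - X) and 1 - X of the exponentials of plus and minus
  \<open>log_series\<close>. The Boolean is the type of the field, since \<open>fsign\<close>
  decides which of them occurs.\<close>

definition exp_log :: "bool \<Rightarrow> complex fps" where
  "exp_log s = (if s then Abs_fps (\<lambda>n. 1) else 1 - fps_X)"

definition csign :: "bool \<Rightarrow> complex" where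
  "csign s = (if s then 1 else - 1)"

lemma fsign_eq: "fsign s = scalar_const (csign s)"
  by (simp add: fsign_def csign_def scalar_const_def single_uminus flip: fps_const_neg)

lemma exp_log_mult: "exp_log s * exp_log (\<not> s) = 1"
proof -
  have "(1 - fps_X) * Abs_fps (\<lambda>n. 1 :: complex) = 1"
    by (rule fps_ext) (simp add: left_diff_distrib)
  then show ?thesis by (simp add: exp_log_def mult.commute)
qed

text \<open>The series \<open>exp (\<plusminus> log_series)\<close> satisfies \<open>(1 - X) F' = \<plusminus> F\<close>, which determines it.\<close>

lemma exp_log_series: "fps_exp (csign s) oo log_series = exp_log s"
proof -
  define F where "F = fps_exp (csign s) oo log_series"
  have "fps_deriv log_series = Abs_fps (\<lambda>n. 1)"
    by (rule fps_ext) (simp add: log_series_def del: of_nat_Suc)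
  moreover have "fps_deriv F = (fps_deriv (fps_exp (csign s)) oo log_series) * fps_deriv log_series"
    unfolding F_def by (rule fps_compose_deriv) (simp add: log_series_def)
  ultimately have "fps_deriv F = fps_const (csign s) * F * Abs_fps (\<lambda>n. 1)"
    by (simp add: F_def fps_compose_mult_distrib log_series_def)
  then have "fps_deriv F * (1 - fps_X) = fps_const (csign s) * F * (exp_log True * exp_log (\<not> True))"
    by (simp add: exp_log_def mult.assoc)
  then have de: "fps_deriv F * (1 - fps_X) = fps_const (csign s) * F"
    by (simp add: exp_log_mult[of True, simplified])
  have rec: "of_nat (Suc n) * fps_nth F (Suc n) = (of_nat n + csign s) * fps_nth F n" for n
    using arg_cong[OF de, of "\<lambda>f. fps_nth f n"]
    by (cases n) (simp_all add: right_diff_distrib distrib_right eq_diff_eq algebra_simps)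
  have F0: "fps_nth F 0 = 1" by (simp add: F_def)
  have "fps_nth F n = fps_nth (exp_log s) n" for n
  proof (cases s)
    case True
    show ?thesis
    proof (induction n)
      case (Suc n)
      have "of_nat (Suc n) * fps_nth F (Suc n) = of_nat (Suc n) * 1"
        using rec[of n] Suc True by (simp add: csign_def exp_log_def)
      then show ?case using True by (simp add: exp_log_def del: of_nat_Suc)
    qed (simp add: F0 exp_log_def True)
  next
    case False
    have F1: "fps_nth F (Suc 0) = - 1" using rec[of 0] F0 False by (simp add: csign_def)
    \<comment> \<open>For the negative sign the recursion multiplies by n - 1, which vanishes at n =
      1 and stops the series.\<close>
    have "fps_nth F (Suc (Suc n)) = 0" for n
    proof (induction n)
      case 0
      then show ?case using rec[of 1] False by (simp add: csign_def)
    next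
      case (Suc n)
      then show ?case using rec[of "Suc (Suc n)"] by (simp del: of_nat_Suc)
    qed
    then show ?thesis
      using False F0 F1 by (cases n; cases "n - 1") (auto simp: exp_log_def)
  qed
  then show ?thesis unfolding F_def by (rule fps_ext)
qed

text \<open>The divided powers of the signed logarithm; they supply the operators D of
  \<open>xexp_leibniz\<close>.\<close>

definition exp_term :: "bool \<Rightarrow> nat \<Rightarrow> complex fps" where
  "exp_term s j = fps_const (1 / fact j) * (fps_const (csign s) * log_series) ^ j"

lemma exp_term_0: "exp_term s 0 = 1"
  by (simp add: exp_term_def)

lemma exp_term_Suc:
  "fps_const (csign s) * log_series * exp_term s j = fps_const (of_nat (Suc j)) * exp_term s (Suc j)"
proof -
  have "fps_const (1 / fact j :: complex) = fps_const (of_nat (Suc j)) * fps_const (1 / fact (Suc j))"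
    by (simp del: of_nat_Suc)
  then show ?thesis by (simp only: exp_term_def power_Suc mult_ac)
qed

text \<open>The logarithm has no constant term, so its j-th power begins at X^j and later terms do
  not reach the coefficient n.\<close>

lemma exp_term_partial_sum:
  assumes "n < N"
  shows "fps_nth (\<Sum>j<N. exp_term s j) n = fps_nth (exp_log s) n"
proof -
  have nth: "fps_nth (exp_term s j) n = fps_nth (fps_exp (csign s)) j * fps_nth (log_series ^ j) n" for j
  proof -
    have "exp_term s j = fps_const (csign s ^ j / fact j) * log_series ^ j"
      by (simp add: exp_term_def power_mult_distrib fps_const_power mult.assoc[symmetric])
    then show ?thesis by simp
  qed
  have "fps_nth (\<Sum>j<N. exp_term s j) n = (\<Sum>j<N. fps_nth (fps_exp (csign s)) j * fps_nth (log_series ^ j) n)"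
    by (simp only: fps_sum_nth nth)
  also have "\<dots> = (\<Sum>j=0..n. fps_nth (fps_exp (csign s)) j * fps_nth (log_series ^ j) n)"
    using assms by (intro sum.mono_neutral_right)
      (auto simp: startsby_zero_power_prefix log_series_def)
  finally show ?thesis by (simp flip: exp_log_series add: fps_compose_nth)
qed

lemma log_series_partial_sum:
  assumes "n < N"
  shows "fps_nth (\<Sum>j<N. if j = 0 then 0 else fps_const (1 / of_nat j) * fps_X ^ j) n = fps_nth log_series n"
proof -
  have "fps_nth (if j = 0 then 0 else fps_const (1 / of_nat j) * fps_X ^ j) n =
      (if j = n then fps_nth log_series n else 0)" for j
    by (cases "j = 0") (auto simp: log_series_def)
  then have "fps_nth (\<Sum>j<N. if j = 0 then 0 else fps_const (1 / of_nat j) * fps_X ^ j) n =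
      (\<Sum>j<N. if j = n then fps_nth log_series n else 0)"
    by (simp only: fps_sum_nth)
  then show ?thesis using assms by simp
qed

text \<open>The substitution of y X for X, with coefficients transported along \<iota>. The
  remaining variable is afterwards read as z or as \<beta>.\<close>

definition fps_subst :: "(complex \<Rightarrow> 'b) \<Rightarrow> 'b \<Rightarrow> complex fps \<Rightarrow> 'b::comm_ring_1 fps" where
  "fps_subst \<iota> y f = Abs_fps (\<lambda>n. \<iota> (fps_nth f n) * y ^ n)"

lemma fps_subst_hom:
  assumes "\<And>a b. \<iota> (a + b) = \<iota> a + \<iota> b" "\<And>a b. \<iota> (a * b) = \<iota> a * \<iota> b" "\<iota> 0 = 0"
  shows "fps_subst \<iota> y (f + g) = fps_subst \<iota> y f + fps_subst \<iota> y g"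
    and "fps_subst \<iota> y (f * g) = fps_subst \<iota> y f * fps_subst \<iota> y g"
    and "fps_subst \<iota> y (fps_const c) = fps_const (\<iota> c)"
proof -
  have sum: "\<iota> (\<Sum>i\<in>A. h i) = (\<Sum>i\<in>A. \<iota> (h i))" for h and A :: "nat set"
    by (induction A rule: infinite_finite_induct) (simp_all add: assms)
  show "fps_subst \<iota> y (f + g) = fps_subst \<iota> y f + fps_subst \<iota> y g"
    by (rule fps_ext) (simp add: fps_subst_def assms distrib_right)
  show "fps_subst \<iota> y (f * g) = fps_subst \<iota> y f * fps_subst \<iota> y g"
  proof (rule fps_ext)
    fix n
    have "\<iota> (fps_nth f i * fps_nth g (n - i)) * y ^ n =
        \<iota> (fps_nth f i) * y ^ i * (\<iota> (fps_nth g (n - i)) * y ^ (n - i))" if "i \<le> n" for i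
    proof -
      have "y ^ n = y ^ i * y ^ (n - i)" using that by (simp flip: power_add)
      then show ?thesis by (simp add: assms mult_ac)
    qed
    then show "fps_nth (fps_subst \<iota> y (f * g)) n = fps_nth (fps_subst \<iota> y f * fps_subst \<iota> y g) n"
      by (simp add: fps_subst_def fps_mult_nth sum sum_distrib_right)
  qed
  show "fps_subst \<iota> y (fps_const c) = fps_const (\<iota> c)"
    by (rule fps_ext) (simp add: fps_subst_def assms)
qed

text \<open>Substitution of a topologically nilpotent element of \<open>gring\<close> into power series.\<close>

locale gring_substitution =
  fixes S :: "complex fps \<Rightarrow> gring"
  assumes S_add: "S (f + g) = S f + S g"
    and S_mult: "S (f * g) = S f * S g"
    and S_const: "S (fps_const c) = gscal (scalar_const c)"
    and S_small: "\<exists>N. \<forall>f. (\<forall>n<N. fps_nth f n = 0) \<longrightarrow> gsmall k m (S f)"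
begin

lemma S_0: "S 0 = 0" and S_1: "S 1 = 1"
proof -
  show "S 0 = 0" using S_add[of 0 0] by simp
  show "S 1 = 1" using S_const[of 1] by simp
qed

lemma S_diff: "S (f - g) = S f - S g"
  using S_add[of "f - g" g] by (simp add: eq_diff_eq)

lemma S_sum: "S (\<Sum>i\<in>A. f i) = (\<Sum>i\<in>A. S (f i))"
  by (induction A rule: infinite_finite_induct) (simp_all add: S_0 S_add)

lemma S_power: "S (f ^ n) = S f ^ n"
  by (induction n) (simp_all add: S_1 S_mult)

lemma S_tends:
  assumes "\<And>n j. n < j \<Longrightarrow> fps_nth (\<Sum>i<j. F i) n = fps_nth f n"
  shows "gtends (\<lambda>j. \<Sum>i<j. S (F i)) (S f)"
  unfolding gtends_def
proof (intro allI)
  fix k m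
  obtain N where N: "\<And>f. (\<And>n. n < N \<Longrightarrow> fps_nth f n = 0) \<Longrightarrow> gsmall k m (S f)"
    using S_small by blast
  have "gsmall k m ((\<Sum>i<j. S (F i)) - S f)" if "j \<ge> N" for j
    unfolding S_sum[symmetric] S_diff[symmetric]
    using that assms by (intro N) (simp del: fps_sum_nth)
  then show "\<exists>N. \<forall>j\<ge>N. gsmall k m ((\<Sum>i<j. S (F i)) - S f)" by blast
qed

end

section \<open>The operators \<open>H\<close> and \<open>H\<^sup>*\<close>\<close>

definition current_sum :: "int \<Rightarrow> (nat \<Rightarrow> scalar) \<Rightarrow> xfock \<Rightarrow> xfock" where
  "current_sum \<sigma> c V = tsum (\<lambda>n. if n = 0 then 0 else xscale (c n) (xcurrent (\<sigma> * int n) V))"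

text \<open>The two sources of convergence: for \<sigma> = 1, as in H, the energy suffices; for
  \<sigma> = -1, as in Hstar, the n-th coefficient must be divisible by \<beta>^n.\<close>

definition admissible :: "int \<Rightarrow> (nat \<Rightarrow> scalar) \<Rightarrow> bool" where
  "admissible \<sigma> c \<longleftrightarrow> \<sigma> = 1 \<or> \<sigma> = - 1 \<and> (\<forall>n. \<forall>i<n. fps_nth (c n) i = 0)"

lemma xcurrent_vanishes:
  assumes "xenergy_le E k V" "m > E" "m \<noteq> 0"
  shows "vanishes_upto k (xcurrent m V)"
proof (rule xenergy_le_neg)
  show "xenergy_le (E - m) k (xcurrent m V)"
    by (rule xenergy_le_scalar_extend[OF assms(1)])
      (use assms in \<open>simp_all add: fock_linearD[OF fock_linear_current] energy_le_current\<close>)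
qed (use assms in simp)

context
  fixes \<sigma> :: int and c :: "nat \<Rightarrow> scalar"
  assumes adm: "admissible \<sigma> c"
begin

lemma xsummable_current_sum:
  "xsummable (\<lambda>n. if n = 0 then 0 else xscale (c n) (xcurrent (\<sigma> * int n) V))"
proof (rule xsummable_natI)
  fix k
  obtain E where E: "xenergy_le E k V" using xenergy_le_exists by blast
  have "vanishes_upto k (xscale (c n) (xcurrent (\<sigma> * int n) V))" if "n > nat E" "n > k" for n
  proof (cases "\<sigma> = 1")
    case True
    then show ?thesis
      using that E by (intro xlinear_vanishes[OF xlinear_xscale] xcurrent_vanishes) auto
  next
    case False
    then show ?thesis
      using that adm by (intro xscale_vanishes_left) (auto simp: admissible_def)
  qed
  then show "\<exists>N. \<forall>n\<ge>N. vanishes_upto k (if n = 0 then 0 else xscale (c n) (xcurrent (\<sigma> * int n) V))"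
    by (intro exI[of _ "Suc (max (nat E) k)"]) auto
qed

lemma xlinear_current_sum: "xlinear (current_sum \<sigma> c)"
  unfolding current_sum_def
proof (rule xlinear_tsum)
  fix n
  have "n \<noteq> 0 \<Longrightarrow> xlinear (\<lambda>V. xscale (c n) (xcurrent (\<sigma> * int n) V))"
    using adm by (intro xlinear_compose[OF xlinear_xscale] xlinear_xcurrent) (auto simp: admissible_def)
  then show "xlinear (\<lambda>V. if n = 0 then 0 else xscale (c n) (xcurrent (\<sigma> * int n) V))"
    by (cases "n = 0") (simp_all add: xlinear_zero)
qed (rule xsummable_current_sum)

text \<open>Each application lowers the energy bound by at least 1 when \<sigma> = 1, and gains a
  factor \<beta> when \<sigma> = -1, because only indices n \<ge> 1 occur.\<close>

lemma nilpotent_current_sum: "nilpotent_op (current_sum \<sigma> c)"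
  unfolding nilpotent_op_def
proof (intro allI)
  fix V k
  let ?t = "\<lambda>n V. if n = 0 then 0 else xscale (c n) (xcurrent (\<sigma> * int n) V)"
  have nth: "\<exists>A. finite A \<and> fps_nth (current_sum \<sigma> c V) i = (\<Sum>n\<in>A. fps_nth (?t n V) i)" for V i
  proof -
    obtain A where "finite A" "\<And>n. n \<notin> A \<Longrightarrow> vanishes_upto i (?t n V)"
      using xsummable_finite_upto[OF xsummable_current_sum] by metis
    then have "fps_nth (current_sum \<sigma> c V) i = (\<Sum>n\<in>A. fps_nth (?t n V) i)"
      unfolding current_sum_def by (intro tsum_nth) (auto simp: vanishes_upto_def)
    then show ?thesis using \<open>finite A\<close> by blast
  qed
  show "\<exists>N. \<forall>n\<ge>N. vanishes_upto k ((current_sum \<sigma> c ^^ n) V)"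
  proof (cases "\<sigma> = 1")
    case True
    obtain E where E: "xenergy_le E k V" using xenergy_le_exists by blast
    have step: "xenergy_le (E - 1) k (current_sum \<sigma> c V)" if "xenergy_le E k V" for E V
    proof -
      have "xenergy_le (E - 1) k (?t n V)" for n
      proof (cases "n = 0")
        case False
        have "xenergy_le (E - \<sigma> * int n) k (xcurrent (\<sigma> * int n) V)"
          by (rule xenergy_le_scalar_extend[OF that])
            (use True False in \<open>simp_all add: fock_linearD[OF fock_linear_current] energy_le_current\<close>)
        then have "xenergy_le (E - 1) k (xcurrent (\<sigma> * int n) V)"
          by (rule xenergy_le_mono) (use True False in auto)
        then show ?thesis using False by (simp add: xenergy_le_xscale)
      qed (simp add: xenergy_le_def energy_le.zero)
      then show ?thesis
        unfolding xenergy_le_def using nth[of V]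
        by (metis (no_types, lifting) energy_le_sum lookup_sum)
    qed
    have "xenergy_le (E - int n) k ((current_sum \<sigma> c ^^ n) V)" for n
    proof (induction n)
      case (Suc n)
      then show ?case using step[OF Suc] by (simp add: algebra_simps)
    qed (simp add: E)
    then have "vanishes_upto k ((current_sum \<sigma> c ^^ n) V)" if "n > nat E" for n
      using that by (intro xenergy_le_neg[of "E - int n"]) auto
    then show ?thesis by (meson Suc_le_eq)
  next
    case False
    then have \<sigma>: "\<sigma> = - 1" and c: "\<And>n i. i < n \<Longrightarrow> fps_nth (c n) i = 0"
      using adm by (auto simp: admissible_def)
    have "\<forall>i<n. fps_nth ((current_sum \<sigma> c ^^ n) V) i = 0" for n
    proof (induction n)
      case (Suc n)
      define W where "W = (current_sum \<sigma> c ^^ n) V"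
      have W: "fps_nth (xcurrent m W) i = 0" if "i < n" for i m
        using Suc that by (simp add: W_def scalar_extend_nth)
      have "fps_nth (?t m W) i = 0" if "i < Suc n" for m i
      proof (cases "m = 0")
        case False
        have "poly_scale (fps_nth (c m) j) (fps_nth (xcurrent (\<sigma> * int m) W) (i - j)) = 0" if "j \<le> i" for j
          using False c[of 0 m] W[of "i - j" "\<sigma> * int m"] that \<open>i < Suc n\<close> by (cases "j = 0") auto
        then show ?thesis using False by (simp add: xscale_nth)
      qed simp
      then have "fps_nth (current_sum \<sigma> c W) i = 0" if "i < Suc n" for i
        using nth[of W i] that by auto
      then show ?case by (simp add: W_def)
    qed simp
    then have "vanishes_upto k ((current_sum \<sigma> c ^^ n) V)" if "n > k" for n
      using that by (auto simp: vanishes_upto_def)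
    then show ?thesis by (meson Suc_le_eq)
  qed
qed

lemma current_sum_fermi_field:
  assumes "gtends (\<lambda>j. \<Sum>n<j. if n = 0 then 0 else gscal (c n) * zpow (\<sigma> * int n)) h"
  shows "current_sum \<sigma> c (fermi_field s P V) =
    fermi_field s P (current_sum \<sigma> c V) + xscale (fsign s) (fermi_field s (h * P) V)"
proof -
  let ?g = "\<lambda>n. (if n = 0 then 0 else gscal (c n) * zpow (\<sigma> * int n)) * P"
  let ?t = "\<lambda>n V. if n = 0 then 0 else xscale (c n) (xcurrent (\<sigma> * int n) V)"
  have g: "gtends (\<lambda>j. \<Sum>n<j. ?g n) (h * P)"
    using gtends_mult[OF assms, of P] by (simp add: sum_distrib_right)
  have "?t n (fermi_field s P V) = fermi_field s P (?t n V) + xscale (fsign s) (fermi_field s (?g n) V)" for n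
  proof (cases "n = 0")
    case False
    then have "\<sigma> * int n \<noteq> 0" using adm by (auto simp: admissible_def)
    then show ?thesis
      using False
      by (simp add: xcurrent_fermi_field xscale_add_right xlinearD(2)[OF xlinear_fermi_field]
          mult.assoc fermi_field_gscal xscale_commute[of "c n"])
  qed (simp add: xlinearD(3)[OF xlinear_fermi_field])
  then have "current_sum \<sigma> c (fermi_field s P V) =
      tsum (\<lambda>n. fermi_field s P (?t n V) + xscale (fsign s) (fermi_field s (?g n) V))"
    by (simp only: current_sum_def)
  also have "\<dots> = fermi_field s P (current_sum \<sigma> c V) + xscale (fsign s) (fermi_field s (h * P) V)"
    by (simp only: tsum_add[OF tsum_xlinear(2)[OF xlinear_fermi_field xsummable_current_sum]
          tsum_xlinear(2)[OF xlinear_xscale tsum_fermi_field(1)[OF g]]]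
        tsum_xlinear(1)[OF xlinear_fermi_field xsummable_current_sum, symmetric]
        tsum_xlinear(1)[OF xlinear_xscale tsum_fermi_field(1)[OF g], symmetric]
        tsum_fermi_field(2)[OF g] current_sum_def)
  finally show ?thesis .
qed

end

lemma xsummable_nat_eventually:
  fixes F :: "nat \<Rightarrow> xfock"
  assumes "xsummable F"
  shows "\<exists>N. \<forall>n\<ge>N. vanishes_upto k (F n)"
proof -
  obtain A where A: "finite A" "\<And>n. n \<notin> A \<Longrightarrow> vanishes_upto k (F n)"
    using xsummable_finite_upto[OF assms] by metis
  then obtain N where "\<forall>n\<in>A. n < N" using finite_nat_set_iff_bounded by blast
  then show ?thesis using A by (meson leD)
qed

text \<open>The commutator with the operator multiplies P by plus or minus S applied to the
  logarithm. The j-th divided power of this multiplication is given by \<open>exp_term\<close>, and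
  these add up to the closed form.\<close>

lemma (in gring_substitution) xexp_current_sum_fermi_field:
  assumes adm: "admissible \<sigma> c"
    and c: "\<And>n. n \<noteq> 0 \<Longrightarrow> gscal (c n) * zpow (\<sigma> * int n) = S (fps_const (1 / of_nat n) * fps_X ^ n)"
  shows "xexp (current_sum \<sigma> c) (fermi_field s P V) =
    fermi_field s (S (exp_log s) * P) (xexp (current_sum \<sigma> c) V)"
proof -
  let ?O = "current_sum \<sigma> c"
  have "(if n = 0 then 0 else gscal (c n) * zpow (\<sigma> * int n)) =
      S (if n = 0 then 0 else fps_const (1 / of_nat n) * fps_X ^ n)" for n
    by (simp add: c S_0)
  then have h: "gtends (\<lambda>j. \<Sum>n<j. if n = 0 then 0 else gscal (c n) * zpow (\<sigma> * int n)) (S log_series)"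
    using S_tends[OF log_series_partial_sum] by simp
  have e: "gtends (\<lambda>j. \<Sum>n<j. S (exp_term s n) * P) (S (exp_log s) * P)"
    using gtends_mult[OF S_tends[OF exp_term_partial_sum], where P=P] by (simp add: sum_distrib_right)
  define D where "D j V = fermi_field s (S (exp_term s j) * P) V" for j V
  have "xexp ?O (D 0 V) = tsum (\<lambda>j. D j (xexp ?O V))"
  proof (rule xexp_leibniz[OF xlinear_current_sum[OF adm] xlinear_current_sum[OF adm] nilpotent_current_sum[OF adm]])
    show "xlinear (D j)" for j unfolding D_def by (rule xlinear_fermi_field)
    show "?O (D j V) = xscale (scalar_const (of_nat (Suc j))) (D (Suc j) V) + D j (?O V)" for j V
    proof -
      have "xscale (fsign s) (fermi_field s (S log_series * (S (exp_term s j) * P)) V) =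
          fermi_field s (S (fps_const (csign s) * log_series * exp_term s j) * P) V"
        by (simp add: S_mult S_const fsign_eq mult.assoc flip: fermi_field_gscal)
      also have "\<dots> = xscale (scalar_const (of_nat (Suc j))) (D (Suc j) V)"
        unfolding exp_term_Suc by (simp add: S_mult S_const mult.assoc fermi_field_gscal D_def del: of_nat_Suc)
      finally show ?thesis
        unfolding D_def current_sum_fermi_field[OF adm h] by (simp add: add.commute)
    qed
    show "\<exists>J. \<forall>j\<ge>J. vanishes_upto k (D j V)" for V k
      unfolding D_def by (rule xsummable_nat_eventually[OF tsum_fermi_field(1)[OF e]])
  qed
  also have "\<dots> = fermi_field s (S (exp_log s) * P) (xexp ?O V)"
    unfolding D_def by (rule tsum_fermi_field(2)[OF e])
  finally show ?thesis by (simp add: D_def exp_term_0 S_1)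
qed

text \<open>X becomes y z.\<close>

definition zsubst :: "mpoly \<Rightarrow> complex fps \<Rightarrow> gring" where
  "zsubst y f = fps_const (fps_to_fls (fps_subst (Poly_Mapping.single 0) y f))"

text \<open>X becomes - \<beta>/z, the sign being that of the argument of Hstar; the variable of the
  outer power series is \<beta>.\<close>

definition bsubst :: "complex fps \<Rightarrow> gring" where
  "bsubst f = fps_subst (\<lambda>a. fls_const (Poly_Mapping.single 0 a)) (- fls_X_inv) f"

lemma single_hom:
  "Poly_Mapping.single 0 (a + b) = (Poly_Mapping.single 0 a + Poly_Mapping.single 0 b :: mpoly)"
  "Poly_Mapping.single 0 (a * b) = (Poly_Mapping.single 0 a * Poly_Mapping.single 0 b :: mpoly)"
  by (simp_all add: single_add mult_single)

lemma gscal_const: "gscal (fps_const p) = fps_const (fls_const p)"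
  by (rule fps_ext) (simp add: fls_const_0)

text \<open>Smallness comes here from high powers of z, and for \<open>bsubst\<close> from high
  powers of \<beta>.\<close>

lemma gring_substitution_zsubst: "gring_substitution (zsubst y)"
proof
  fix f g :: "complex fps" and c k m
  show "zsubst y (f + g) = zsubst y f + zsubst y g"
    by (simp add: zsubst_def fps_subst_hom(1)[of "Poly_Mapping.single 0", OF single_hom] flip: fps_const_add)
  show "zsubst y (f * g) = zsubst y f * zsubst y g"
    by (simp add: zsubst_def fps_subst_hom(2)[of "Poly_Mapping.single 0", OF single_hom]
        fls_times_fps_to_fls flip: fps_const_mult)
  show "zsubst y (fps_const c) = gscal (scalar_const c)"
    by (simp add: zsubst_def fps_subst_hom(3)[of "Poly_Mapping.single 0", OF single_hom]
        scalar_const_def gscal_const)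
  have "gsmall k m (zsubst y f)" if "\<forall>n<Suc (nat m). fps_nth f n = 0" for f
    using that by (auto simp: gsmall_def zsubst_def fps_subst_def)
  then show "\<exists>N. \<forall>f. (\<forall>n<N. fps_nth f n = 0) \<longrightarrow> gsmall k m (zsubst y f)" by blast
qed

lemma fls_single_hom:
  "fls_const (Poly_Mapping.single 0 (a + b)) =
    (fls_const (Poly_Mapping.single 0 a) + fls_const (Poly_Mapping.single 0 b) :: mpoly fls)"
  "fls_const (Poly_Mapping.single 0 (a * b)) =
    (fls_const (Poly_Mapping.single 0 a) * fls_const (Poly_Mapping.single 0 b) :: mpoly fls)"
  "fls_const (Poly_Mapping.single 0 0) = (0 :: mpoly fls)"
  by (simp_all add: single_hom fls_const_0 fls_plus_const)

lemma gring_substitution_bsubst: "gring_substitution bsubst"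
proof
  fix f g :: "complex fps" and c k m
  note hom = fps_subst_hom[of "\<lambda>a. fls_const (Poly_Mapping.single 0 a) :: mpoly fls", OF fls_single_hom]
  show "bsubst (f + g) = bsubst f + bsubst g" by (simp add: bsubst_def hom)
  show "bsubst (f * g) = bsubst f * bsubst g" by (simp add: bsubst_def hom)
  show "bsubst (fps_const c) = gscal (scalar_const c)"
    by (simp add: bsubst_def hom scalar_const_def gscal_const)
  have "gsmall k m (bsubst f)" if "\<forall>n<Suc k. fps_nth f n = 0" for f
    using that by (auto simp: gsmall_def bsubst_def fps_subst_def fls_const_0)
  then show "\<exists>N. \<forall>f. (\<forall>n<N. fps_nth f n = 0) \<longrightarrow> gsmall k m (bsubst f)" by blast
qed

interpretation zsubst: gring_substitution "zsubst y" for y by (rule gring_substitution_zsubst)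
interpretation bsubst: gring_substitution bsubst by (rule gring_substitution_bsubst)

definition H_coeff :: "scalar list \<Rightarrow> nat \<Rightarrow> scalar" where
  "H_coeff X n = scalar_const (1 / of_nat n) * power_sum X n"

lemma Hop_eq: "Hop X = current_sum 1 (H_coeff X)"
  by (simp add: fun_eq_iff Hop_def current_sum_def xsum_eq_tsum H_coeff_def cong: if_cong)

lemma Hstar_eq: "Hstar X = current_sum (- 1) (H_coeff X)"
  by (simp add: fun_eq_iff Hstar_def current_sum_def xsum_eq_tsum H_coeff_def cong: if_cong)

lemma admissible_Hop: "admissible 1 c"
  by (simp add: admissible_def)

lemma beta_power_nth: "fps_nth (c * beta ^ n) i = (if i < n then 0 else fps_nth c (i - n))"
  unfolding beta_def by (simp add: fps_X_power_mult_right_nth)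

lemma admissible_Hstar: "admissible (- 1) (H_coeff [- beta])"
proof -
  have "H_coeff [- beta] n = (scalar_const (1 / of_nat n) * (- 1) ^ n) * beta ^ n" for n
    by (simp add: H_coeff_def power_sum_def power_minus[of beta])
  then show ?thesis by (simp add: admissible_def beta_power_nth)
qed

abbreviation (input) x_scalar :: "nat \<Rightarrow> scalar" where
  "x_scalar k \<equiv> fps_const (xvar k)"

abbreviation (input) Hstar_beta :: "xfock \<Rightarrow> xfock" where
  "Hstar_beta \<equiv> Hstar [- beta]"

lemmas Hop_linear = xlinear_current_sum[OF admissible_Hop, of "H_coeff X" for X, folded Hop_eq]
lemmas Hop_nilpotent = nilpotent_current_sum[OF admissible_Hop, of "H_coeff X" for X, folded Hop_eq]
lemmas Hstar_linear = xlinear_current_sum[OF admissible_Hstar, folded Hstar_eq]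
lemmas Hstar_nilpotent = nilpotent_current_sum[OF admissible_Hstar, folded Hstar_eq]

lemma fps_subst_monomial:
  assumes "\<iota> 0 = 0"
  shows "fps_subst \<iota> y (fps_const c * fps_X ^ n) = fps_const (\<iota> c * y ^ n) * fps_X ^ n"
  by (rule fps_ext) (simp add: fps_subst_def assms)

text \<open>For a single variable x the multiplier of H is the sum of x^n z^n / n, that is - log (1
  - x z).\<close>

lemma xexp_Hop_field:
  "xexp (Hop [x_scalar k]) (fermi_field s P V) =
    fermi_field s (zsubst (xvar k) (exp_log s) * P) (xexp (Hop [x_scalar k]) V)"
  unfolding Hop_eq
proof (rule zsubst.xexp_current_sum_fermi_field[OF admissible_Hop])
  fix n :: nat
  have "gscal (H_coeff [x_scalar k] n) * zpow (1 * int n) =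
      fps_const (fls_const (Poly_Mapping.single 0 (1 / of_nat n) * xvar k ^ n) * fls_X_intpow (int n))"
    by (simp add: H_coeff_def power_sum_def scalar_const_def fps_const_power gscal_const zpow_def
        del: fls_const_mult_const)
  also have "fls_X_intpow (int n) = fps_to_fls (fps_X ^ n :: mpoly fps)"
    by (simp add: fps_to_fls_power fls_X_power_conv_shift_1)
  also have "fls_const (Poly_Mapping.single 0 (1 / of_nat n) * xvar k ^ n) =
      fps_to_fls (fps_const (Poly_Mapping.single 0 (1 / of_nat n) * xvar k ^ n))"
    by simp
  finally show "gscal (H_coeff [x_scalar k] n) * zpow (1 * int n) =
      zsubst (xvar k) (fps_const (1 / of_nat n) * fps_X ^ n)"
    by (simp only: zsubst_def fps_subst_monomial[of "Poly_Mapping.single 0", OF single_zero] fls_times_fps_to_fls)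
qed

lemma xexp_Hstar_field:
  "xexp Hstar_beta (fermi_field s P V) = fermi_field s (bsubst (exp_log s) * P) (xexp Hstar_beta V)"
  unfolding Hstar_eq
proof (rule bsubst.xexp_current_sum_fermi_field[OF admissible_Hstar])
  fix n :: nat
  have "gscal (H_coeff [- beta] n) * zpow (- 1 * int n) =
      fps_const (fls_const (Poly_Mapping.single 0 (1 / of_nat n) * (- 1) ^ n)) * fps_X ^ n * zpow (- int n)"
  proof -
    have "gscal beta = fps_X"
      by (rule fps_ext) (auto simp: beta_def fls_const_0 fls_const_1)
    moreover have "H_coeff [- beta] n = fps_const (Poly_Mapping.single 0 (1 / of_nat n) * (- 1) ^ n) * beta ^ n"
      by (simp add: H_coeff_def power_sum_def scalar_const_def power_minus[of beta] mult.assoc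
          flip: fps_const_mult fps_const_power fps_const_neg)
    ultimately show ?thesis by (simp add: gscal_mult gscal_power gscal_const del: fls_const_mult_const)
  qed
  also have "\<dots> = fps_const (fls_const (Poly_Mapping.single 0 (1 / of_nat n)) * (- fls_X_inv) ^ n) * fps_X ^ n"
  proof -
    have "zpow (- int n) = fps_const (fls_X_inv ^ n)"
      by (simp add: zpow_def fls_X_inv_power_conv_shift_1)
    moreover have "(- fls_X_inv) ^ n = fls_const ((- 1) ^ n) * (fls_X_inv ^ n :: mpoly fls)"
      by (cases "even n") simp_all
    ultimately show ?thesis
      by (simp add: mult_ac flip: fls_const_mult_const)
  qed
  finally show "gscal (H_coeff [- beta] n) * zpow (- 1 * int n) = bsubst (fps_const (1 / of_nat n) * fps_X ^ n)"
    by (simp add: bsubst_def fps_subst_monomial fls_const_0)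
qed

section \<open>Exchanging the exponentials of H and of Hstar\<close>

lemma xcurrent_commute: "m > 0 \<Longrightarrow> n > 0 \<Longrightarrow> xcurrent m (xcurrent n V) = xcurrent n (xcurrent m V)"
  by (intro xfock_eqI)
    (simp add: lookup_scalar_extend fock_linearD[OF fock_linear_current] current_commute)

lemma xcurrent_heisenberg:
  "m > 0 \<Longrightarrow> n > 0 \<Longrightarrow> xcurrent m (xcurrent (- n) V) =
    xcurrent (- n) (xcurrent m V) + (if m = n then xscale (scalar_const (of_int m)) V else 0)"
proof (intro xfock_eqI)
  fix k l
  assume "m > 0" "n > 0"
  moreover have "Poly_Mapping.lookup (poly_scale (Poly_Mapping.single 0 c) v) l =
      fock_scale c (Poly_Mapping.lookup v l)" for c v
  proof -
    have "poly_scale (Poly_Mapping.single 0 c) v = Poly_Mapping.map (fock_scale c) v"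
      by (induction v rule: poly_mapping_induct_single)
        (simp_all add: poly_scale_add_right map_add_hom fock.scale_right_distrib map_single)
    then show ?thesis by (simp add: lookup_map_zero)
  qed
  ultimately show "Poly_Mapping.lookup (fps_nth (xcurrent m (xcurrent (- n) V)) k) l =
    Poly_Mapping.lookup (fps_nth (xcurrent (- n) (xcurrent m V) +
      (if m = n then xscale (scalar_const (of_int m)) V else 0)) k) l"
    by (simp add: lookup_scalar_extend fock_linearD[OF fock_linear_current] current_heisenberg
        lookup_add scalar_const_def xscale_const_nth del: single_of_int)
qed

lemma tsum_xscale:
  fixes f :: "nat \<Rightarrow> scalar"
  assumes "\<And>k. \<exists>N. \<forall>j\<ge>N. \<forall>i\<le>k. fps_nth (\<Sum>n<j. f n) i = fps_nth g i"
  shows "xsummable (\<lambda>n. xscale (f n) V)" "tsum (\<lambda>n. xscale (f n) V) = xscale g V"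
proof -
  have "\<exists>N. \<forall>j\<ge>N. vanishes_upto k ((\<Sum>n<j. xscale (f n) V) - xscale g V)" for k
  proof -
    obtain N where N: "\<forall>j\<ge>N. \<forall>i\<le>k. fps_nth (\<Sum>n<j. f n) i = fps_nth g i" using assms by blast
    have "vanishes_upto k ((\<Sum>n<j. xscale (f n) V) - xscale g V)" if "j \<ge> N" for j
    proof -
      have "vanishes_upto k (xscale ((\<Sum>n<j. f n) - g) V)"
        using N that by (intro xscale_vanishes_left) simp
      then show ?thesis
        using xscale_add_left[of "(\<Sum>n<j. f n) - g" g V]
        by (simp add: xscale_sum_left algebra_simps)
    qed
    then show ?thesis by blast
  qed
  then show "xsummable (\<lambda>n. xscale (f n) V)" "tsum (\<lambda>n. xscale (f n) V) = xscale g V"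
    by (rule tsum_partial_sums)+
qed

text \<open>X becomes y \<beta>. The value y = - x_k belongs to the product of x_k z and -
  \<beta>/z, the arguments substituted for H and for Hstar.\<close>

definition rsubst :: "mpoly \<Rightarrow> complex fps \<Rightarrow> scalar" where
  "rsubst y f = fps_subst (Poly_Mapping.single 0) y f"

lemma rsubst_hom:
  "rsubst y (f + g) = rsubst y f + rsubst y g" "rsubst y (f * g) = rsubst y f * rsubst y g"
  "rsubst y (fps_const c) = scalar_const c"
  by (simp_all add: rsubst_def scalar_const_def fps_subst_hom[of "Poly_Mapping.single 0", OF single_hom])

lemma rsubst_sum: "rsubst y (\<Sum>i\<in>A. f i) = (\<Sum>i\<in>A. rsubst y (f i))"
proof -
  have "rsubst y 0 = 0" using rsubst_hom(3)[of y 0] by (simp add: scalar_const_def)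
  then show ?thesis
    by (induction A rule: infinite_finite_induct) (simp_all add: rsubst_hom)
qed

lemma rsubst_uminus: "rsubst y (- f) = - rsubst y f"
proof -
  have "rsubst y (- f) + rsubst y f = 0"
    using rsubst_hom(3)[of y 0] by (simp add: scalar_const_def flip: rsubst_hom)
  then show ?thesis by (simp add: eq_neg_iff_add_eq_0)
qed

lemma rsubst_tends:
  assumes "\<And>n j. n < j \<Longrightarrow> fps_nth (\<Sum>i<j. F i) n = fps_nth f n"
  shows "\<exists>N. \<forall>j\<ge>N. \<forall>i\<le>k. fps_nth (\<Sum>n<j. rsubst y (F n)) i = fps_nth (rsubst y f) i"
proof (intro exI[of _ "Suc k"] allI impI)
  fix j i assume "Suc k \<le> j" "i \<le> k"
  then have "fps_nth (\<Sum>i<j. F i) i = fps_nth f i" by (intro assms) simp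
  then show "fps_nth (\<Sum>n<j. rsubst y (F n)) i = fps_nth (rsubst y f) i"
    unfolding rsubst_sum[symmetric] by (simp add: rsubst_def fps_subst_def)
qed

text \<open>Only currents of opposite index interact, and n (x^n / n) ((- \<beta>)^n / n) sums to -
  log (1 + \<beta> x).\<close>

lemma Hop_Hstar:
  "Hop [x_scalar k] (Hstar_beta V) = Hstar_beta (Hop [x_scalar k] V) + xscale (rsubst (- xvar k) log_series) V"
proof -
  let ?c = "H_coeff [x_scalar k]" and ?d = "H_coeff [- beta]"
  let ?ts = "\<lambda>n V. if n = 0 then 0 else xscale (?d n) (xcurrent (- 1 * int n) V)"
  let ?to = "\<lambda>n V. if n = 0 then 0 else xscale (?c n) (xcurrent (1 * int n) V)"
  let ?e = "\<lambda>n::nat. if n = 0 then 0 else ?c n * (?d n * scalar_const (of_nat n))"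
  have star: "xcurrent (int n) (Hstar_beta V) =
      Hstar_beta (xcurrent (int n) V) + xscale (?d n * scalar_const (of_nat n)) V" if "n \<noteq> 0" for n V
  proof -
    have lin: "xlinear (xcurrent (int n))" using that by (intro xlinear_xcurrent) simp
    let ?r = "\<lambda>m. if m = n then xscale (?d n * scalar_const (of_nat n)) V else 0"
    have "xcurrent (int n) (?ts m V) = ?ts m (xcurrent (int n) V) + ?r m" for m
      using that
      by (cases "m = 0")
        (auto simp: xlinearD[OF lin] xcurrent_heisenberg xscale_add_right xscale_mult)
    then have "xcurrent (int n) (Hstar_beta V) = tsum (\<lambda>m. ?ts m (xcurrent (int n) V) + ?r m)"
      by (simp only: Hstar_eq current_sum_def tsum_xlinear(1)[OF lin xsummable_current_sum[OF admissible_Hstar]])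
    also have "\<dots> = Hstar_beta (xcurrent (int n) V) + tsum ?r"
      unfolding Hstar_eq current_sum_def
    proof (rule tsum_add[OF xsummable_current_sum[OF admissible_Hstar]])
      show "xsummable ?r"
        by (rule xsummableI) (intro exI[of _ "{n}"], auto)
    qed
    also have "tsum ?r = xscale (?d n * scalar_const (of_nat n)) V"
      by (subst tsum_single[where a=n]) auto
    finally show ?thesis .
  qed
  have "?e n = rsubst (- xvar k) (if n = 0 then 0 else fps_const (1 / of_nat n) * fps_X ^ n)" for n
  proof (cases "n = 0")
    case False
    have one: "scalar_const (1 / of_nat n) * scalar_const (of_nat n) = 1"
      using False by (simp flip: scalar_const_mult)
    have "?e n = (scalar_const (1 / of_nat n) * scalar_const (of_nat n)) *
        (scalar_const (1 / of_nat n) * (x_scalar k * - beta) ^ n)"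
      using False unfolding H_coeff_def power_sum_def power_mult_distrib by (simp add: mult_ac)
    also have "\<dots> = scalar_const (1 / of_nat n) * (x_scalar k * - beta) ^ n"
      unfolding one by simp
    also have "(x_scalar k * - beta) = fps_const (- xvar k) * fps_X"
      by (simp add: beta_def flip: fps_const_neg)
    also have "scalar_const (1 / of_nat n) * (fps_const (- xvar k) * fps_X) ^ n =
        fps_const (Poly_Mapping.single 0 (1 / of_nat n) * (- xvar k) ^ n) * fps_X ^ n"
      by (simp add: scalar_const_def power_mult_distrib fps_const_power mult.assoc[symmetric] del: fps_const_neg)
    also have "\<dots> = rsubst (- xvar k) (fps_const (1 / of_nat n) * fps_X ^ n)"
      by (simp add: rsubst_def fps_subst_monomial[of "Poly_Mapping.single 0", OF single_zero])
    finally show ?thesis using False by simp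
  qed (simp add: rsubst_def fps_subst_def fps_ext)
  then have e: "\<exists>N. \<forall>j\<ge>N. \<forall>i\<le>m. fps_nth (\<Sum>n<j. ?e n) i = fps_nth (rsubst (- xvar k) log_series) i" for m
    using rsubst_tends[OF log_series_partial_sum, of m "- xvar k"] by simp
  have "?to n (Hstar_beta V) = Hstar_beta (?to n V) + xscale (?e n) V" for n
    by (cases "n = 0")
      (simp_all add: star xlinearD[OF Hstar_linear] xscale_add_right xscale_mult)
  then have "Hop [x_scalar k] (Hstar_beta V) = tsum (\<lambda>n. Hstar_beta (?to n V) + xscale (?e n) V)"
    by (simp only: Hop_eq current_sum_def)
  also have "\<dots> = Hstar_beta (Hop [x_scalar k] V) + xscale (rsubst (- xvar k) log_series) V"
    by (simp only: tsum_add[OF tsum_xlinear(2)[OF Hstar_linear xsummable_current_sum[OF admissible_Hop]] tsum_xscale(1)[OF e]]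
        tsum_xlinear(1)[OF Hstar_linear xsummable_current_sum[OF admissible_Hop], symmetric]
        tsum_xscale(2)[OF e] Hop_eq current_sum_def)
  finally show ?thesis .
qed

lemma op_neg_linear: "xlinear T \<Longrightarrow> xlinear (op_neg T)"
  unfolding op_neg_eq by (rule xlinear_uminus)

lemma op_neg_nilpotent: "xlinear T \<Longrightarrow> nilpotent_op T \<Longrightarrow> nilpotent_op (op_neg T)"
  unfolding op_neg_eq by (rule nilpotent_op_uminus)

abbreviation (input) exp_neg_Hstar :: "xfock \<Rightarrow> xfock" where
  "exp_neg_Hstar \<equiv> xexp (op_neg Hstar_beta)"

lemmas exp_neg_Hstar_linear = xlinear_xexp[OF op_neg_linear[OF Hstar_linear] op_neg_nilpotent[OF Hstar_linear Hstar_nilpotent]]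

lemma rsubst_exp_log_False: "rsubst (- xvar k) (exp_log False) = 1 + beta * x_scalar k"
proof (rule fps_ext)
  fix n
  show "fps_nth (rsubst (- xvar k) (exp_log False)) n = fps_nth (1 + beta * x_scalar k) n"
    by (cases n; cases "n - 1")
      (simp_all add: rsubst_def fps_subst_def exp_log_def beta_def single_uminus)
qed

text \<open>For operators with scalar commutator c, exchanging their exponentials costs the scalar
  exp c. Here c is the commutator of H with - Hstar, that is log (1 + \<beta> x).\<close>

lemma xexp_Hop_exp_neg_Hstar:
  "xexp (Hop [x_scalar k]) (exp_neg_Hstar V) = xscale (1 + beta * x_scalar k) (exp_neg_Hstar (xexp (Hop [x_scalar k]) V))"
proof -
  let ?g = "rsubst (- xvar k)"
  have comm: "Hop [x_scalar k] (exp_neg_Hstar V) = exp_neg_Hstar (Hop [x_scalar k] V) + xscale (- ?g log_series) (exp_neg_Hstar V)" for V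
  proof (rule xexp_scalar_commutator[OF Hop_linear op_neg_linear[OF Hstar_linear]
        op_neg_nilpotent[OF Hstar_linear Hstar_nilpotent]])
    show "Hop [x_scalar k] (op_neg Hstar_beta V) = op_neg Hstar_beta (Hop [x_scalar k] V) + xscale (- ?g log_series) V" for V
      by (simp add: op_neg_def xlinearD[OF Hop_linear] Hop_Hstar xscale_uminus)
  qed
  define D where "D j V = xscale (?g (exp_term False j)) (exp_neg_Hstar V)" for j V
  have e: "\<exists>N. \<forall>j\<ge>N. \<forall>i\<le>m. fps_nth (\<Sum>n<j. ?g (exp_term False n)) i = fps_nth (?g (exp_log False)) i" for m
    by (rule rsubst_tends[OF exp_term_partial_sum])
  have "xexp (Hop [x_scalar k]) (D 0 V) = tsum (\<lambda>j. D j (xexp (Hop [x_scalar k]) V))"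
  proof (rule xexp_leibniz[OF Hop_linear Hop_linear Hop_nilpotent])
    show "xlinear (D j)" for j
      unfolding D_def by (rule xlinear_compose[OF xlinear_xscale exp_neg_Hstar_linear])
    show "Hop [x_scalar k] (D j V) = xscale (scalar_const (of_nat (Suc j))) (D (Suc j) V) + D j (Hop [x_scalar k] V)" for j V
    proof -
      have "?g (exp_term False j) * - ?g log_series = ?g (fps_const (csign False) * log_series * exp_term False j)"
        by (simp add: csign_def rsubst_uminus rsubst_hom mult.commute flip: fps_const_neg)
      also have "\<dots> = scalar_const (of_nat (Suc j)) * ?g (exp_term False (Suc j))"
        by (simp only: exp_term_Suc rsubst_hom)
      finally have "xscale (?g (exp_term False j)) (xscale (- ?g log_series) (exp_neg_Hstar V)) =
          xscale (scalar_const (of_nat (Suc j))) (D (Suc j) V)"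
        by (simp only: D_def flip: xscale_mult)
      then show ?thesis
        by (simp only: D_def xlinearD(2)[OF Hop_linear] comm xscale_add_right) (simp add: add.commute)
    qed
    show "\<exists>J. \<forall>j\<ge>J. vanishes_upto m (D j V)" for V m
      unfolding D_def by (rule xsummable_nat_eventually[OF tsum_xscale(1)[OF e]])
  qed
  also have "\<dots> = xscale (1 + beta * x_scalar k) (exp_neg_Hstar (xexp (Hop [x_scalar k]) V))"
    unfolding D_def tsum_xscale(2)[OF e] rsubst_exp_log_False ..
  finally show ?thesis using rsubst_hom(3)[of _ 1] by (simp add: D_def exp_term_0)
qed

lemma H_coeff_append: "H_coeff (X @ Y) n = H_coeff X n + H_coeff Y n"
  by (simp add: H_coeff_def power_sum_def distrib_left)

lemma Hop_append: "Hop (X @ Y) V = Hop X V + Hop Y V"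
proof -
  let ?t = "\<lambda>X n. if n = 0 then 0 else xscale (H_coeff X n) (xcurrent (1 * int n) V)"
  have "?t (X @ Y) n = ?t X n + ?t Y n" for n
    by (simp add: H_coeff_append xscale_add_left)
  then show ?thesis
    by (simp only: Hop_eq current_sum_def tsum_add[OF xsummable_current_sum[OF admissible_Hop]
          xsummable_current_sum[OF admissible_Hop]])
qed

lemma Hop_commute: "Hop X (Hop Y V) = Hop Y (Hop X V)"
proof -
  let ?t = "\<lambda>X n V. if n = 0 then 0 else xscale (H_coeff X n) (xcurrent (1 * int n) V)"
  have cur: "xcurrent (int m) (Hop Y V) = Hop Y (xcurrent (int m) V)" if "m \<noteq> 0" for m V
  proof -
    have lin: "xlinear (xcurrent (int m))" using that by (intro xlinear_xcurrent) simp
    have "xcurrent (int m) (?t Y n V) = ?t Y n (xcurrent (int m) V)" for n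
      using that by (simp add: xlinearD[OF lin] xcurrent_commute)
    then show ?thesis
      by (simp only: Hop_eq current_sum_def tsum_xlinear(1)[OF lin xsummable_current_sum[OF admissible_Hop]])
  qed
  have "?t X n (Hop Y V) = Hop Y (?t X n V)" for n
    by (simp add: cur xlinearD[OF Hop_linear])
  then show ?thesis
    by (simp only: Hop_eq[of X] current_sum_def
        tsum_xlinear(1)[OF Hop_linear xsummable_current_sum[OF admissible_Hop]])
qed

section \<open>The exponentials attached to the flags\<close>

definition exp_H :: "nat \<Rightarrow> xfock \<Rightarrow> xfock" where
  "exp_H p = xexp (Hop (x_upto p))"

definition exp_neg_H :: "nat \<Rightarrow> xfock \<Rightarrow> xfock" where
  "exp_neg_H p = xexp (op_neg (Hop (x_upto p)))"

lemma exp_H_linear: "xlinear (exp_H p)" and exp_neg_H_linear: "xlinear (exp_neg_H p)"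
  unfolding exp_H_def exp_neg_H_def
  by (intro xlinear_xexp Hop_linear Hop_nilpotent op_neg_linear op_neg_nilpotent)+

lemma exp_H_inv [simp]: "exp_H p (exp_neg_H p V) = V" "exp_neg_H p (exp_H p V) = V"
  unfolding exp_H_def exp_neg_H_def by (rule xexp_op_neg[OF Hop_linear Hop_nilpotent])+

lemma exp_H_0 [simp]: "exp_H 0 V = V"
proof -
  have "Hop (x_upto 0) = (\<lambda>V. 0)"
  proof
    fix V
    have "Hop ([] @ []) V = Hop [] V + Hop [] V" by (rule Hop_append)
    then show "Hop (x_upto 0) V = 0" by (simp add: x_upto_def)
  qed
  then show ?thesis by (simp add: exp_H_def xexp_zero)
qed

lemma exp_neg_H_0 [simp]: "exp_neg_H 0 V = V"
  using exp_H_inv(2)[of 0 V] unfolding exp_H_0 .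

lemma xexp_Hop_add: "xexp (\<lambda>V. Hop X V + Hop Y V) V = xexp (Hop X) (xexp (Hop Y) V)"
  by (rule xexp_add[of "Hop X" "Hop Y", OF Hop_linear Hop_nilpotent Hop_linear Hop_nilpotent Hop_commute])

lemma exp_H_Suc: "exp_H (Suc p) V = exp_H p (xexp (Hop [x_scalar (Suc p)]) V)"
proof -
  have eq: "Hop (x_upto (Suc p)) = (\<lambda>V. Hop (x_upto p) V + Hop [x_scalar (Suc p)] V)"
    by (simp add: fun_eq_iff x_upto_def Hop_append)
  show ?thesis
    unfolding exp_H_def eq
    by (rule xexp_Hop_add)
qed

text \<open>Splitting the difference into two full exponentials avoids any distinction of cases
  between p and q - 1.\<close>

lemma xexp_Hquot: "xexp (Hquot p q) V = exp_H p (exp_neg_H (q - 1) V)"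
proof -
  have eq: "Hquot p q = (\<lambda>V. Hop (x_upto p) V + op_neg (Hop (x_upto (q - 1))) V)"
    by (simp add: fun_eq_iff Hquot_def op_neg_def)
  show ?thesis
    unfolding exp_H_def exp_neg_H_def eq
    by (rule xexp_add[OF Hop_linear Hop_nilpotent op_neg_linear[OF Hop_linear]
          op_neg_nilpotent[OF Hop_linear Hop_nilpotent]])
      (simp add: op_neg_def xlinearD[OF Hop_linear] Hop_commute[of "x_upto p"])
qed

lemma xexp_neg_Hquot: "xexp (op_neg (Hquot p q)) V = exp_neg_H p (exp_H (q - 1) V)"
proof -
  have eq: "op_neg (Hquot p q) = (\<lambda>V. op_neg (Hop (x_upto p)) V + Hop (x_upto (q - 1)) V)"
    by (simp add: fun_eq_iff Hquot_def op_neg_def)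
  show ?thesis
    unfolding exp_H_def exp_neg_H_def eq
    by (rule xexp_add[OF op_neg_linear[OF Hop_linear] op_neg_nilpotent[OF Hop_linear Hop_nilpotent]
          Hop_linear Hop_nilpotent])
      (simp add: op_neg_def xlinearD[OF Hop_linear] Hop_commute[of "x_upto p"])
qed

lemma exp_H_commute: "exp_H p (exp_H q V) = exp_H q (exp_H p V)"
  unfolding exp_H_def xexp_Hop_add[symmetric] by (simp only: add.commute)

lemma Hop_xvac: "Hop X (xvac r) = 0"
proof -
  have "xcurrent (int n) (xvac r) = 0" if "n \<noteq> 0" for n
    using that
    by (intro xfock_eqI)
      (simp add: lookup_scalar_extend fock_linearD[OF fock_linear_current] xvac_def lookup_single
        when_def current_shifted_vac)
  then have "(if n = 0 then 0 else xscale (H_coeff X n) (xcurrent (1 * int n) (xvac r))) = 0" for n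
    by simp
  then show ?thesis by (simp only: Hop_eq current_sum_def tsum_zero)
qed

lemma exp_H_xvac: "exp_H p (xvac r) = xvac r"
proof -
  have "(Hop (x_upto p) ^^ n) (xvac r) = 0" if "n \<noteq> 0" for n
  proof -
    obtain m where "n = Suc m" using \<open>n \<noteq> 0\<close> not0_implies_Suc by blast
    then have "(Hop (x_upto p) ^^ n) (xvac r) = (Hop (x_upto p) ^^ m) 0"
      by (simp only: funpow_Suc_right comp_apply Hop_xvac)
    also have "\<dots> = 0" by (rule xlinearD(3)[OF xlinear_power[OF Hop_linear]])
    finally show ?thesis .
  qed
  then have "exp_H p (xvac r) = div_power (Hop (x_upto p)) 0 (xvac r)"
    unfolding exp_H_def xexp_eq_tsum by (intro tsum_single) (simp add: div_power_def)
  then show ?thesis by simp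
qed

lemma exp_neg_H_xvac: "exp_neg_H p (xvac r) = xvac r"
  using exp_H_inv(2)[of p "xvac r"] by (simp add: exp_H_xvac)

text \<open>The multiplier that a field picks up from \<open>exp_H p\<close>: the product of the 1 -
  x_k z for \<psi>*, and its inverse for \<psi>.\<close>

definition H_factor :: "bool \<Rightarrow> nat \<Rightarrow> gring" where
  "H_factor s p = (\<Prod>k=1..p. zsubst (xvar k) (exp_log s))"

lemma H_factor_inverse: "H_factor s p * H_factor (\<not> s) p = 1"
  unfolding H_factor_def prod.distrib[symmetric]
  by (simp add: exp_log_mult zsubst.S_1 flip: zsubst.S_mult)

lemma exp_H_field: "exp_H p (fermi_field s P V) = fermi_field s (H_factor s p * P) (exp_H p V)"
  by (induction p arbitrary: P V)
    (simp_all add: H_factor_def exp_H_Suc xexp_Hop_field mult_ac)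

lemma exp_neg_H_field: "exp_neg_H p (fermi_field s P V) = fermi_field s (H_factor (\<not> s) p * P) (exp_neg_H p V)"
proof -
  have "fermi_field s P V = exp_H p (fermi_field s (H_factor (\<not> s) p * P) (exp_neg_H p V))"
    using H_factor_inverse[of s p] by (simp add: exp_H_field flip: mult.assoc)
  then show ?thesis by simp
qed

abbreviation (input) exp_Hstar :: "xfock \<Rightarrow> xfock" where
  "exp_Hstar \<equiv> xexp Hstar_beta"

lemmas exp_Hstar_linear = xlinear_xexp[OF Hstar_linear Hstar_nilpotent]

lemma exp_neg_Hstar_inv [simp]: "exp_neg_Hstar (exp_Hstar V) = V" "exp_Hstar (exp_neg_Hstar V) = V"
  by (rule xexp_op_neg[OF Hstar_linear Hstar_nilpotent])+

lemma exp_neg_Hstar_field: "exp_neg_Hstar (fermi_field s P V) = fermi_field s (bsubst (exp_log (\<not> s)) * P) (exp_neg_Hstar V)"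
proof -
  have "fermi_field s P V = exp_Hstar (fermi_field s (bsubst (exp_log (\<not> s)) * P) (exp_neg_Hstar V))"
    by (simp add: xexp_Hstar_field exp_log_mult bsubst.S_1 flip: mult.assoc bsubst.S_mult)
  then show ?thesis by (metis exp_neg_Hstar_inv(1))
qed

text \<open>\<open>eps True p\<close> is the product of the 1 + \<beta> x_k with k \<le> p, and
  \<open>eps False p\<close> is its inverse: the costs of moving \<open>exp_H p\<close> past the
  exponentials of - Hstar and of Hstar.\<close>

definition eps :: "bool \<Rightarrow> nat \<Rightarrow> scalar" where
  "eps s p = (\<Prod>k=1..p. rsubst (- xvar k) (exp_log (\<not> s)))"

lemma rsubst_1: "rsubst y 1 = 1"
  using rsubst_hom(3)[of y 1] by simp

lemma eps_inverse: "eps s p * eps (\<not> s) p = 1"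
  unfolding eps_def prod.distrib[symmetric]
  using exp_log_mult[of s] exp_log_mult[of "\<not> s"]
  by (simp add: rsubst_1 flip: rsubst_hom)

lemma exp_H_exp_neg_Hstar: "exp_H p (exp_neg_Hstar V) = xscale (eps True p) (exp_neg_Hstar (exp_H p V))"
proof (induction p arbitrary: V)
  case (Suc p)
  then show ?case
    by (simp add: exp_H_Suc xexp_Hop_exp_neg_Hstar xlinearD[OF exp_H_linear] eps_def rsubst_exp_log_False
        mult.commute flip: xscale_mult)
qed (simp add: eps_def)

lemma exp_H_exp_Hstar: "exp_H p (exp_Hstar (exp_neg_H p V)) = xscale (eps False p) (exp_Hstar V)"
proof -
  have "V = xscale (eps True p) (exp_neg_Hstar (exp_H p (exp_Hstar (exp_neg_H p V))))"
    using exp_H_exp_neg_Hstar[of p "exp_Hstar (exp_neg_H p V)"] by simp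
  then have "exp_Hstar V = xscale (eps True p) (exp_H p (exp_Hstar (exp_neg_H p V)))"
    by (metis exp_neg_Hstar_inv(2) xlinearD(2)[OF exp_Hstar_linear])
  then show ?thesis
    using eps_inverse[of False p] by (metis xscale_mult xscale_one)
qed

section \<open>Wick's theorem\<close>

abbreviation (input) fermi_fields :: "bool \<Rightarrow> gring list \<Rightarrow> xfock \<Rightarrow> xfock" where
  "fermi_fields s Ps V \<equiv> foldr (fermi_field s) Ps V"

lemma xlinear_fermi_fields: "xlinear (fermi_fields s Ps)"
  by (induction Ps) (simp_all add: xlinear_def xlinearD[OF xlinear_fermi_field])

lemma fermi_fields_scale:
  assumes "\<And>P V. D (fermi_field s P V) = fermi_field s (c * P) (D V)"
  shows "D (fermi_fields s (map P is) V) = fermi_fields s (map (\<lambda>i. c * P i) is) (D V)"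
  by (induction "is") (simp_all add: assms)

text \<open>The field \<psi>* moves right until it annihilates V. Each \<psi> that it passes changes
  the sign and leaves a contraction.\<close>

lemma field_contract:
  assumes "fermi_field False Q V = 0"
  shows "fermi_field False Q (fermi_fields True Ps V) =
    (\<Sum>i<length Ps. xscale ((- 1) ^ i * gcoef (Ps ! i * Q) 0) (fermi_fields True (take i Ps @ drop (Suc i) Ps) V))"
proof (induction Ps)
  case (Cons P Ps)
  let ?W = "fermi_fields True Ps V"
  have "fermi_field False Q (fermi_field True P ?W) =
      xscale (gcoef (P * Q) 0) ?W - fermi_field True P (fermi_field False Q ?W)"
    using fermi_field_anticomm[of P Q ?W] by (simp add: eq_diff_eq add.commute)
  also have "fermi_field True P (fermi_field False Q ?W) =
      (\<Sum>i<length Ps. xscale ((- 1) ^ i * gcoef (Ps ! i * Q) 0)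
        (fermi_field True P (fermi_fields True (take i Ps @ drop (Suc i) Ps) V)))"
    by (simp only: Cons xlinearD[OF xlinear_fermi_field])
  finally show ?case
    by (simp add: sum.lessThan_Suc_shift xscale_uminus sum_negf del: sum.lessThan_Suc)
qed (use assms in simp)

text \<open>Contracting the innermost \<psi>* is the Laplace expansion along the first column.
  Because of \<open>rev\<close> the head of the list is this innermost field, so the tail is left
  for the induction.\<close>

lemma wick:
  assumes "length Ps = length Qs" "\<And>Q. Q \<in> set Qs \<Longrightarrow> fermi_field False Q V = 0"
  shows "fermi_fields False (rev Qs) (fermi_fields True Ps V) =
    xscale (Determinant.det (mat (length Qs) (length Qs) (\<lambda>(i, j). gcoef (Ps ! i * Qs ! j) 0))) V"
  using assms
proof (induction Qs arbitrary: Ps)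
  case Nil
  then show ?case by simp
next
  case (Cons Q Qs)
  let ?n = "length Qs"
  let ?del = "\<lambda>i. take i Ps @ drop (Suc i) Ps"
  define M where "M = mat (Suc ?n) (Suc ?n) (\<lambda>(i, j). gcoef (Ps ! i * (Q # Qs) ! j) 0)"
  have minor: "mat_delete M i 0 = mat ?n ?n (\<lambda>(k, j). gcoef (?del i ! k * Qs ! j) 0)"
    if "i < Suc ?n" for i
    using that Cons.prems(1)
    by (intro eq_matI) (auto simp: M_def mat_delete_def nth_append)
  have "fermi_fields False (rev (Q # Qs)) (fermi_fields True Ps V) =
      fermi_fields False (rev Qs) (fermi_field False Q (fermi_fields True Ps V))"
    by simp
  also have "\<dots> = (\<Sum>i<Suc ?n. xscale ((- 1) ^ i * gcoef (Ps ! i * Q) 0)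
      (fermi_fields False (rev Qs) (fermi_fields True (?del i) V)))"
    using Cons.prems by (simp only: field_contract[OF Cons.prems(2)[OF list.set_intros(1)]]
        xlinearD[OF xlinear_fermi_fields] length_Cons)
  also have "\<dots> = (\<Sum>i<Suc ?n. xscale (M $$ (i, 0) * cofactor M i 0) V)"
  proof (intro sum.cong refl)
    fix i assume i: "i \<in> {..<Suc ?n}"
    then have "length (?del i) = ?n" using Cons.prems(1) by simp
    then have "fermi_fields False (rev Qs) (fermi_fields True (?del i) V) = xscale (Determinant.det (mat_delete M i 0)) V"
      using i Cons.prems(2) by (simp only: minor lessThan_iff) (intro Cons.IH, auto)
    then show "xscale ((- 1) ^ i * gcoef (Ps ! i * Q) 0) (fermi_fields False (rev Qs) (fermi_fields True (?del i) V)) =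
        xscale (M $$ (i, 0) * cofactor M i 0) V"
      using i by (simp add: cofactor_def M_def mult_ac flip: xscale_mult)
  qed
  also have "\<dots> = xscale (Determinant.det M) V"
    by (subst laplace_expansion_column[of M "Suc ?n" 0]) (simp_all add: M_def xscale_sum_left del: sum.lessThan_Suc)
  finally show ?case by (simp add: M_def)
qed

section \<open>Orders in z valid for all powers of \<beta>, and fields annihilating |-r>\<close>

definition zlow :: "int \<Rightarrow> gring \<Rightarrow> bool" where
  "zlow L P \<longleftrightarrow> (\<forall>i. \<forall>n<L. fls_nth (fps_nth P i) n = 0)"

lemma zlow_mult: "zlow L P \<Longrightarrow> zlow L' Q \<Longrightarrow> zlow (L + L') (P * Q)"
  unfolding zlow_def
  by (simp add: fps_mult_nth fls_nth_sum fls_times_nth_bounds[of L _ L'])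

lemma zlow_one: "zlow 0 1"
  by (simp add: zlow_def)

lemma zlow_power: "zlow L P \<Longrightarrow> zlow (int n * L) (P ^ n)"
  by (induction n) (simp_all add: zlow_one distrib_right zlow_mult)

lemma zlow_prod: "(\<And>k. k \<in> A \<Longrightarrow> zlow 0 (P k)) \<Longrightarrow> zlow 0 (\<Prod>k\<in>A. P k)"
  by (induction A rule: infinite_finite_induct) (auto simp: zlow_one intro: zlow_mult[of 0 _ 0, simplified])

lemma zlow_gscal: "zlow 0 (gscal c)"
  by (simp add: zlow_def)

lemma zlow_zpow: "zlow n (zpow n)"
  using gcoef_zpow[of n] by (auto simp: zlow_def zpow_def)

lemma zlow_H_factor: "zlow 0 (H_factor s p)"
  unfolding H_factor_def by (intro zlow_prod) (simp add: zlow_def zsubst_def)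

text \<open>The two-term element 1 + \<beta>/z has an order that is uniform in \<beta>, unlike its
  inverse. This is why it matters which power of it multiplies the fields \<psi>*.\<close>

lemma zlow_bsubst: "zlow (- 1) (bsubst (exp_log False))"
proof -
  have "fls_nth (fps_nth (bsubst (exp_log False)) i) n = 0" if "n < - 1" for i n
    using that
    by (cases i; cases "i - 1")
      (auto simp: bsubst_def fps_subst_def exp_log_def fls_const_0 fls_const_times_nth single_uminus)
  then show ?thesis by (simp add: zlow_def)
qed

lemma fermi_field_xvac:
  assumes "zlow (- int r) Q"
  shows "fermi_field False Q (xvac r) = 0"
proof -
  have "xscale (gcoef Q n) (scalar_extend (fmode False n) (xvac r)) = 0" for n
  proof (cases "n < - int r")
    case True
    then have "gcoef Q n = 0" using assms by (intro fps_ext) (simp add: zlow_def)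
    then show ?thesis by simp
  next
    case False
    then have "scalar_extend (fmode False n) (xvac r) = 0"
      by (intro xfock_eqI)
        (simp add: lookup_scalar_extend fock_linearD[OF fock_linear_fmode] xvac_def lookup_single
          when_def fmode_def act_psi_star_shifted_vac)
    then show ?thesis by simp
  qed
  then show ?thesis by (simp add: fermi_field_def)
qed

lemma xvev_xscale_xvac: "xvev (shifted_covac r) (xscale c (xvac r)) = c"
proof (rule fps_ext)
  fix k
  let ?w = "shifted_covac r" and ?v = "shifted_vac r"
  have "fps_nth (xscale c (xvac r)) k = (\<Sum>i=0..k. if i = k then poly_scale (fps_nth c k) (Poly_Mapping.single 0 ?v) else 0)"
    unfolding xscale_nth xvac_def by (rule sum.cong) auto
  then have "fps_nth (xvev ?w (xscale c (xvac r))) k =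
      Poly_Mapping.map (vev ?w) (poly_scale (fps_nth c k) (Poly_Mapping.single 0 ?v))"
    by (simp add: xvev_def scalar_extend_nth)
  also have "\<dots> = p" if "p = fps_nth c k" for p
    unfolding that[symmetric]
    by (induction p rule: poly_mapping_induct_single)
      (simp_all add: poly_scale_add_left map_add_hom[of "vev ?w", OF vev_linear(1) vev_zero]
        map_single vev_zero vev_linear vev_shifted_vac)
  finally show "fps_nth (xvev ?w (xscale c (xvac r))) k = fps_nth c k" by simp
qed

section \<open>The determinant entries\<close>

text \<open>The series (1 - X)^m for an arbitrary exponent, so that \<open>bsubst\<close> turns it
  into (1 + \<beta>/z)^m.\<close>

definition alt_binomial :: "complex \<Rightarrow> complex fps" where
  "alt_binomial m = Abs_fps (\<lambda>s. (- 1) ^ s * (m gchoose s))"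

lemma alt_binomial_add: "alt_binomial (m + n) = alt_binomial m * alt_binomial n"
proof -
  have "alt_binomial m = fps_binomial m oo (fps_const (- 1) * fps_X)" for m
    by (simp add: alt_binomial_def fps_compose_linear del: fps_const_neg)
  then show ?thesis by (simp add: fps_binomial_add_mult fps_compose_mult_distrib)
qed

lemma alt_binomial_of_nat: "alt_binomial (of_nat n) = exp_log False ^ n"
proof (induction n)
  case 0
  have "alt_binomial 0 = 1"
    by (rule fps_ext) (simp add: alt_binomial_def gbinomial_0_left split: nat.split)
  then show ?case by simp
next
  case (Suc n)
  have "alt_binomial 1 = exp_log False"
  proof (rule fps_ext)
    fix s
    have "(1 :: complex) gchoose s = fps_nth (1 + fps_X) s"
      using fps_binomial_of_nat[of 1] by (metis fps_binomial_nth of_nat_1 power_one_right)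
    then show "fps_nth (alt_binomial 1) s = fps_nth (exp_log False) s"
      by (cases s; cases "s - 1") (simp_all add: alt_binomial_def exp_log_def)
  qed
  then show ?case using Suc by (simp add: alt_binomial_add)
qed

lemma alt_binomial_neg_of_nat: "alt_binomial (- of_nat n) = exp_log True ^ n"
proof -
  have a: "exp_log True ^ n * exp_log False ^ n = 1"
    using exp_log_mult[of True] by (simp flip: power_mult_distrib)
  have b: "alt_binomial (- of_nat n) * exp_log False ^ n = 1"
    using alt_binomial_of_nat[of 0] by (simp flip: alt_binomial_of_nat[of n] alt_binomial_add)
  have "alt_binomial (- of_nat n) = alt_binomial (- of_nat n) * (exp_log True ^ n * exp_log False ^ n)"
    unfolding a by simp
  also have "\<dots> = (alt_binomial (- of_nat n) * exp_log False ^ n) * exp_log True ^ n"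
    by (simp only: mult_ac)
  also have "\<dots> = exp_log True ^ n"
    unfolding b by simp
  finally show ?thesis .
qed

text \<open>The exponents satisfy - r + (i - 1) + (r - j) = (i - j) - 1; the final -1 is kept as a
  separate factor, since it belongs to the series of G.\<close>

lemma exp_log_powers:
  assumes "1 \<le> i" "j \<le> r"
  shows "exp_log True ^ r * exp_log False ^ (i - 1) * exp_log False ^ (r - j) =
    alt_binomial (of_int (int i - int j)) * exp_log True"
proof -
  have "exp_log True ^ r * exp_log False ^ (i - 1) * exp_log False ^ (r - j) =
      alt_binomial (- of_nat r + of_nat (i - 1) + of_nat (r - j))"
    by (simp only: alt_binomial_add alt_binomial_of_nat alt_binomial_neg_of_nat)
  also have "- of_nat r + of_nat (i - 1) + of_nat (r - j) = (of_int (int i - int j) + - of_nat 1 :: complex)"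
    using assms by (simp add: of_nat_diff)
  finally show ?thesis by (simp only: alt_binomial_add alt_binomial_neg_of_nat power_one_right)
qed

text \<open>The sign in \<open>alt_binomial\<close> and the sign of - \<beta>/z cancel.\<close>

lemma bsubst_alt_binomial_nth:
  "fps_nth (bsubst (alt_binomial m)) s = fls_const (Poly_Mapping.single 0 (m gchoose s)) * fls_X_inv ^ s"
proof -
  have "(- fls_X_inv) ^ s = fls_const (Poly_Mapping.single 0 ((- 1) ^ s)) * (fls_X_inv ^ s :: mpoly fls)"
    by (cases "even s") (simp_all add: single_uminus)
  then have "fps_nth (bsubst (alt_binomial m)) s =
      fls_const (Poly_Mapping.single 0 ((- 1) ^ s * (m gchoose s)) * Poly_Mapping.single 0 ((- 1) ^ s)) * fls_X_inv ^ s"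
    by (simp add: bsubst_def fps_subst_def alt_binomial_def mult.assoc flip: fls_const_mult_const)
  also have "Poly_Mapping.single 0 ((- 1) ^ s * (m gchoose s)) * Poly_Mapping.single 0 ((- 1) ^ s) =
      (Poly_Mapping.single 0 (m gchoose s) :: mpoly)"
    by (cases "even s") (simp_all add: mult_single)
  finally show ?thesis .
qed

lemma fls_const_X_inv_times_nth:
  "fls_nth (fls_const c * fls_X_inv ^ s * f) n = c * fls_nth f (n + int s)"
  for c :: "'a::comm_ring_1"
  unfolding mult.assoc fls_const_times_nth by (simp add: fls_X_inv_power_times_conv_shift)

text \<open>The s-th term of (1 + \<beta>/z)^m moves the index from n to n + s and is divisible by
  \<beta>^s. Every coefficient of the partial sums is therefore eventually constant, which is
  convergence in the metric of power series.\<close>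

lemma binomial_series_sums:
  "(\<lambda>s. scalar_const (m gchoose s) * beta ^ s * gcoef G (n + int s)) sums gcoef (bsubst (alt_binomial m) * G) n"
  unfolding sums_def
proof (rule tendsto_fpsI)
  fix k
  let ?t = "\<lambda>s. scalar_const (m gchoose s) * beta ^ s * gcoef G (n + int s)"
  have t: "fps_nth (?t s) k =
      (if k < s then 0 else Poly_Mapping.single 0 (m gchoose s) * fls_nth (fps_nth G (k - s)) (n + int s))" for s
  proof -
    have eq: "?t s = fps_const (Poly_Mapping.single 0 (m gchoose s)) * (gcoef G (n + int s) * beta ^ s)"
      by (simp add: scalar_const_def mult_ac)
    show ?thesis unfolding eq by (simp add: beta_power_nth)
  qed
  have "fps_nth (gcoef (bsubst (alt_binomial m) * G) n) k =
      (\<Sum>s=0..k. Poly_Mapping.single 0 (m gchoose s) * fls_nth (fps_nth G (k - s)) (n + int s))"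
    by (simp only: gcoef_nth fps_mult_nth fls_nth_sum bsubst_alt_binomial_nth fls_const_X_inv_times_nth)
  also have "\<dots> = (\<Sum>s<N. fps_nth (?t s) k)" if "N > k" for N
    unfolding t using that by (intro sum.mono_neutral_cong_left) auto
  finally have "fps_nth (\<Sum>s<N. ?t s) k = fps_nth (gcoef (bsubst (alt_binomial m) * G) n) k" if "N > k" for N
    using that by (simp add: fps_sum_nth)
  then show "\<forall>\<^sub>F N in sequentially. fps_nth (\<Sum>s<N. ?t s) k = fps_nth (gcoef (bsubst (alt_binomial m) * G) n) k"
    using eventually_gt_at_top[of k] by (rule eventually_mono[rotated])
qed

section \<open>Factorisation of the series of the functions G\<close>

lemma gscal_prod: "gscal (\<Prod>k\<in>A. f k) = (\<Prod>k\<in>A. gscal (f k))"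
  by (induction A rule: infinite_finite_induct) (simp_all add: gscal_mult)

lemma unit_inv_bsubst: "unit_inv (1 + g_beta * g_z_inv) = bsubst (exp_log True)"
proof (rule unit_inv_eqI)
  have eq: "bsubst (exp_log False) = 1 + g_beta * g_z_inv"
  proof (rule fps_ext)
    fix n
    show "fps_nth (bsubst (exp_log False)) n = fps_nth (1 + g_beta * g_z_inv) n"
      by (cases n; cases "n - 1")
        (auto simp: bsubst_def fps_subst_def exp_log_def g_beta_def g_z_inv_def single_uminus
          fls_const_0 fls_const_1)
  qed
  show "(1 + g_beta * g_z_inv) * bsubst (exp_log True) = 1"
    unfolding eq[symmetric] bsubst.S_mult[symmetric]
    using exp_log_mult[of False] by (simp add: bsubst.S_1)
qed

lemma zsubst_exp_log_False: "zsubst (xvar k) (exp_log False) = 1 - g_x k * g_z"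
proof -
  have "fps_subst (Poly_Mapping.single 0) (xvar k) (exp_log False) = 1 - fps_const (xvar k) * fps_X"
  proof (rule fps_ext)
    fix n
    show "fps_nth (fps_subst (Poly_Mapping.single 0) (xvar k) (exp_log False)) n =
      fps_nth (1 - fps_const (xvar k) * fps_X) n"
      by (cases n; cases "n - 1") (simp_all add: fps_subst_def exp_log_def single_uminus)
  qed
  then show ?thesis
    by (simp add: zsubst_def g_x_def g_z_def fls_times_fps_to_fls flip: fps_const_sub fps_const_mult)
qed

lemma gscal_rsubst_exp_log_False: "gscal (rsubst (- xvar k) (exp_log False)) = 1 + g_beta * g_x k"
proof -
  have "gscal beta = g_beta"
    by (rule fps_ext) (auto simp: beta_def g_beta_def fls_const_0 fls_const_1)
  then show ?thesis
    by (simp add: rsubst_exp_log_False gscal_add gscal_mult gscal_const g_x_def)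
qed

text \<open>All three cases of the definition are one quotient of full products, over k \<le> p and
  over k \<le> q, after cancellation of the common factors.\<close>

lemma G_series_eq:
  "G_series p (Suc q) = bsubst (exp_log True) * (gscal (eps True p) * H_factor True p) *
    (gscal (eps False q) * H_factor False q)"
proof -
  define F where "F k = (1 + g_beta * g_x k) * unit_inv (1 - g_x k * g_z)" for k
  define F' where "F' k = (1 - g_x k * g_z) * unit_inv (1 + g_beta * g_x k)" for k
  have iz: "unit_inv (1 - g_x k * g_z) = zsubst (xvar k) (exp_log True)" for k
    using exp_log_mult[of False]
    by (intro unit_inv_eqI) (simp add: zsubst.S_1 flip: zsubst_exp_log_False zsubst.S_mult)
  have ib: "unit_inv (1 + g_beta * g_x k) = gscal (rsubst (- xvar k) (exp_log True))" for k
    using exp_log_mult[of False]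
    by (intro unit_inv_eqI)
      (simp add: rsubst_1 flip: gscal_rsubst_exp_log_False gscal_mult rsubst_hom)
  have P: "gscal (eps True p) * H_factor True p = (\<Prod>k=1..p. F k)" for p
    by (simp add: eps_def H_factor_def gscal_prod F_def iz gscal_rsubst_exp_log_False flip: prod.distrib)
  have P': "gscal (eps False q) * H_factor False q = (\<Prod>k=1..q. F' k)" for q
    by (simp add: eps_def H_factor_def gscal_prod F'_def ib zsubst_exp_log_False mult.commute
        flip: prod.distrib)
  have inv: "(\<Prod>k=1..n. F k) * (\<Prod>k=1..n. F' k) = 1" for n
  proof -
    have "(gscal (eps True n) * H_factor True n) * (gscal (eps False n) * H_factor False n) =
        gscal (eps True n * eps (\<not> True) n) * (H_factor True n * H_factor (\<not> True) n)"
      by (simp add: gscal_mult mult_ac)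
    then show ?thesis unfolding P P' by (simp only: eps_inverse H_factor_inverse gscal_one mult_1)
  qed
  have split: "(\<Prod>k=1..n. h k) = (\<Prod>k=1..m. h k) * (\<Prod>k=Suc m..n. h k)"
    if "m \<le> n" for m n and h :: "nat \<Rightarrow> gring"
    using that by (subst prod.union_disjoint[symmetric]) (auto intro: prod.cong)
  have "(if Suc q \<le> p then \<Prod>k=Suc q..p. F k
      else if p = Suc q - 1 then 1
      else \<Prod>k=p + 1..Suc q - 1. F' k) = (\<Prod>k=1..p. F k) * (\<Prod>k=1..q. F' k)"
  proof (cases "q \<le> p")
    case True
    have "(\<Prod>k=1..p. F k) * (\<Prod>k=1..q. F' k) =
        ((\<Prod>k=1..q. F k) * (\<Prod>k=1..q. F' k)) * (\<Prod>k=Suc q..p. F k)"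
      unfolding split[OF True, of F] by (simp only: mult_ac)
    then show ?thesis using True unfolding inv by (cases "p = q") auto
  next
    case False
    then have "p \<le> q" by simp
    have "(\<Prod>k=1..p. F k) * (\<Prod>k=1..q. F' k) =
        ((\<Prod>k=1..p. F k) * (\<Prod>k=1..p. F' k)) * (\<Prod>k=Suc p..q. F' k)"
      unfolding split[OF \<open>p \<le> q\<close>, of F'] by (simp only: mult_ac)
    then show ?thesis using False unfolding inv by auto
  qed
  then show ?thesis
    unfolding G_series_def unit_inv_bsubst P P' F_def F'_def by (simp only: mult.assoc)
qed

section \<open>Moving the exponentials to the right\<close>

lemma compose_list_simps [simp]:
  "compose_list [] = id" "compose_list (T # Ts) = T \<circ> compose_list Ts"
  by (simp_all add: compose_list_def)

text \<open>The additional \<open>exp_H (p s)\<close> in front makes the claim inductive: it cancels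
  the inverse exponential at the head of factor s + 1, whose own \<open>exp_H\<close> then passes
  its field and the exponential of - Hstar and becomes the prefix of the remaining product.\<close>

lemma right_chain:
  assumes F: "\<And>i V. 1 \<le> i \<Longrightarrow> i \<le> r \<Longrightarrow>
      F i V = exp_H (p i) (exp_neg_H (p (i - 1)) (fermi_field True (P i) (exp_neg_Hstar V)))"
    and "s \<le> r"
  shows "exp_H (p s) (compose_list (map F [Suc s..<Suc r]) (xvac r)) =
    fermi_fields True (map (\<lambda>i. bsubst (exp_log False) ^ (i - Suc s) *
      (gscal (eps True (p i)) * (H_factor True (p i) * P i))) [Suc s..<Suc r]) ((exp_neg_Hstar ^^ (r - s)) (xvac r))"
  using \<open>s \<le> r\<close>
proof (induction s rule: inc_induct)
  case base
  then show ?case by (simp add: exp_H_xvac)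
next
  case (step s)
  let ?a = "bsubst (exp_log False)"
  let ?P = "\<lambda>i. gscal (eps True (p i)) * (H_factor True (p i) * P i)"
  let ?R = "compose_list (map F [Suc (Suc s)..<Suc r]) (xvac r)"
  have upt: "[Suc s..<Suc r] = Suc s # [Suc (Suc s)..<Suc r]"
    using step.hyps by (intro upt_conv_Cons) simp
  have "exp_H (p s) (F (Suc s) ?R) = exp_H (p (Suc s)) (fermi_field True (P (Suc s)) (exp_neg_Hstar ?R))"
    using step.hyps by (simp add: F exp_H_commute[of "p s"])
  also have "\<dots> = fermi_field True (?P (Suc s)) (exp_neg_Hstar (exp_H (p (Suc s)) ?R))"
    by (simp add: exp_H_field exp_H_exp_neg_Hstar fermi_field_gscal xlinearD(2)[OF xlinear_fermi_field])
  also have "exp_neg_Hstar (exp_H (p (Suc s)) ?R) =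
      fermi_fields True (map (\<lambda>i. ?a * (?a ^ (i - Suc (Suc s)) * ?P i)) [Suc (Suc s)..<Suc r])
        (exp_neg_Hstar ((exp_neg_Hstar ^^ (r - Suc s)) (xvac r)))"
    unfolding step.IH by (rule fermi_fields_scale) (simp add: exp_neg_Hstar_field)
  also have "map (\<lambda>i. ?a * (?a ^ (i - Suc (Suc s)) * ?P i)) [Suc (Suc s)..<Suc r] =
      map (\<lambda>i. ?a ^ (i - Suc s) * ?P i) [Suc (Suc s)..<Suc r]"
  proof (intro map_cong refl)
    fix i assume "i \<in> set [Suc (Suc s)..<Suc r]"
    then have "i - Suc s = Suc (i - Suc (Suc s))" by auto
    then show "?a * (?a ^ (i - Suc (Suc s)) * ?P i) = ?a ^ (i - Suc s) * ?P i"
      by (simp add: mult.assoc)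
  qed
  also have "exp_neg_Hstar ((exp_neg_Hstar ^^ (r - Suc s)) (xvac r)) = (exp_neg_Hstar ^^ (r - s)) (xvac r)"
    using step.hyps by (simp flip: Suc_diff_Suc)
  finally show ?case by (simp add: upt del: upt_Suc)
qed

text \<open>The prefix \<open>exp_H (q s)\<close> conjugates the exponential of Hstar in factor s,
  which costs the scalar \<open>eps False\<close>. The \<psi> fields are part of the claim because
  each exponential of Hstar runs through them as well and finally cancels one exponential of - Hstar
  on the vacuum.\<close>

lemma left_chain:
  assumes G: "\<And>j V. 1 \<le> j \<Longrightarrow> j \<le> r \<Longrightarrow>
      G j V = fermi_field False (Q j) (exp_Hstar (exp_neg_H (q j) (exp_H (q (j - 1)) V)))"
    and "q 0 = 0" "s \<le> r"
  shows "exp_H (q s) (compose_list (map G (rev [1..<Suc s])) (fermi_fields True Ps ((exp_neg_Hstar ^^ r) (xvac r)))) =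
    fermi_fields False (map (\<lambda>j. bsubst (exp_log False) ^ (s - j) *
      (gscal (eps False (q j)) * (H_factor False (q j) * Q j))) (rev [1..<Suc s]))
      (fermi_fields True (map (\<lambda>P. bsubst (exp_log True) ^ s * P) Ps) ((exp_neg_Hstar ^^ (r - s)) (xvac r)))"
  using \<open>s \<le> r\<close>
proof (induction s)
  case 0
  then show ?case by (simp add: \<open>q 0 = 0\<close>)
next
  case (Suc s)
  let ?a = "bsubst (exp_log False)" and ?b = "bsubst (exp_log True)"
  let ?Q = "\<lambda>j. gscal (eps False (q j)) * (H_factor False (q j) * Q j)"
  let ?X = "compose_list (map G (rev [1..<Suc s])) (fermi_fields True Ps ((exp_neg_Hstar ^^ r) (xvac r)))"
  have upt: "rev [Suc 0..<Suc (Suc s)] = Suc s # rev [Suc 0..<Suc s]" by simp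
  have "exp_H (q (Suc s)) (G (Suc s) ?X) =
      fermi_field False (H_factor False (q (Suc s)) * Q (Suc s))
        (exp_H (q (Suc s)) (exp_Hstar (exp_neg_H (q (Suc s)) (exp_H (q s) ?X))))"
    using Suc.prems by (simp add: G exp_H_field)
  also have "\<dots> = fermi_field False (?Q (Suc s)) (exp_Hstar (exp_H (q s) ?X))"
    by (simp add: exp_H_exp_Hstar fermi_field_gscal xlinearD(2)[OF xlinear_fermi_field])
  also have "exp_Hstar (exp_H (q s) ?X) =
      fermi_fields False (map (\<lambda>j. ?a * (?a ^ (s - j) * ?Q j)) (rev [1..<Suc s]))
        (fermi_fields True (map (\<lambda>P. ?b * (?b ^ s * P)) Ps) (exp_Hstar ((exp_neg_Hstar ^^ (r - s)) (xvac r))))"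
    unfolding Suc.IH[OF Suc_leD[OF Suc.prems]]
    by (simp only: fermi_fields_scale[where D=exp_Hstar and s=False, OF xexp_Hstar_field]
        fermi_fields_scale[where D=exp_Hstar and s=True, OF xexp_Hstar_field])
  also have "map (\<lambda>j. ?a * (?a ^ (s - j) * ?Q j)) (rev [1..<Suc s]) =
      map (\<lambda>j. ?a ^ (Suc s - j) * ?Q j) (rev [1..<Suc s])"
    by (intro map_cong refl) (auto simp: Suc_diff_le mult.assoc)
  also have "exp_Hstar ((exp_neg_Hstar ^^ (r - s)) (xvac r)) = (exp_neg_Hstar ^^ (r - Suc s)) (xvac r)"
    using Suc.prems by (simp flip: Suc_diff_Suc)
  finally show ?case by (simp add: upt mult.assoc del: upt_Suc)
qed

theorem theorem3p2:
  fixes r :: nat and lam mu f g :: "nat \<Rightarrow> nat"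
  assumes "r \<ge> 1"
    and "\<forall>i j. 1 \<le> i \<and> i \<le> j \<and> j \<le> r \<longrightarrow> lam j \<le> lam i"
    and "\<forall>i j. 1 \<le> i \<and> i \<le> j \<and> j \<le> r \<longrightarrow> mu j \<le> mu i"
    and "\<forall>i. 1 \<le> i \<and> i \<le> r \<longrightarrow> mu i \<le> lam i"
    and "\<forall>i. 1 \<le> i \<and> i \<le> r \<longrightarrow> 0 < f i"
    and "\<forall>i. 1 \<le> i \<and> i \<le> r \<longrightarrow> 0 < g i"
  shows "flagged_skew_G r lam mu f g =
    xvev (shifted_covac r)
      ((compose_list (map (\<lambda>j.
            scalar_extend (act (psi_star (int (mu j) - int j)))
            \<circ> xexp (Hstar [- beta])
            \<circ> xexp (op_neg (if j = 1 then Hop (x_upto (g 1 - 1))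
                             else Hquot (g j - 1) (g (j - 1)))))
          (rev [1..<Suc r]))
        \<circ> compose_list (map (\<lambda>i.
            xexp (if i = 1 then Hop (x_upto (f 1)) else Hquot (f i) (f (i - 1) + 1))
            \<circ> scalar_extend (act (psi (int (lam i) - int i)))
            \<circ> xexp (op_neg (Hstar [- beta])))
          [1..<Suc r]))
       (xvac r))"
proof -
  let ?a = "bsubst (exp_log False)" and ?b = "bsubst (exp_log True)"
  \<comment> \<open>The value 0 at index 0 stands for the empty set of variables, whose exponential
    is the identity. The convention for the first factor thus becomes an instance of the general
    formula; the same holds for \<open>q\<close>.\<close>
  define p where "p i = (if i = 0 then 0 else f i)" for i
  define q where "q j = (if j = 0 then 0 else g j - 1)" for j
  define F where "F i = xexp (if i = 1 then Hop (x_upto (f 1)) else Hquot (f i) (f (i - 1) + 1))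
      \<circ> scalar_extend (act (psi (int (lam i) - int i))) \<circ> xexp (op_neg (Hstar [- beta]))" for i
  define G where "G j = scalar_extend (act (psi_star (int (mu j) - int j))) \<circ> xexp (Hstar [- beta])
      \<circ> xexp (op_neg (if j = 1 then Hop (x_upto (g 1 - 1)) else Hquot (g j - 1) (g (j - 1))))" for j
  define P where "P i = gscal (eps True (p i)) * (H_factor True (p i) * zpow (int i - int (lam i)))" for i
  define Q where "Q j = gscal (eps False (q j)) * (H_factor False (q j) * zpow (int (mu j) - int j))" for j
  \<comment> \<open>The left chain leaves \<open>exp_neg_H (q r)\<close> in front of everything.
    Moving it to the vacuum multiplies the two kinds of fields by mutually inverse factors, which
    cancel in each product of a \<open>P'\<close> with a \<open>Q'\<close>.\<close>
  define P' where "P' i = H_factor False (q r) * (?b ^ r * (?a ^ (i - Suc 0) * P i))" for i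
  define Q' where "Q' j = H_factor True (q r) * (?a ^ (r - j) * Q j)" for j
  have F: "F i V = exp_H (p i) (exp_neg_H (p (i - 1)) (fermi_field True (zpow (int i - int (lam i))) (exp_neg_Hstar V)))"
    if "1 \<le> i" for i V
  proof -
    have "fmode True (int i - int (lam i)) = act (psi (int (lam i) - int i))"
      by (simp add: fmode_def)
    then show ?thesis
      using that by (auto simp: F_def p_def xexp_Hquot fermi_field_zpow simp flip: exp_H_def)
  qed
  have G: "G j V = fermi_field False (zpow (int (mu j) - int j)) (exp_Hstar (exp_neg_H (q j) (exp_H (q (j - 1)) V)))"
    if "1 \<le> j" for j V
  proof -
    have "fmode False (int (mu j) - int j) = act (psi_star (int (mu j) - int j))"
      by (simp add: fmode_def)
    then show ?thesis
      using that by (auto simp: G_def q_def xexp_neg_Hquot fermi_field_zpow simp flip: exp_neg_H_def)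
  qed
  define R where "R = compose_list (map F [1..<Suc r]) (xvac r)"
  define X where "X = compose_list (map G (rev [1..<Suc r])) R"
  have R: "R = fermi_fields True (map (\<lambda>i. ?a ^ (i - Suc 0) * P i) [1..<Suc r]) ((exp_neg_Hstar ^^ r) (xvac r))"
    using right_chain[of r F p "\<lambda>i. zpow (int i - int (lam i))" 0] F
    by (simp add: R_def P_def p_def)
  have "exp_H (q r) X = fermi_fields False (map (\<lambda>j. ?a ^ (r - j) * Q j) (rev [1..<Suc r]))
      (fermi_fields True (map (\<lambda>i. ?b ^ r * (?a ^ (i - Suc 0) * P i)) [1..<Suc r]) (xvac r))"
    using left_chain[of r G "\<lambda>j. zpow (int (mu j) - int j)" q r] G
    by (simp add: X_def R Q_def q_def comp_def del: upt_Suc)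
  then have "X = exp_neg_H (q r) (fermi_fields False (map (\<lambda>j. ?a ^ (r - j) * Q j) (rev [1..<Suc r]))
      (fermi_fields True (map (\<lambda>i. ?b ^ r * (?a ^ (i - Suc 0) * P i)) [1..<Suc r]) (xvac r)))"
    by (metis exp_H_inv(2))
  also have "\<dots> = fermi_fields False (map Q' (rev [1..<Suc r])) (fermi_fields True (map P' [1..<Suc r]) (xvac r))"
  proof -
    have U: "exp_neg_H (q r) (fermi_field False P V) = fermi_field False (H_factor True (q r) * P) (exp_neg_H (q r) V)"
      "exp_neg_H (q r) (fermi_field True P V) = fermi_field True (H_factor False (q r) * P) (exp_neg_H (q r) V)" for P V
      by (simp_all add: exp_neg_H_field)
    show ?thesis
      unfolding P'_def Q'_def
      by (simp only: fermi_fields_scale[where D="exp_neg_H (q r)", OF U(1)]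
          fermi_fields_scale[where D="exp_neg_H (q r)", OF U(2)] exp_neg_H_xvac)
  qed
  also have "\<dots> = xscale (Determinant.det (mat r r (\<lambda>(i, j). gcoef (map P' [1..<Suc r] ! i * map Q' [1..<Suc r] ! j) 0))) (xvac r)"
  proof -
    have "fermi_field False (Q' j) (xvac r) = 0" if "1 \<le> j" "j \<le> r" for j
    proof (rule fermi_field_xvac)
      \<comment> \<open>The bound equals (j - r) + (\<mu>_j - j) = \<mu>_j - r, which is at least
        -r.\<close>
      have "zlow (0 + (int (r - j) * - 1 + (0 + (0 + (int (mu j) - int j))))) (Q' j)"
        unfolding Q'_def Q_def
        by (intro zlow_mult zlow_power zlow_H_factor zlow_bsubst zlow_gscal zlow_zpow)
      then show "zlow (- int r) (Q' j)" using that by (auto simp: zlow_def of_nat_diff)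
    qed
    then have "fermi_field False Q (xvac r) = 0" if "Q \<in> set (map Q' [1..<Suc r])" for Q
      using that by auto
    from wick[where Ps="map P' [1..<Suc r]" and Qs="map Q' [1..<Suc r]", OF _ this] show ?thesis
      by (simp add: rev_map del: upt_Suc)
  qed
  finally have "xvev (shifted_covac r) X =
      Determinant.det (mat r r (\<lambda>(i, j). gcoef (map P' [1..<Suc r] ! i * map Q' [1..<Suc r] ! j) 0))"
    by (simp add: xvev_xscale_xvac)
  also have "mat r r (\<lambda>(i, j). gcoef (map P' [1..<Suc r] ! i * map Q' [1..<Suc r] ! j) 0) =
      mat r r (\<lambda>(i, j). flagged_skew_G_entry lam mu f g (Suc i) (Suc j))"
  proof (intro cong_mat refl, clarify)
    fix i' j' assume "i' < r" "j' < r"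
    define i j where "i = Suc i'" and "j = Suc j'"
    have ij: "1 \<le> i" "i \<le> r" "1 \<le> j" "j \<le> r" using \<open>i' < r\<close> \<open>j' < r\<close> by (auto simp: i_def j_def)
    define n where "n = int (lam i) - int (mu j) - int i + int j"
    \<comment> \<open>Positivity of the flag makes the truncated subtraction in \<open>q\<close>
      exact.\<close>
    have gj: "g j = Suc (q j)" using assms(6) ij by (simp add: q_def)
    have pi: "p i = f i" using ij by (simp add: p_def)
    have U: "H_factor False (q r) * H_factor True (q r) = 1"
      using H_factor_inverse[of False "q r"] by simp
    have ab: "?b ^ r * ?a ^ (i - 1) * ?a ^ (r - j) =
        bsubst (alt_binomial (of_int (int i - int j))) * ?b"
      using exp_log_powers[OF ij(1,4)] by (simp only: flip: bsubst.S_power bsubst.S_mult)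
    have "P' i * Q' j = (H_factor False (q r) * H_factor True (q r)) * (?b ^ r * ?a ^ (i - 1) * ?a ^ (r - j)) *
        (gscal (eps True (f i)) * H_factor True (f i)) * (gscal (eps False (q j)) * H_factor False (q j)) *
        (zpow (int i - int (lam i)) * zpow (int (mu j) - int j))"
      by (simp add: P'_def Q'_def P_def Q_def pi mult_ac)
    \<comment> \<open>The two monomials multiply to z^(-n), so the coefficient of z^0 of the product
      is the coefficient of z^n of the remaining series.\<close>
    also have "\<dots> = zpow (- n) * (bsubst (alt_binomial (of_int (int i - int j))) * G_series (f i) (g j))"
      unfolding U ab gj G_series_eq by (simp add: n_def algebra_simps flip: zpow_add)
    finally have "gcoef (P' i * Q' j) 0 =
        gcoef (bsubst (alt_binomial (of_int (int i - int j))) * G_series (f i) (g j)) n"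
      by (simp add: gcoef_zpow_mult)
    also have "\<dots> = flagged_skew_G_entry lam mu f g i j"
      unfolding flagged_skew_G_entry_def G_fun_def gcoef_def[symmetric] n_def
      by (rule sums_unique[OF binomial_series_sums])
    finally show "gcoef (map P' [1..<Suc r] ! i' * map Q' [1..<Suc r] ! j') 0 =
        flagged_skew_G_entry lam mu f g (Suc i') (Suc j')"
      using \<open>i' < r\<close> \<open>j' < r\<close> by (simp add: i_def j_def del: upt_Suc)
  qed
  finally show ?thesis
    by (simp only: flagged_skew_G_def X_def R_def F_def[abs_def] G_def[abs_def] comp_apply)
qed

end
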